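(* Let $\Omega\subset\mathbb R^N$ be a bounded $C^1$-domain that is starshaped (with respect to the origin $0\in\Omega$), let $1<p<q<N$ with $q/p\le N/(N-1)$, let $0\le a\in C^1(\Omega)$ be radial and radially nondecreasing, and let $$f(x,u)=c(x)|u|^{r-2}u+\mu|u|^{p^*-2}u+b(x)|u|^{q^*-2}u,$$ with $\mu\ge0$, $0\le b\in L^\infty(\Omega)$ satisfying $a_0:=\inf_{x\in\operatorname{supp}(b)}a(x)>0$ ($a_0=+\infty$ if $b\equiv0$), and $0\le c\in C(\bar\Omega)\setminus\{0\}$. Let $b_\infty=|b|_\infty$. Then there exists a positive constant $\kappa=\kappa(\Omega,p,q,r,a,c,\mu,b_\infty)$ such that the problem $$-\operatorname{div}\left(|\nabla u|^{p-2}\nabla u+a(x)|\nabla u|^{q-2}\nabla u\right)=f(x,u)\ \text{ in }\Omega,\qquad u=0\ \text{ on }\partial\Omega,$$ does not admit a nonzero weak solution $u\in W^{1,\mathcal A}_0(\Omega)\cap W^{2,\mathcal A}(\Omega)$ belonging to the ball $\{u:\|u\|\le\kappa\}$ in each of the following cases: (i) $p<r\le p^*$; (ii) $p^*<r<q^*$ and there is a constant $C>0$ such that $c(x)\le C\,a(x)^{r/q}$ for a.a. $x\in\Omega$; (iii) $p^*<r<q^*$ and $a_0':=\inf_{x\in\operatorname{supp}(c)}a(x)>0$.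
   Context: $N\ge2$; $a\in L^\infty(\Omega)\cap C^{0,\frac Np(q-p)}(\Omega)$ is a standing assumption. $p^*=Np/(N-p)$, $q^*=Nq/(N-q)$; $|\cdot|_\infty$ is the norm of $L^\infty(\Omega)$. Let $\mathcal A(x,t)=t^p+a(x)t^q$ and $\rho_{\mathcal A}(u)=\int_\Omega\mathcal A(x,|u|)\,dx$. $L^{\mathcal A}(\Omega)$ is the space of measurable $u:\Omega\to\mathbb R$ with $\rho_{\mathcal A}(u)<\infty$, with the Luxemburg norm $\|u\|_{\mathcal A}=\inf\{\tau>0:\rho_{\mathcal A}(u/\tau)\le1\}$. $W^{1,\mathcal A}(\Omega)$ is the space of $u\in L^{\mathcal A}(\Omega)$ with $|\nabla u|\in L^{\mathcal A}(\Omega)$, normed by $\|u\|_{\mathcal A}+\|\,|\nabla u|\,\|_{\mathcal A}$; $W^{1,\mathcal A}_0(\Omega)$ is the completion of $C_0^\infty(\Omega)$ in $W^{1,\mathcal A}(\Omega)$, renormed by $\|u\|=\|\,|\nabla u|\,\|_{\mathcal A}$; $W^{2,\mathcal A}(\Omega)$ is the space of measurable $u$ with $|\nabla^ku|\in L^{\mathcal A}(\Omega)$ for $k=0,1,2$. A weak solution is $u\in W^{1,\mathcal A}_0(\Omega)$ with $\int_\Omega(|\nabla u|^{p-2}+a(x)|\nabla u|^{q-2})\nabla u\cdot\nabla v\,dx=\int_\Omega f(x,u)v\,dx$ for all $v\in W^{1,\mathcal A}_0(\Omega)$.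
   Formalization: The constant κ is also allowed to depend on a_0 (it is uniform over all b with the same b_∞ and the same a_0); independence of a_0 is false: for b concentrated near a zero of a at the origin, with b_∞ fixed, there are nonzero solutions of arbitrarily small norm. *)

theory Defs
  imports "HOL-Analysis.Analysis" "HOL-Probability.Essential_Supremum"
begin

section \<open>Classical regularity\<close>

text \<open>Intended for open \<open>S\<close>; the derivatives are full gradients, not derivatives within \<open>S\<close>.\<close>

primrec Ck_on :: "nat \<Rightarrow> (real^'n) set \<Rightarrow> (real^'n \<Rightarrow> real) \<Rightarrow> bool" where
  "Ck_on 0 S f \<longleftrightarrow> continuous_on S f"
| "Ck_on (Suc k) S f \<longleftrightarrow>
     (\<exists>g. (\<forall>x\<in>S. GDERIV f x :> g x) \<and> (\<forall>i. Ck_on k S (\<lambda>x. g x $ i)))"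

definition holder_on :: "real \<Rightarrow> (real^'n) set \<Rightarrow> (real^'n \<Rightarrow> real) \<Rightarrow> bool" where
  "holder_on \<alpha> S f \<longleftrightarrow> (\<exists>L\<ge>0. \<forall>x\<in>S. \<forall>y\<in>S. \<bar>f x - f y\<bar> \<le> L * norm (x - y) powr \<alpha>)"

text \<open>\<open>C\<^sub>0\<^sup>\<infinity>(\<Omega>)\<close>, its members being extended by zero to the whole space.\<close>

definition test_functions :: "(real^'n) set \<Rightarrow> (real^'n \<Rightarrow> real) set" where
  "test_functions \<Omega> = {\<phi>. (\<forall>k. Ck_on k UNIV \<phi>) \<and>
     compact (closure {x. \<phi> x \<noteq> 0}) \<and> closure {x. \<phi> x \<noteq> 0} \<subseteq> \<Omega>}"

text \<open>Near each boundary point the domain lies strictly above the graph of a \<open>C\<^sup>1\<close> function.  The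
  rotated coordinate system is given by its vertical direction \<open>e\<close>; a function of the remaining
  \<open>N - 1\<close> coordinates is a function on the whole space that is constant along \<open>e\<close>.\<close>

definition C1_domain :: "(real^'n) set \<Rightarrow> bool" where
  "C1_domain \<Omega> \<longleftrightarrow> open \<Omega> \<and> connected \<Omega> \<and> \<Omega> \<noteq> {} \<and>
     (\<forall>x0\<in>frontier \<Omega>. \<exists>\<rho>>0. \<exists>e \<gamma>. norm e = 1 \<and> Ck_on 1 UNIV \<gamma> \<and>
        (\<forall>x t. \<gamma> (x + t *\<^sub>R e) = \<gamma> x) \<and>
        \<Omega> \<inter> ball x0 \<rho> = {x \<in> ball x0 \<rho>. \<gamma> x < x \<bullet> e})"

definition starshaped_origin :: "(real^'n) set \<Rightarrow> bool" where
  "starshaped_origin \<Omega> \<longleftrightarrow> 0 \<in> \<Omega> \<and> (\<forall>x\<in>\<Omega>. closed_segment 0 x \<subseteq> \<Omega>)"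

definition radial_nondecreasing_on :: "(real^'n) set \<Rightarrow> (real^'n \<Rightarrow> real) \<Rightarrow> bool" where
  "radial_nondecreasing_on \<Omega> f \<longleftrightarrow>
     (\<exists>g. (\<forall>x\<in>\<Omega>. f x = g (norm x)) \<and> mono_on (norm ` \<Omega>) g)"


section \<open>Bounded measurable functions\<close>

definition Linf :: "(real^'n) set \<Rightarrow> (real^'n \<Rightarrow> real) set" where
  "Linf \<Omega> = {f \<in> borel_measurable (lebesgue_on \<Omega>).
     esssup (lebesgue_on \<Omega>) (\<lambda>x. ereal \<bar>f x\<bar>) < \<infinity>}"

definition Linf_norm :: "(real^'n) set \<Rightarrow> (real^'n \<Rightarrow> real) \<Rightarrow> real" where
  "Linf_norm \<Omega> f = real_of_ereal (esssup (lebesgue_on \<Omega>) (\<lambda>x. ereal \<bar>f x\<bar>))"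

text \<open>The support of a measurable function, relative to \<open>\<Omega>\<close>: the complement in \<open>\<Omega>\<close> of the largest
  open set on which the function vanishes almost everywhere.  For a continuous function this is
  the closure in \<open>\<Omega>\<close> of the set where it does not vanish.\<close>

definition support_in :: "(real^'n) set \<Rightarrow> (real^'n \<Rightarrow> real) \<Rightarrow> (real^'n) set" where
  "support_in \<Omega> f =
     {x\<in>\<Omega>. \<forall>\<epsilon>>0. \<not> (AE y in lebesgue_on \<Omega>. y \<in> ball x \<epsilon> \<longrightarrow> f y = 0)}"

text \<open>The infimum of \<open>a\<close> over the support of \<open>f\<close>, in the extended reals, so that it is
  \<open>\<infinity>\<close> if \<open>f\<close> vanishes almost everywhere.\<close>

definition inf_on_support ::
    "(real^'n) set \<Rightarrow> (real^'n \<Rightarrow> real) \<Rightarrow> (real^'n \<Rightarrow> real) \<Rightarrow> ereal" where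
  "inf_on_support \<Omega> a f = (INF x\<in>support_in \<Omega> f. ereal (a x))"


section \<open>Weak derivatives\<close>

definition locally_integrable_on :: "(real^'n \<Rightarrow> 'b::euclidean_space) \<Rightarrow> (real^'n) set \<Rightarrow> bool"
  where "locally_integrable_on f \<Omega> \<longleftrightarrow>
     (\<forall>K. compact K \<and> K \<subseteq> \<Omega> \<longrightarrow> f absolutely_integrable_on K)"

definition has_weak_gradient ::
    "(real^'n) set \<Rightarrow> (real^'n \<Rightarrow> real) \<Rightarrow> (real^'n \<Rightarrow> real^'n) \<Rightarrow> bool" where
  "has_weak_gradient \<Omega> u g \<longleftrightarrow>
     locally_integrable_on u \<Omega> \<and> locally_integrable_on g \<Omega> \<and>
     (\<forall>\<phi>\<in>test_functions \<Omega>. \<forall>\<phi>'. (\<forall>x. GDERIV \<phi> x :> \<phi>' x) \<longrightarrow>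
        (LINT x|lebesgue_on \<Omega>. u x *\<^sub>R \<phi>' x) = - (LINT x|lebesgue_on \<Omega>. \<phi> x *\<^sub>R g x))"

definition weakly_differentiable :: "(real^'n) set \<Rightarrow> (real^'n \<Rightarrow> real) \<Rightarrow> bool" where
  "weakly_differentiable \<Omega> u \<longleftrightarrow> (\<exists>g. has_weak_gradient \<Omega> u g)"

text \<open>A weak gradient is unique only up to null sets; one representative is chosen.\<close>

definition weak_grad :: "(real^'n) set \<Rightarrow> (real^'n \<Rightarrow> real) \<Rightarrow> real^'n \<Rightarrow> real^'n" where
  "weak_grad \<Omega> u = (SOME g. has_weak_gradient \<Omega> u g)"

definition weak_hessian :: "(real^'n) set \<Rightarrow> (real^'n \<Rightarrow> real) \<Rightarrow> real^'n \<Rightarrow> real^'n^'n" where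
  "weak_hessian \<Omega> u x = (\<chi> i. weak_grad \<Omega> (\<lambda>y. weak_grad \<Omega> u y $ i) x)"


section \<open>Musielak-Orlicz and Musielak-Orlicz-Sobolev spaces of double phase type\<close>

definition modular ::
    "(real^'n) set \<Rightarrow> real \<Rightarrow> real \<Rightarrow> (real^'n \<Rightarrow> real) \<Rightarrow> (real^'n \<Rightarrow> real) \<Rightarrow> ennreal" where
  "modular \<Omega> p q a u =
     (\<integral>\<^sup>+x. ennreal (\<bar>u x\<bar> powr p + a x * \<bar>u x\<bar> powr q) \<partial>lebesgue_on \<Omega>)"

definition LA ::
    "(real^'n) set \<Rightarrow> real \<Rightarrow> real \<Rightarrow> (real^'n \<Rightarrow> real) \<Rightarrow> (real^'n \<Rightarrow> real) set" where
  "LA \<Omega> p q a = {u \<in> borel_measurable (lebesgue_on \<Omega>). modular \<Omega> p q a u < \<infinity>}"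

definition LA_norm ::
    "(real^'n) set \<Rightarrow> real \<Rightarrow> real \<Rightarrow> (real^'n \<Rightarrow> real) \<Rightarrow> (real^'n \<Rightarrow> real) \<Rightarrow> real" where
  "LA_norm \<Omega> p q a u = Inf {\<tau>. \<tau> > 0 \<and> modular \<Omega> p q a (\<lambda>x. u x / \<tau>) \<le> 1}"

definition W1A ::
    "(real^'n) set \<Rightarrow> real \<Rightarrow> real \<Rightarrow> (real^'n \<Rightarrow> real) \<Rightarrow> (real^'n \<Rightarrow> real) set" where
  "W1A \<Omega> p q a = {u \<in> LA \<Omega> p q a.
     weakly_differentiable \<Omega> u \<and> (\<lambda>x. norm (weak_grad \<Omega> u x)) \<in> LA \<Omega> p q a}"

definition W1A_norm ::
    "(real^'n) set \<Rightarrow> real \<Rightarrow> real \<Rightarrow> (real^'n \<Rightarrow> real) \<Rightarrow> (real^'n \<Rightarrow> real) \<Rightarrow> real" where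
  "W1A_norm \<Omega> p q a u =
     LA_norm \<Omega> p q a u + LA_norm \<Omega> p q a (\<lambda>x. norm (weak_grad \<Omega> u x))"

text \<open>The completion of \<open>C\<^sub>0\<^sup>\<infinity>(\<Omega>)\<close> in the Banach space \<open>W1A\<close>, i.e. its closure there.\<close>

definition W01A ::
    "(real^'n) set \<Rightarrow> real \<Rightarrow> real \<Rightarrow> (real^'n \<Rightarrow> real) \<Rightarrow> (real^'n \<Rightarrow> real) set" where
  "W01A \<Omega> p q a = {u \<in> W1A \<Omega> p q a.
     \<forall>\<epsilon>>0. \<exists>\<phi>\<in>test_functions \<Omega>. W1A_norm \<Omega> p q a (\<lambda>x. u x - \<phi> x) < \<epsilon>}"

definition W01A_norm ::
    "(real^'n) set \<Rightarrow> real \<Rightarrow> real \<Rightarrow> (real^'n \<Rightarrow> real) \<Rightarrow> (real^'n \<Rightarrow> real) \<Rightarrow> real" where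
  "W01A_norm \<Omega> p q a u = LA_norm \<Omega> p q a (\<lambda>x. norm (weak_grad \<Omega> u x))"

text \<open>The norm of the Hessian as an element of \<^typ>\<open>real^'n^'n\<close> is its Frobenius norm.\<close>

definition W2A ::
    "(real^'n) set \<Rightarrow> real \<Rightarrow> real \<Rightarrow> (real^'n \<Rightarrow> real) \<Rightarrow> (real^'n \<Rightarrow> real) set" where
  "W2A \<Omega> p q a = {u \<in> W1A \<Omega> p q a.
     (\<forall>i. weakly_differentiable \<Omega> (\<lambda>x. weak_grad \<Omega> u x $ i)) \<and>
     (\<lambda>x. norm (weak_hessian \<Omega> u x)) \<in> LA \<Omega> p q a}"


section \<open>The problem\<close>

definition crit_exp :: "real \<Rightarrow> real \<Rightarrow> real" where
  "crit_exp N s = N * s / (N - s)"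

definition flux :: "real \<Rightarrow> real \<Rightarrow> (real^'n \<Rightarrow> real) \<Rightarrow> real^'n \<Rightarrow> real^'n \<Rightarrow> real^'n" where
  "flux p q a x \<xi> = (norm \<xi> powr (p - 2) + a x * norm \<xi> powr (q - 2)) *\<^sub>R \<xi>"

text \<open>Both integrals are required to exist, since \<open>LINT\<close> is \<open>0\<close> on non-integrable functions.\<close>

definition weak_solution :: "(real^'n) set \<Rightarrow> real \<Rightarrow> real \<Rightarrow> (real^'n \<Rightarrow> real) \<Rightarrow>
    (real^'n \<Rightarrow> real \<Rightarrow> real) \<Rightarrow> (real^'n \<Rightarrow> real) \<Rightarrow> bool" where
  "weak_solution \<Omega> p q a f u \<longleftrightarrow> u \<in> W01A \<Omega> p q a \<and>
     (\<forall>v\<in>W01A \<Omega> p q a.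
        integrable (lebesgue_on \<Omega>) (\<lambda>x. flux p q a x (weak_grad \<Omega> u x) \<bullet> weak_grad \<Omega> v x) \<and>
        integrable (lebesgue_on \<Omega>) (\<lambda>x. f x (u x) * v x) \<and>
        (LINT x|lebesgue_on \<Omega>. flux p q a x (weak_grad \<Omega> u x) \<bullet> weak_grad \<Omega> v x) =
        (LINT x|lebesgue_on \<Omega>. f x (u x) * v x))"

definition nonlinearity :: "real \<Rightarrow> real \<Rightarrow> real \<Rightarrow> real \<Rightarrow> (real^'n \<Rightarrow> real) \<Rightarrow>
    (real^'n \<Rightarrow> real) \<Rightarrow> real^'n \<Rightarrow> real \<Rightarrow> real" where
  "nonlinearity p q r \<mu> c b x t =
     c x * \<bar>t\<bar> powr (r - 2) * t
     + \<mu> * \<bar>t\<bar> powr (crit_exp (real CARD('n)) p - 2) * t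
     + b x * \<bar>t\<bar> powr (crit_exp (real CARD('n)) q - 2) * t"

end

theory Submission
  imports Defs
begin

text \<open>Since \<open>r > p\<close> (and \<open>r > q\<close> when \<open>r > p\<^sup>*\<close>, because \<open>q / p \<le> N / (N - 1)\<close> forces \<open>q < p\<^sup>*\<close>), no
  Pohozaev-type identity is needed.  Testing the equation with \<open>u\<close> itself gives
  \<open>E = \<integral> |\<nabla>u|\<^sup>p + a |\<nabla>u|\<^sup>q = \<integral> f(x, u) u\<close>, and every term on the right is bounded by a power of \<open>E\<close>
  with exponent greater than \<open>1\<close>; hence \<open>E = 0\<close> once \<open>E\<close> is small.  The bounds come from the Sobolev
  inequality for \<open>|u|\<close> in terms of \<open>|\<nabla>u|\<^sup>p\<close>, and from its weighted version for \<open>a\<^sup>1\<^sup>/\<^sup>q |u|\<close> in terms of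
  \<open>a |\<nabla>u|\<^sup>q\<close>.  The latter holds because the weight is radially nondecreasing: in the
  Gagliardo--Nirenberg argument one integrates along each coordinate line in the direction that
  moves away from the origin, where the weight only grows.\<close>

section \<open>Powers in the extended nonnegative reals and the Gagliardo--Nirenberg inequality\<close>

text \<open>Applying the Sobolev inequality to \<open>a powr (1 / q) * u\<close> would produce a
  gradient of the weight, which the energy does not control. Shifting the weight along outward rays
  costs nothing and still gives the exponent q*/q = N/(N - q). Every term is then superlinear in E:
  of order N/(N - p) for \<open>\<mu>\<close>, N/(N - q) for \<open>b\<close> after the comparison b
  \<le> K a^(q*/q), and r/p or r/q for \<open>c\<close>, by interpolation on a set of finite
  measure. The constants see \<open>b\<close> only through \<open>a0\<close> and
  \<open>b_inf\<close>, so the radius is fixed before \<open>b\<close>. Two obstacles shape the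
  rest. Elements of \<open>W01A\<close> are limits of test functions in a Luxemburg norm and
  \<open>weak_grad\<close> is an arbitrary representative, so smallness of norms must be turned into
  integral bounds and weak gradients must be shown unique up to null sets. Moreover, the Sobolev
  argument absorbs a power of its own left side, which requires that side to be finite; it is
  therefore carried out for test functions and transferred by Fatou's lemma.\<close>

text \<open>In contrast to \<open>powr\<close>, zero to the power zero is \<open>1\<close> here.\<close>

definition epow :: "ennreal \<Rightarrow> real \<Rightarrow> ennreal" where
  "epow x p = (if p = 0 then 1 else if x = top then top else ennreal (enn2real x powr p))"

lemma measurable_epow [measurable]:
  assumes [measurable]: "f \<in> borel_measurable M"
  shows "(\<lambda>x. epow (f x) p) \<in> borel_measurable M"
  unfolding epow_def by measurable

lemma epow_0 [simp]: "epow x 0 = 1"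
  by (simp add: epow_def)

lemma epow_1 [simp]: "epow x 1 = x"
  by (cases x) (auto simp: epow_def)

lemma epow_top [simp]: "p \<noteq> 0 \<Longrightarrow> epow top p = top"
  by (simp add: epow_def)

lemma epow_ennreal: "0 \<le> x \<Longrightarrow> p \<noteq> 0 \<Longrightarrow> epow (ennreal x) p = ennreal (x powr p)"
  by (simp add: epow_def)

lemma epow_eq_0_iff: "epow x p = 0 \<longleftrightarrow> x = 0 \<and> p \<noteq> 0"
  by (cases x) (auto simp: epow_def)

lemma epow_eq_top_iff: "epow x p = top \<longleftrightarrow> x = top \<and> p \<noteq> 0"
  by (cases x) (auto simp: epow_def)

lemma epow_mono: "0 \<le> p \<Longrightarrow> x \<le> y \<Longrightarrow> epow x p \<le> epow y p"
  by (cases x; cases y) (auto simp: epow_def top_unique intro!: powr_mono2)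

lemma epow_mult:
  assumes "0 \<le> p" shows "epow (x * y) p = epow x p * epow y p"
proof (cases "p = 0")
  case False
  with assms have "p > 0" by simp
  then show ?thesis
    by (cases x; cases y)
      (auto simp: epow_def powr_mult ennreal_mult ennreal_top_mult ennreal_mult_top
        simp flip: ennreal_mult split: if_splits)
qed simp

lemma epow_add:
  assumes "0 \<le> p" "0 \<le> r" shows "epow x (p + r) = epow x p * epow x r"
  using assms by (cases x) (auto simp: epow_def powr_add ennreal_mult' ennreal_top_mult ennreal_mult_top add_nonneg_eq_0_iff)

section \<open>Weighted AM-GM and Hoelder's inequality for finitely many factors\<close>

lemma weighted_AM_GM:
  fixes x p :: "'i \<Rightarrow> real"
  assumes "finite S" "\<And>i. i \<in> S \<Longrightarrow> 0 < p i" "(\<Sum>i\<in>S. p i) = 1" "\<And>i. i \<in> S \<Longrightarrow> 0 \<le> x i"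
  shows "(\<Prod>i\<in>S. x i powr p i) \<le> (\<Sum>i\<in>S. p i * x i)"
proof (cases "\<exists>i\<in>S. x i = 0")
  case True
  then have "(\<Prod>i\<in>S. x i powr p i) = 0" using assms(1) by (auto simp: prod_zero_iff)
  moreover have "0 \<le> (\<Sum>i\<in>S. p i * x i)" using assms by (intro sum_nonneg mult_nonneg_nonneg) (auto simp: less_imp_le)
  ultimately show ?thesis by simp
next
  case False
  then have pos: "0 < x i" if "i \<in> S" for i using assms(4)[OF that] that by fastforce
  \<comment> \<open>Jensen's inequality for exp at the points ln x_i. The case of a vanishing x_i
    was split off because exp (ln x_i) = x_i needs x_i > 0.\<close>
  have "exp (\<Sum>i\<in>S. p i *\<^sub>R ln (x i)) \<le> (\<Sum>i\<in>S. p i * exp (ln (x i)))"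
    using assms by (intro convex_on_sum[OF _ _ exp_convex])
      (auto simp: less_imp_le)
  also have "(\<Sum>i\<in>S. p i * exp (ln (x i))) = (\<Sum>i\<in>S. p i * x i)"
    using pos by (intro sum.cong) auto
  also have "exp (\<Sum>i\<in>S. p i *\<^sub>R ln (x i)) = (\<Prod>i\<in>S. x i powr p i)"
    using assms(1) pos by (subst exp_sum) (auto intro!: prod.cong simp: powr_def dest!: pos)
  finally show ?thesis .
qed

lemma weighted_AM_GM_epow:
  fixes x :: "'i \<Rightarrow> ennreal"
  assumes "finite S" "\<And>i. i \<in> S \<Longrightarrow> 0 < p i" "(\<Sum>i\<in>S. p i) = 1"
  shows "(\<Prod>i\<in>S. epow (x i) (p i)) \<le> (\<Sum>i\<in>S. ennreal (p i) * x i)"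
proof (cases "\<exists>i\<in>S. x i = top")
  case True
  then obtain i where i: "i \<in> S" "x i = top" by blast
  then have "ennreal (p i) * x i = top" using assms(2)[of i] by (simp add: ennreal_mult_top)
  then have "(\<Sum>i\<in>S. ennreal (p i) * x i) = top" using i assms(1)
    by (subst sum.remove[of S i]) auto
  then show ?thesis by simp
next
  case False
  define y where "y i = enn2real (x i)" for i
  have xy: "x i = ennreal (y i)" "0 \<le> y i" if "i \<in> S" for i
    using False that by (auto simp: y_def less_top)
  have "(\<Prod>i\<in>S. epow (x i) (p i)) = (\<Prod>i\<in>S. ennreal (y i powr p i))"
    using xy assms(2) by (intro prod.cong) (auto simp: epow_ennreal less_imp_neq[symmetric] intro!: epow_ennreal)
  also have "\<dots> = ennreal (\<Prod>i\<in>S. y i powr p i)" by (simp add: prod_ennreal)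
  also have "\<dots> \<le> ennreal (\<Sum>i\<in>S. p i * y i)"
    using assms xy by (intro ennreal_leI weighted_AM_GM) auto
  also have "\<dots> = (\<Sum>i\<in>S. ennreal (p i * y i))"
    using assms xy by (intro sum_ennreal[symmetric]) (auto simp: less_imp_le)
  also have "\<dots> = (\<Sum>i\<in>S. ennreal (p i) * x i)"
    using assms xy by (intro sum.cong) (auto simp: ennreal_mult less_imp_le)
  finally show ?thesis .
qed

text \<open>Dividing each factor by its integral \<open>A i\<close> reduces the claim to factors of
  integral 1, for which integrating the weighted AM-GM inequality gives the bound \<Sum> p_i = 1.
  This needs every \<open>A i\<close> to be nonzero and finite. Positivity of the exponents settles
  the degenerate cases: a zero \<open>A i\<close> makes the integrand vanish almost everywhere, and
  an infinite one, with none of them zero, makes the right side infinite.\<close>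

lemma nn_integral_prod_Holder_pos:
  fixes f :: "'i \<Rightarrow> 'a \<Rightarrow> ennreal"
  assumes fin: "finite S" and p: "\<And>i. i \<in> S \<Longrightarrow> 0 < p i" "(\<Sum>i\<in>S. p i) = 1"
    and [measurable]: "\<And>i. i \<in> S \<Longrightarrow> f i \<in> borel_measurable M"
  shows "(\<integral>\<^sup>+x. (\<Prod>i\<in>S. epow (f i x) (p i)) \<partial>M) \<le> (\<Prod>i\<in>S. epow (\<integral>\<^sup>+x. f i x \<partial>M) (p i))"
proof -
  define A where "A i = (\<integral>\<^sup>+x. f i x \<partial>M)" for i
  consider i where "i \<in> S" "A i = 0" | i where "i \<in> S" "A i = top" "\<And>j. j \<in> S \<Longrightarrow> A j \<noteq> 0"
    | "\<And>j. j \<in> S \<Longrightarrow> A j \<noteq> 0 \<and> A j \<noteq> top" by blast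
  then show ?thesis
  proof cases
    case 1
    then have "AE x in M. f i x = 0"
      by (subst (asm) A_def) (auto simp: nn_integral_0_iff_AE)
    then have "AE x in M. (\<Prod>i\<in>S. epow (f i x) (p i)) = 0"
      by eventually_elim (use 1 p(1)[OF 1(1)] fin in \<open>auto intro!: bexI[of _ i] simp: epow_eq_0_iff\<close>)
    then have "(\<integral>\<^sup>+x. (\<Prod>i\<in>S. epow (f i x) (p i)) \<partial>M) = 0"
      by (subst nn_integral_0_iff_AE) auto
    then show ?thesis by simp
  next
    case 2
    have "(\<Prod>i\<in>S. epow (A i) (p i)) = top"
      unfolding ennreal_prod_eq_top using 2 p fin by (force simp: epow_eq_0_iff epow_eq_top_iff)
    then show ?thesis by (simp add: A_def)
  next
    case 3
    have "(\<Prod>i\<in>S. epow (f i x) (p i)) =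
        (\<Prod>i\<in>S. epow (A i) (p i)) * (\<Prod>i\<in>S. epow (f i x / A i) (p i))" for x
      unfolding prod.distrib[symmetric]
    proof (intro prod.cong refl)
      fix i assume i: "i \<in> S"
      have "f i x = A i * (f i x / A i)" using 3[OF i]
        by (metis ennreal_mult_divide_eq ennreal_times_divide mult.commute)
      then show "epow (f i x) (p i) = epow (A i) (p i) * epow (f i x / A i) (p i)"
        using p(1)[OF i] by (metis epow_mult less_imp_le)
    qed
    then have "(\<integral>\<^sup>+x. (\<Prod>i\<in>S. epow (f i x) (p i)) \<partial>M) =
      (\<Prod>i\<in>S. epow (A i) (p i)) * (\<integral>\<^sup>+x. (\<Prod>i\<in>S. epow (f i x / A i) (p i)) \<partial>M)"
      by (simp add: nn_integral_cmult)
    also have "(\<integral>\<^sup>+x. (\<Prod>i\<in>S. epow (f i x / A i) (p i)) \<partial>M)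
        \<le> (\<integral>\<^sup>+x. (\<Sum>i\<in>S. ennreal (p i) * (f i x / A i)) \<partial>M)"
      using fin p by (intro nn_integral_mono weighted_AM_GM_epow)
    also have "\<dots> = (\<Sum>i\<in>S. ennreal (p i) * (A i / A i))"
      by (simp add: nn_integral_sum nn_integral_cmult nn_integral_divide A_def)
    also have "\<dots> = (\<Sum>i\<in>S. ennreal (p i))"
      using 3 by (intro sum.cong) (auto simp: less_top)
    also have "\<dots> = 1"
      using p by (subst sum_ennreal) (auto simp: less_imp_le)
    finally show ?thesis by (simp add: A_def mult_left_mono)
  qed
qed

proposition nn_integral_prod_Holder:
  fixes f :: "'i \<Rightarrow> 'a \<Rightarrow> ennreal"
  assumes fin: "finite S" and p: "\<And>i. i \<in> S \<Longrightarrow> 0 \<le> p i" "(\<Sum>i\<in>S. p i) = 1"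
    and f: "\<And>i. i \<in> S \<Longrightarrow> f i \<in> borel_measurable M"
  shows "(\<integral>\<^sup>+x. (\<Prod>i\<in>S. epow (f i x) (p i)) \<partial>M) \<le> (\<Prod>i\<in>S. epow (\<integral>\<^sup>+x. f i x \<partial>M) (p i))"
proof -
  define T where "T = {i\<in>S. p i \<noteq> 0}"
  have eq: "(\<Prod>i\<in>S. epow (g i) (p i)) = (\<Prod>i\<in>T. epow (g i) (p i))" for g
    using fin by (intro prod.mono_neutral_right) (auto simp: T_def)
  have "(\<Sum>i\<in>T. p i) = 1"
    using p(2) fin by (subst sum.mono_neutral_left[of S]) (auto simp: T_def)
  then show ?thesis unfolding eq
    using fin p f by (intro nn_integral_prod_Holder_pos) (auto simp: T_def less_le)
qed

lemma nn_integral_Holder_epow: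
  fixes f g :: "'a \<Rightarrow> ennreal"
  assumes "0 \<le> s" "0 \<le> t" "s + t = 1" "f \<in> borel_measurable M" "g \<in> borel_measurable M"
  shows "(\<integral>\<^sup>+x. epow (f x) s * epow (g x) t \<partial>M)
     \<le> epow (\<integral>\<^sup>+x. f x \<partial>M) s * epow (\<integral>\<^sup>+x. g x \<partial>M) t"
  using nn_integral_prod_Holder[of UNIV "\<lambda>b. if b then s else t" "\<lambda>b. if b then f else g" M] assms
  by (auto simp: UNIV_bool mult.commute split: if_splits)

text \<open>Gagliardo--Nirenberg--Sobolev in its multiplicative form, by induction on the number of
  coordinates: Hoelder in the new coordinate, with exponent \<open>p\<close> for every old coordinate, reproduces the
  claim for the marginal of \<open>f\<close>.\<close>

proposition nn_integral_grid_lines: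
  fixes f :: "('i \<Rightarrow> real) \<Rightarrow> ennreal"
  assumes "finite I" "0 \<le> p" "(real (card I) - 1) * p \<le> 1"
    and "f \<in> borel_measurable (\<Pi>\<^sub>M i\<in>I. lborel)"
  shows "(\<integral>\<^sup>+x. epow (f x) (1 - (real (card I) - 1) * p) *
        (\<Prod>i\<in>I. epow (\<integral>\<^sup>+t. f (x(i := t)) \<partial>lborel) p) \<partial>(\<Pi>\<^sub>M i\<in>I. lborel))
     \<le> epow (\<integral>\<^sup>+x. f x \<partial>(\<Pi>\<^sub>M i\<in>I. lborel)) (1 + p)"
  using assms
proof (induction I arbitrary: f rule: finite_induct)
  case empty
  interpret product_sigma_finite "\<lambda>i::'i. lborel :: real measure" ..
  show ?case by (simp add: PiM_empty nn_integral_count_space_finite)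
next
  case (insert j I f)
  interpret product_sigma_finite "\<lambda>i::'i. lborel :: real measure" ..
  let ?k = "real (card I)"
  have card: "real (card (insert j I)) = ?k + 1" using insert.hyps by simp
  have kp: "?k * p \<le> 1" using insert.prems card by simp
  have meas[measurable]: "f \<in> borel_measurable (\<Pi>\<^sub>M i\<in>insert j I. lborel)" by fact
  define F where "F x = (\<integral>\<^sup>+t. f (x(j := t)) \<partial>lborel)" for x
  have upd[measurable]: "(\<lambda>(x, t). x(j := t)) \<in> (\<Pi>\<^sub>M i\<in>I. lborel) \<Otimes>\<^sub>M lborel \<rightarrow>\<^sub>M (\<Pi>\<^sub>M i\<in>insert j I. lborel)"
    by (rule measurable_add_dim)
  have Fm[measurable]: "F \<in> borel_measurable (\<Pi>\<^sub>M i\<in>I. lborel)"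
    unfolding F_def by measurable
  have line[measurable]: "(\<lambda>t. x(i := t)) \<in> lborel \<rightarrow>\<^sub>M (\<Pi>\<^sub>M i\<in>I. lborel)"
    if "x \<in> space (\<Pi>\<^sub>M i\<in>I. lborel)" "i \<in> I" for x :: "'i \<Rightarrow> real" and i
    using that by (intro measurable_fun_upd[of I I]) auto
  have line2[measurable]: "(\<lambda>(t, y). (x(i := t))(j := y)) \<in> lborel \<Otimes>\<^sub>M lborel \<rightarrow>\<^sub>M (\<Pi>\<^sub>M i\<in>insert j I. lborel)"
    if "x \<in> space (\<Pi>\<^sub>M i\<in>I. lborel)" "i \<in> I" for x :: "'i \<Rightarrow> real" and i
    unfolding case_prod_beta
    using that by (intro measurable_fun_upd[of _ I] measurable_compose[OF measurable_fst line]) auto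
  have swap: "(\<integral>\<^sup>+y. \<integral>\<^sup>+t. f ((x(i := t))(j := y)) \<partial>lborel \<partial>lborel) = (\<integral>\<^sup>+t. F (x(i := t)) \<partial>lborel)"
    if "x \<in> space (\<Pi>\<^sub>M i\<in>I. lborel)" "i \<in> I" for x i
    unfolding F_def using measurable_compose[OF line2[OF that] meas]
    by (intro lborel_pair.Fubini') (simp add: case_prod_beta)
  \<comment> \<open>One line in the new direction j, with the old coordinates x frozen. Integrated
    over x, this turns the claim for \<open>f\<close> into the claim for its marginal
    \<open>F\<close>.\<close>
  have step: "(\<integral>\<^sup>+y. epow (f (x(j := y))) (1 - ?k * p) *
        (\<Prod>i\<in>insert j I. epow (\<integral>\<^sup>+t. f ((x(j := y))(i := t)) \<partial>lborel) p) \<partial>lborel)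
      \<le> epow (F x) (1 - (?k - 1) * p) * (\<Prod>i\<in>I. epow (\<integral>\<^sup>+t. F (x(i := t)) \<partial>lborel) p)"
    if x: "x \<in> space (\<Pi>\<^sub>M i\<in>I. lborel)" for x
  proof -
    \<comment> \<open>Hoelder in y is applied to \<open>f\<close> with exponent 1 - k p and to its k
      line integrals in the old directions with exponent p each; these exponents sum to 1. The line
      integral in direction j is \<open>F x\<close>, constant in y, and is pulled out
      beforehand.\<close>
    define g where "g i y = (if i = j then f (x(j := y)) else \<integral>\<^sup>+t. f ((x(i := t))(j := y)) \<partial>lborel)" for i y
    define e where "e i = (if i = j then 1 - ?k * p else p)" for i
    have g_meas: "g i \<in> borel_measurable lborel" if "i \<in> insert j I" for i
    proof (cases "i = j")
      case True
      have "(\<lambda>y. x(j := y)) \<in> lborel \<rightarrow>\<^sub>M (\<Pi>\<^sub>M i\<in>insert j I. lborel)"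
        using x by (intro measurable_fun_upd[of _ I]) auto
      from measurable_compose[OF this meas] show ?thesis using True by (simp add: g_def[abs_def])
    next
      case False
      then have i: "i \<in> I" using that by simp
      have "(\<lambda>z. (x(i := snd z))(j := fst z)) \<in> lborel \<Otimes>\<^sub>M lborel \<rightarrow>\<^sub>M (\<Pi>\<^sub>M i\<in>insert j I. (lborel :: real measure))"
        by (intro measurable_fun_upd[of _ I] measurable_compose[OF measurable_snd line[OF x i]]) auto
      from measurable_compose[OF this meas]
      have "(\<lambda>y. \<integral>\<^sup>+t. f ((x(i := t))(j := y)) \<partial>lborel) \<in> borel_measurable lborel"
        by (intro lborel.borel_measurable_nn_integral) (simp add: case_prod_beta)
      then show ?thesis using False by (simp add: g_def[abs_def])
    qed
    have "(\<integral>\<^sup>+y. epow (f (x(j := y))) (1 - ?k * p) *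
        (\<Prod>i\<in>insert j I. epow (\<integral>\<^sup>+t. f ((x(j := y))(i := t)) \<partial>lborel) p) \<partial>lborel)
      = (\<integral>\<^sup>+y. epow (F x) p * (\<Prod>i\<in>insert j I. epow (g i y) (e i)) \<partial>lborel)"
    proof (intro nn_integral_cong)
      fix y :: real
      have "(\<Prod>i\<in>I. epow (g i y) (e i)) = (\<Prod>i\<in>I. epow (\<integral>\<^sup>+t. f ((x(j := y))(i := t)) \<partial>lborel) p)"
        using insert.hyps by (intro prod.cong refl) (auto simp: g_def e_def fun_upd_twist)
      then show "epow (f (x(j := y))) (1 - ?k * p) *
        (\<Prod>i\<in>insert j I. epow (\<integral>\<^sup>+t. f ((x(j := y))(i := t)) \<partial>lborel) p) =
        epow (F x) p * (\<Prod>i\<in>insert j I. epow (g i y) (e i))"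
        using insert.hyps by (simp add: g_def e_def F_def mult_ac)
    qed
    also have "\<dots> = epow (F x) p * (\<integral>\<^sup>+y. (\<Prod>i\<in>insert j I. epow (g i y) (e i)) \<partial>lborel)"
      using g_meas by (intro nn_integral_cmult borel_measurable_prod_ennreal measurable_epow)
    also have "\<dots> \<le> epow (F x) p * (\<Prod>i\<in>insert j I. epow (\<integral>\<^sup>+y. g i y \<partial>lborel) (e i))"
    proof (intro mult_left_mono nn_integral_prod_Holder g_meas)
      have "sum e I = ?k * p" using insert.hyps by (subst sum.cong[of _ _ _ "\<lambda>_. p"]) (auto simp: e_def)
      then show "sum e (insert j I) = 1" using insert.hyps by (simp add: e_def)
    qed (use insert kp in \<open>auto simp: e_def\<close>)
    also have "(\<Prod>i\<in>insert j I. epow (\<integral>\<^sup>+y. g i y \<partial>lborel) (e i)) =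
        epow (F x) (1 - ?k * p) * (\<Prod>i\<in>I. epow (\<integral>\<^sup>+t. F (x(i := t)) \<partial>lborel) p)"
    proof -
      have "(\<Prod>i\<in>I. epow (\<integral>\<^sup>+y. g i y \<partial>lborel) (e i)) = (\<Prod>i\<in>I. epow (\<integral>\<^sup>+t. F (x(i := t)) \<partial>lborel) p)"
      proof (intro prod.cong refl)
        fix i assume i: "i \<in> I"
        then have "i \<noteq> j" using insert.hyps by auto
        then show "epow (\<integral>\<^sup>+y. g i y \<partial>lborel) (e i) = epow (\<integral>\<^sup>+t. F (x(i := t)) \<partial>lborel) p"
          using swap[OF x i] by (simp add: g_def e_def)
      qed
      then show ?thesis using insert.hyps by (simp add: g_def e_def F_def)
    qed
    also have "epow (F x) p * (epow (F x) (1 - ?k * p) * (\<Prod>i\<in>I. epow (\<integral>\<^sup>+t. F (x(i := t)) \<partial>lborel) p))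
      = epow (F x) (p + (1 - ?k * p)) * (\<Prod>i\<in>I. epow (\<integral>\<^sup>+t. F (x(i := t)) \<partial>lborel) p)"
      using insert.prems kp by (subst epow_add) (auto simp: mult.assoc)
    also have "p + (1 - ?k * p) = 1 - (?k - 1) * p" by (simp add: algebra_simps)
    finally show ?thesis .
  qed
  have "(\<integral>\<^sup>+x. epow (f x) (1 - (real (card (insert j I)) - 1) * p) *
        (\<Prod>i\<in>insert j I. epow (\<integral>\<^sup>+t. f (x(i := t)) \<partial>lborel) p) \<partial>(\<Pi>\<^sub>M i\<in>insert j I. lborel))
    = (\<integral>\<^sup>+x. \<integral>\<^sup>+y. epow (f (x(j := y))) (1 - ?k * p) *
        (\<Prod>i\<in>insert j I. epow (\<integral>\<^sup>+t. f ((x(j := y))(i := t)) \<partial>lborel) p) \<partial>lborel \<partial>(\<Pi>\<^sub>M i\<in>I. lborel))"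
  proof (subst product_nn_integral_insert[OF insert.hyps])
    have "(\<lambda>x. \<integral>\<^sup>+t. f (x(i := t)) \<partial>lborel) \<in> borel_measurable (\<Pi>\<^sub>M i\<in>insert j I. lborel)"
      if "i \<in> insert j I" for i
    proof -
      have "(\<lambda>z. (fst z)(i := snd z)) \<in> (\<Pi>\<^sub>M i\<in>insert j I. lborel) \<Otimes>\<^sub>M lborel \<rightarrow>\<^sub>M (\<Pi>\<^sub>M i\<in>insert j I. (lborel :: real measure))"
        using that by (intro measurable_fun_upd[of _ "insert j I"]) auto
      from measurable_compose[OF this meas] show ?thesis
        by (intro lborel.borel_measurable_nn_integral) (simp add: case_prod_beta)
    qed
    then show "(\<lambda>x. epow (f x) (1 - (real (card (insert j I)) - 1) * p) *
        (\<Prod>i\<in>insert j I. epow (\<integral>\<^sup>+t. f (x(i := t)) \<partial>lborel) p)) \<in> borel_measurable (\<Pi>\<^sub>M i\<in>insert j I. lborel)"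
      by (intro borel_measurable_times_ennreal borel_measurable_prod_ennreal measurable_epow meas) auto
  qed (simp add: card)
  also have "\<dots> \<le> (\<integral>\<^sup>+x. epow (F x) (1 - (?k - 1) * p) *
      (\<Prod>i\<in>I. epow (\<integral>\<^sup>+t. F (x(i := t)) \<partial>lborel) p) \<partial>(\<Pi>\<^sub>M i\<in>I. lborel))"
    by (intro nn_integral_mono step)
  \<comment> \<open>The induction runs with p fixed, not tied to the number of coordinates, so its
    hypothesis applies to \<open>F\<close>: k p \<le> 1 implies (k - 1) p \<le> 1.\<close>
  also have "\<dots> \<le> epow (\<integral>\<^sup>+x. F x \<partial>(\<Pi>\<^sub>M i\<in>I. lborel)) (1 + p)"
    using insert.prems kp by (intro insert.IH Fm) (auto simp: algebra_simps)
  also have "(\<integral>\<^sup>+x. F x \<partial>(\<Pi>\<^sub>M i\<in>I. lborel)) = (\<integral>\<^sup>+x. f x \<partial>(\<Pi>\<^sub>M i\<in>insert j I. lborel))"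
    unfolding F_def by (rule product_nn_integral_insert[OF insert.hyps meas, symmetric])
  finally show ?case .
qed

section \<open>The Gagliardo--Nirenberg inequality from bounds on coordinate lines\<close>

lemma epow_power: "0 \<le> p \<Longrightarrow> epow x p ^ n = epow x (real n * p)"
  by (induction n) (auto simp: epow_add algebra_simps)

lemma prod_mono_ennreal:
  fixes f g :: "'i \<Rightarrow> ennreal"
  shows "(\<And>i. i \<in> S \<Longrightarrow> f i \<le> g i) \<Longrightarrow> (\<Prod>i\<in>S. f i) \<le> (\<Prod>i\<in>S. g i)"
  by (induction S rule: infinite_finite_induct) (auto intro!: mult_mono)

text \<open>The power h^(N/(N - 1)) splits into N factors h^(1/(N - 1)), one per coordinate
  direction, and each is bounded by a power of the integral of \<open>G\<close> over the line in
  that direction. The grid-line estimate with p = 1/(N - 1) then applies. Keeping \<open>h\<close>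
  and \<open>G\<close> abstract leaves room for a weight: only the line bound has to be
  checked.\<close>

theorem nn_integral_Gagliardo_Nirenberg:
  fixes h G :: "'a::euclidean_space \<Rightarrow> ennreal"
  assumes dim: "DIM('a) \<ge> 2"
    and [measurable]: "h \<in> borel_measurable borel" "G \<in> borel_measurable borel"
    and lines: "\<And>x b. b \<in> Basis \<Longrightarrow> h x \<le> (\<integral>\<^sup>+t. G (x + t *\<^sub>R b) \<partial>lborel)"
  defines "\<theta> \<equiv> real DIM('a) / (real DIM('a) - 1)"
  shows "(\<integral>\<^sup>+x. epow (h x) \<theta> \<partial>lborel) \<le> epow (\<integral>\<^sup>+x. G x \<partial>lborel) \<theta>"
proof -
  define p where "p = 1 / (real DIM('a) - 1)"
  define \<Phi> :: "('a \<Rightarrow> real) \<Rightarrow> 'a" where "\<Phi> f = (\<Sum>b\<in>Basis. f b *\<^sub>R b)" for f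
  have p: "0 \<le> p" "(real DIM('a) - 1) * p = 1" "real DIM('a) * p = \<theta>" "1 + p = \<theta>"
    using dim by (auto simp: p_def \<theta>_def field_simps)
  have \<Phi>_meas[measurable]: "\<Phi> \<in> (\<Pi>\<^sub>M b\<in>Basis. lborel) \<rightarrow>\<^sub>M borel"
    unfolding \<Phi>_def[abs_def] by measurable
  have line: "h (\<Phi> f) \<le> (\<integral>\<^sup>+t. G (\<Phi> (f(b := t))) \<partial>lborel)" if b: "b \<in> Basis" for f b
  proof -
    have "\<Phi> (f(b := t)) = \<Phi> f + (t - f b) *\<^sub>R b" for t
    proof -
      have "\<Phi> (f(b := t)) = t *\<^sub>R b + (\<Sum>i\<in>Basis - {b}. f i *\<^sub>R i)"
        using b by (simp add: \<Phi>_def sum.remove[of _ b])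
      also have "\<dots> = \<Phi> f + (t - f b) *\<^sub>R b"
        using b by (simp add: \<Phi>_def sum.remove[of _ b] algebra_simps)
      finally show ?thesis .
    qed
    then have "(\<integral>\<^sup>+t. G (\<Phi> (f(b := t))) \<partial>lborel) = (\<integral>\<^sup>+t. G (\<Phi> f + (t - f b) *\<^sub>R b) \<partial>lborel)"
      by simp
    also have "\<dots> = (\<integral>\<^sup>+t. G (\<Phi> f + t *\<^sub>R b) \<partial>lborel)"
      by (subst nn_integral_real_affine[where c=1 and t="f b"]) auto
    finally show ?thesis using lines[OF b] by simp
  qed
  have "(\<integral>\<^sup>+x. epow (h x) \<theta> \<partial>lborel) = (\<integral>\<^sup>+f. epow (h (\<Phi> f)) \<theta> \<partial>(\<Pi>\<^sub>M b\<in>Basis. lborel))"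
    by (subst lborel_eq, subst nn_integral_distr) (auto simp: \<Phi>_def[symmetric])
  also have "\<dots> \<le> (\<integral>\<^sup>+f. epow (G (\<Phi> f)) (1 - (real (card (Basis :: 'a set)) - 1) * p) *
        (\<Prod>b\<in>Basis. epow (\<integral>\<^sup>+t. G (\<Phi> (f(b := t))) \<partial>lborel) p) \<partial>(\<Pi>\<^sub>M b\<in>Basis. lborel))"
  proof (intro nn_integral_mono)
    fix f
    have "epow (h (\<Phi> f)) \<theta> = (\<Prod>b\<in>(Basis :: 'a set). epow (h (\<Phi> f)) p)"
      using p by (simp add: epow_power)
    also have "\<dots> \<le> (\<Prod>b\<in>Basis. epow (\<integral>\<^sup>+t. G (\<Phi> (f(b := t))) \<partial>lborel) p)"
      using p line by (intro prod_mono_ennreal epow_mono) auto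
    finally show "epow (h (\<Phi> f)) \<theta> \<le> epow (G (\<Phi> f)) (1 - (real (card (Basis :: 'a set)) - 1) * p) *
        (\<Prod>b\<in>Basis. epow (\<integral>\<^sup>+t. G (\<Phi> (f(b := t))) \<partial>lborel) p)"
      using p by simp
  qed
  also have "\<dots> \<le> epow (\<integral>\<^sup>+f. G (\<Phi> f) \<partial>(\<Pi>\<^sub>M b\<in>Basis. lborel)) (1 + p)"
    using p by (intro nn_integral_grid_lines) auto
  also have "(\<integral>\<^sup>+f. G (\<Phi> f) \<partial>(\<Pi>\<^sub>M b\<in>Basis. lborel)) = (\<integral>\<^sup>+x. G x \<partial>lborel)"
    by (subst lborel_eq, subst nn_integral_distr) (auto simp: \<Phi>_def[symmetric])
  finally show ?thesis using p by simp
qed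

section \<open>Weighted line integrals along outward rays\<close>

lemma has_real_derivative_abs_powr:
  fixes t :: real
  assumes "1 < c"
  shows "((\<lambda>t. \<bar>t\<bar> powr c) has_real_derivative c * \<bar>t\<bar> powr (c - 1) * sgn t) (at t)"
proof -
  consider "t > 0" | "t < 0" | "t = 0" by linarith
  then show ?thesis
  proof cases
    case 1
    have "((\<lambda>t. t powr c) has_real_derivative c * t powr (c - 1)) (at t)"
      using 1 by (rule has_real_derivative_powr)
    moreover have "\<forall>\<^sub>F y in nhds t. \<bar>y\<bar> powr c = y powr c"
      by (rule eventually_mono[OF eventually_nhds_in_open[of "{0<..}"]]) (use 1 in auto)
    ultimately show ?thesis using 1 by (simp add: DERIV_cong_ev[OF refl])
  next
    case 2
    have "((\<lambda>t. (- t) powr c) has_real_derivative c * (- t) powr (c - 1) * (-1)) (at t)"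
      using 2 by (auto intro!: derivative_eq_intros)
    moreover have "\<forall>\<^sub>F y in nhds t. \<bar>y\<bar> powr c = (- y) powr c"
      by (rule eventually_mono[OF eventually_nhds_in_open[of "{..<0}"]]) (use 2 in auto)
    ultimately show ?thesis using 2 by (simp add: DERIV_cong_ev[OF refl])
  next
    case 3
    have "((\<lambda>h::real. \<bar>h\<bar> powr (c - 1)) \<longlongrightarrow> \<bar>0\<bar> powr (c - 1)) (at 0)"
      using assms by (intro tendsto_powr2 tendsto_intros) auto
    then have "((\<lambda>h::real. \<bar>h\<bar> powr (c - 1)) \<longlongrightarrow> 0) (at 0)" by simp
    then have "((\<lambda>h::real. (\<bar>h\<bar> powr c) / h) \<longlongrightarrow> 0) (at 0)"
    proof (rule Lim_null_comparison[rotated])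
      show "\<forall>\<^sub>F h in at 0. norm (\<bar>h\<bar> powr c / h) \<le> \<bar>h\<bar> powr (c - 1)"
        unfolding eventually_at by (intro exI[of _ 1]) (auto simp: powr_diff)
    qed
    then show ?thesis using 3 by (simp add: DERIV_def)
  qed
qed

lemma GDERIV_along_line:
  assumes "GDERIV f (x + t *\<^sub>R e) :> D"
  shows "((\<lambda>t. f (x + t *\<^sub>R e)) has_real_derivative D \<bullet> e) (at t)"
proof -
  have "(f has_derivative (\<lambda>h. h \<bullet> D)) (at (x + t *\<^sub>R e))"
    using assms by (simp add: gderiv_def)
  moreover have "((\<lambda>t. x + t *\<^sub>R e) has_derivative (\<lambda>h. h *\<^sub>R e)) (at t)"
    by (auto intro!: derivative_eq_intros)
  ultimately have "((\<lambda>t. f (x + t *\<^sub>R e)) has_derivative (\<lambda>h. (h *\<^sub>R e) \<bullet> D)) (at t)"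
    by (rule has_derivative_compose[rotated, where f="\<lambda>t. x + t *\<^sub>R e"])
  then show ?thesis
    unfolding has_field_derivative_def by (rule has_derivative_eq_rhs) (auto simp: inner_commute mult.commute)
qed

text \<open>The weight grows along the ray, so it may be pulled into the line integral.\<close>

lemma weighted_ray_bound:
  fixes \<phi> W :: "'a::euclidean_space \<Rightarrow> real"
  assumes deriv: "\<And>x. GDERIV \<phi> x :> \<phi>' x" and cont: "continuous_on UNIV \<phi>'"
    and K: "bounded K" "\<And>x. x \<notin> K \<Longrightarrow> \<phi> x = 0" "\<And>x. x \<notin> K \<Longrightarrow> \<phi>' x = 0"
    and W: "\<And>x. 0 \<le> W x" "\<And>x y. x \<in> K \<Longrightarrow> y \<in> K \<Longrightarrow> norm x \<le> norm y \<Longrightarrow> W x \<le> W y"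
    and c: "1 < c" and e: "norm e = 1" "0 \<le> x \<bullet> e"
  shows "ennreal (W x * \<bar>\<phi> x\<bar> powr c)
    \<le> (\<integral>\<^sup>+t. ennreal (W (x + t *\<^sub>R e) * (c * \<bar>\<phi> (x + t *\<^sub>R e)\<bar> powr (c - 1) * norm (\<phi>' (x + t *\<^sub>R e)))) \<partial>lborel)"
proof (cases "x \<in> K")
  case False
  then show ?thesis using K by simp
next
  case x: True
  let ?l = "\<lambda>t. x + t *\<^sub>R e"
  \<comment> \<open>\<open>D'\<close> is the derivative of |\<phi>|^c along the ray and
    \<open>D\<close> a continuous majorant of its absolute value. The condition c > 1 makes
    |\<phi>|^c differentiable at the zeros of \<phi> as well.\<close>
  define D where "D t = c * \<bar>\<phi> (?l t)\<bar> powr (c - 1) * norm (\<phi>' (?l t))" for t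
  define D' where "D' t = c * \<bar>\<phi> (?l t)\<bar> powr (c - 1) * sgn (\<phi> (?l t)) * (\<phi>' (?l t) \<bullet> e)" for t
  obtain B where B: "\<And>y. y \<in> K \<Longrightarrow> norm y \<le> B" using K(1) by (auto simp: bounded_iff)
  define T where "T = \<bar>B\<bar> + norm x + 1"
  have T: "0 \<le> T" by (simp add: T_def)
  have "?l T \<notin> K"
  proof
    assume "?l T \<in> K"
    then have "norm (?l T) \<le> B" by (rule B)
    moreover have "T \<le> norm (?l T) + norm x"
      using norm_triangle_ineq4[of "?l T" x] e T by simp
    ultimately show False by (simp add: T_def)
  qed
  then have end0: "\<phi> (?l T) = 0" by (rule K)
  have cont\<phi>: "continuous_on UNIV \<phi>"
    using deriv by (metis continuous_at_imp_continuous_on gderiv_def has_derivative_continuous)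
  have contl: "continuous_on S (\<lambda>t. \<phi> (?l t))" "continuous_on S (\<lambda>t. \<phi>' (?l t))" for S
    by (auto intro!: continuous_on_compose2[OF cont\<phi>] continuous_on_compose2[OF cont] continuous_intros)
  have contD: "continuous_on S D" for S unfolding D_def
    using c by (intro continuous_intros contl continuous_on_powr') (auto)
  have deriv': "((\<lambda>t. \<bar>\<phi> (?l t)\<bar> powr c) has_real_derivative D' t) (at t)" for t
    using DERIV_chain2[OF has_real_derivative_abs_powr[OF c] GDERIV_along_line[OF deriv]]
    by (simp add: D'_def)
  have "(D' has_integral (\<bar>\<phi> (?l T)\<bar> powr c - \<bar>\<phi> (?l 0)\<bar> powr c)) {0..T}"
    using deriv' T by (intro fundamental_theorem_of_calculus)
      (auto simp: has_real_derivative_iff_has_vector_derivative intro: has_vector_derivative_at_within)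
  then have D': "(D' has_integral (- (\<bar>\<phi> x\<bar> powr c))) {0..T}" using end0 c by simp
  have D: "D integrable_on {0..T}" using contD by (rule integrable_continuous_real)
  have D0: "0 \<le> D t" for t using c by (simp add: D_def)
  have "norm (integral {0..T} D') \<le> integral {0..T} D"
  proof (intro integral_norm_bound_integral D has_integral_integrable[OF D'])
    fix t
    have "\<bar>\<phi>' (?l t) \<bullet> e\<bar> \<le> norm (\<phi>' (?l t))"
      using Cauchy_Schwarz_ineq2[of "\<phi>' (?l t)" e] e by simp
    then show "norm (D' t) \<le> D t" using c
      by (auto simp: D_def D'_def abs_mult sgn_if intro!: mult_left_mono)
  qed
  then have main: "\<bar>\<phi> x\<bar> powr c \<le> integral {0..T} D"
    using integral_unique[OF D'] by simp
  have "ennreal (W x * \<bar>\<phi> x\<bar> powr c) \<le> ennreal (W x) * ennreal (integral {0..T} D)"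
    using main W(1)[of x] by (simp add: ennreal_mult[symmetric] ennreal_leI mult_left_mono integral_nonneg[OF D] D0)
  also have "ennreal (integral {0..T} D) = (\<integral>\<^sup>+t. ennreal (indicator {0..T} t * D t) \<partial>lborel)"
    using nn_integral_has_integral_lebesgue[OF D0 integrable_integral[OF D]] by simp
  also have "ennreal (W x) * \<dots> = (\<integral>\<^sup>+t. ennreal (W x) * ennreal (indicator {0..T} t * D t) \<partial>lborel)"
    using borel_measurable_continuous_onI[OF contD] by (intro nn_integral_cmult[symmetric]) auto
  also have "\<dots> \<le> (\<integral>\<^sup>+t. ennreal (W (?l t) * D t) \<partial>lborel)"
  proof (intro nn_integral_mono)
    fix t
    \<comment> \<open>Monotonicity of \<open>W\<close> is available only between points of K. Off K
      the gradient and hence \<open>D\<close> vanish, so those points contribute nothing on the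
      left.\<close>
    show "ennreal (W x) * ennreal (indicator {0..T} t * D t) \<le> ennreal (W (?l t) * D t)"
    proof (cases "0 \<le> t \<and> D t \<noteq> 0")
      case True
      then have "?l t \<in> K" using K(3)[of "?l t"] by (auto simp: D_def)
      \<comment> \<open>Because x \<bullet> e \<ge> 0, the cross term in |x + t e|^2 is nonnegative:
        the ray moves away from the origin.\<close>
      moreover have "norm x \<le> norm (?l t)"
      proof (rule power2_le_imp_le)
        have "(norm (?l t))\<^sup>2 = (norm x)\<^sup>2 + 2 * t * (x \<bullet> e) + t\<^sup>2"
          using e(1) unfolding power2_norm_eq_inner norm_eq_1
          by (simp add: inner_add_left inner_add_right inner_commute power2_eq_square del: dot_square_norm)
        then show "(norm x)\<^sup>2 \<le> (norm (?l t))\<^sup>2" using True e by simp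
      qed simp
      ultimately have "W x \<le> W (?l t)" using W(2)[OF x] by blast
      then have "W x * (indicator {0..T} t * D t) \<le> W (?l t) * D t"
        using W(1)[of x] W(1)[of "?l t"] D0[of t] by (intro mult_mono) (auto simp: indicator_def)
      then show ?thesis using W(1)[of x] D0[of t] by (simp add: ennreal_mult[symmetric] ennreal_leI)
    qed (auto simp: indicator_def)
  qed
  finally show ?thesis by (simp add: D_def)
qed

section \<open>The Sobolev inequality with a radially nondecreasing weight\<close>

text \<open>The unknown x stands on both sides, on the right with the exponent (1 - 1/s) N/(N - 1),
  which is below 1 exactly because s < N. Since x is a positive real, this power can be cancelled;
  \<open>m\<close> is the reciprocal of the remaining exponent (N - s)/(s (N - 1)).\<close>

lemma Sobolev_self_improvement:
  fixes x y s N \<gamma> :: real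
  assumes s: "1 < s" "s < N" and \<gamma>: "0 < \<gamma>" and x: "0 < x" and y: "0 \<le> y"
    and le: "x \<le> (\<gamma> * (x powr (1 - 1 / s) * y powr (1 / s))) powr (N / (N - 1))"
  shows "x \<le> \<gamma> powr (N * s / (N - s)) * y powr (N / (N - s))"
proof -
  define \<theta> where "\<theta> = N / (N - 1)"
  define m where "m = s * (N - 1) / (N - s)"
  have m: "0 < m" using s by (simp add: m_def)
  have m1: "(1 - (1 - 1 / s) * \<theta>) * m = 1" using s by (simp add: \<theta>_def m_def divide_simps) (simp add: algebra_simps)
  have m2: "\<theta> * m = N * s / (N - s)" using s by (simp add: \<theta>_def m_def divide_simps)
  have m3: "1 / s * \<theta> * m = N / (N - s)" using s by (simp add: \<theta>_def m_def divide_simps)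
  have "x powr (1 - (1 - 1 / s) * \<theta>) * x powr ((1 - 1 / s) * \<theta>) = x"
    using x by (simp add: powr_add[symmetric])
  moreover have "(\<gamma> * (x powr (1 - 1 / s) * y powr (1 / s))) powr \<theta> =
      (\<gamma> powr \<theta> * y powr (1 / s * \<theta>)) * x powr ((1 - 1 / s) * \<theta>)"
    using x y \<gamma> by (simp only: powr_mult powr_powr mult_ac)
  ultimately have "x powr (1 - (1 - 1 / s) * \<theta>) * x powr ((1 - 1 / s) * \<theta>)
      \<le> (\<gamma> powr \<theta> * y powr (1 / s * \<theta>)) * x powr ((1 - 1 / s) * \<theta>)"
    using le by (simp add: \<theta>_def)
  then have "x powr (1 - (1 - 1 / s) * \<theta>) \<le> \<gamma> powr \<theta> * y powr (1 / s * \<theta>)"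
    using x by (simp add: mult_le_cancel_right)
  then have "(x powr (1 - (1 - 1 / s) * \<theta>)) powr m \<le> (\<gamma> powr \<theta> * y powr (1 / s * \<theta>)) powr m"
    using m by (intro powr_mono2) auto
  then show ?thesis using x y \<gamma> by (simp only: powr_mult powr_powr m1 m2 m3) simp
qed

text \<open>Gagliardo--Nirenberg is applied to a power of |\<phi>|. Hoelder then separates the
  gradient from the rest, and the integral of the critical power reappears on the right with
  exponent below 1, where it is absorbed. A power of a monotone weight is again monotone, so the
  weight can be carried along.\<close>

theorem weighted_Sobolev:
  fixes \<phi> W :: "'a::euclidean_space \<Rightarrow> real"
  assumes deriv: "\<And>x. GDERIV \<phi> x :> \<phi>' x" and cont: "continuous_on UNIV \<phi>'"
    and K: "bounded K" "\<And>x. x \<notin> K \<Longrightarrow> \<phi> x = 0" "\<And>x. x \<notin> K \<Longrightarrow> \<phi>' x = 0"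
    and W[measurable]: "W \<in> borel_measurable borel"
    and W0: "\<And>x. 0 \<le> W x" and W_le: "\<And>x. x \<in> K \<Longrightarrow> W x \<le> M"
    and W_mono: "\<And>x y. x \<in> K \<Longrightarrow> y \<in> K \<Longrightarrow> norm x \<le> norm y \<Longrightarrow> W x \<le> W y"
    and dim: "DIM('a) \<ge> 2" and s: "1 < s" "s < real DIM('a)"
  defines "N \<equiv> real DIM('a)"
  defines "\<kappa> \<equiv> N / (N - s)"
  shows "(\<integral>\<^sup>+x. ennreal (W x powr \<kappa> * \<bar>\<phi> x\<bar> powr (s * \<kappa>)) \<partial>lborel)
    \<le> ennreal ((s * (N - 1) / (N - s)) powr (s * \<kappa>)) * epow (\<integral>\<^sup>+x. ennreal (W x * norm (\<phi>' x) powr s) \<partial>lborel) \<kappa>"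
    (is "?X \<le> _ * epow ?Y _")
proof -
  \<comment> \<open>Two demands on \<gamma> agree: \<gamma> N/(N - 1) = s \<kappa>, and
    |\<phi>|^(\<gamma> - 1) is the (1 - 1/s)-th power of |\<phi>|^(s \<kappa>). The exponent
    \<gamma>/s in \<open>V\<close> gives V^\<theta> = W^\<kappa> and lets \<open>V\<close> split
    into the weights of the two Hoelder factors. This is the content of \<open>e1\<close> to
    \<open>e4\<close>.\<close>
  define \<gamma> where "\<gamma> = s * (N - 1) / (N - s)"
  define V where "V x = W x powr (\<gamma> / s)" for x
  define h where "h x = ennreal (V x * \<bar>\<phi> x\<bar> powr \<gamma>)" for x
  define g where "g x = V x * (\<gamma> * \<bar>\<phi> x\<bar> powr (\<gamma> - 1) * norm (\<phi>' x))" for x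
  define \<theta> where "\<theta> = N / (N - 1)"
  have N: "2 \<le> N" "s < N" using dim s by (auto simp: N_def)
  have "N * 1 < N * s" using N s by (intro mult_strict_left_mono) auto
  then have \<gamma>: "1 < \<gamma>" using N s by (simp add: \<gamma>_def field_simps)
  have \<gamma>s: "0 < \<gamma> / s" using \<gamma> s by simp
  have \<kappa>: "1 < \<kappa>" using N s by (simp add: \<kappa>_def)
  have \<theta>: "0 < \<theta>" using N by (simp add: \<theta>_def)
  have nz: "s \<noteq> 0" "N - 1 \<noteq> 0" "N - s \<noteq> 0" "N \<noteq> 0" using N s by auto
  have e1: "\<gamma> * \<theta> = s * \<kappa>" using nz by (simp add: \<gamma>_def \<theta>_def \<kappa>_def divide_simps)
  have e2: "\<gamma> / s * \<theta> = \<kappa>" using nz by (simp add: \<gamma>_def \<theta>_def \<kappa>_def divide_simps)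
  have e3: "s * \<kappa> * (1 - 1 / s) = \<gamma> - 1" using nz by (simp add: \<gamma>_def \<kappa>_def divide_simps) (simp add: algebra_simps)
  have e4: "\<kappa> * (1 - 1 / s) + 1 / s = \<gamma> / s"
    using N s by (simp add: \<gamma>_def \<kappa>_def divide_simps) (simp add: algebra_simps)
  have cont\<phi>: "continuous_on UNIV \<phi>"
    using deriv by (metis continuous_at_imp_continuous_on gderiv_def has_derivative_continuous)
  have [measurable]: "\<phi> \<in> borel_measurable borel" "\<phi>' \<in> borel_measurable borel"
    using cont\<phi> cont by (auto intro: borel_measurable_continuous_onI)
  have V0: "0 \<le> V x" for x by (simp add: V_def)
  have V_mono: "V x \<le> V y" if "x \<in> K" "y \<in> K" "norm x \<le> norm y" for x y
    using that \<gamma>s W0 W_mono by (auto simp: V_def intro!: powr_mono2)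
  \<comment> \<open>The required bound involves the whole line, so either half of it may be used:
    the ray along b or the one along -b, whichever points away from the origin at x.\<close>
  have lines: "h x \<le> (\<integral>\<^sup>+t. ennreal (g (x + t *\<^sub>R b)) \<partial>lborel)" if b: "b \<in> Basis" for x b
  proof (cases "0 \<le> x \<bullet> b")
    case True
    show ?thesis unfolding h_def g_def
      by (rule weighted_ray_bound[OF deriv cont K V0 V_mono \<gamma>]) (use b True in auto)
  next
    case False
    have "h x \<le> (\<integral>\<^sup>+t. ennreal (g (x + t *\<^sub>R (- b))) \<partial>lborel)" unfolding h_def g_def
      by (rule weighted_ray_bound[OF deriv cont K V0 V_mono \<gamma>]) (use b False in auto)
    also have "\<dots> = (\<integral>\<^sup>+t. ennreal (g (x + t *\<^sub>R b)) \<partial>lborel)"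
      unfolding g_def V_def by (subst nn_integral_real_affine[where c="-1" and t=0]) auto
    finally show ?thesis .
  qed
  have "?X = (\<integral>\<^sup>+x. epow (h x) \<theta> \<partial>lborel)"
    using \<theta> V0 s by (intro nn_integral_cong)
      (simp add: h_def epow_ennreal powr_mult V_def powr_powr e1 e2)
  also have "\<dots> \<le> epow (\<integral>\<^sup>+x. ennreal (g x) \<partial>lborel) \<theta>"
    unfolding \<theta>_def N_def using dim lines
    by (intro nn_integral_Gagliardo_Nirenberg) (auto simp: h_def g_def[abs_def] V_def[abs_def])
  also have "(\<integral>\<^sup>+x. ennreal (g x) \<partial>lborel) = (\<integral>\<^sup>+x. ennreal \<gamma> *
      (epow (ennreal (W x powr \<kappa> * \<bar>\<phi> x\<bar> powr (s * \<kappa>))) (1 - 1 / s) *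
       epow (ennreal (W x * norm (\<phi>' x) powr s)) (1 / s)) \<partial>lborel)"
  proof (intro nn_integral_cong)
    fix x
    have "epow (ennreal (W x powr \<kappa> * \<bar>\<phi> x\<bar> powr (s * \<kappa>))) (1 - 1 / s) *
       epow (ennreal (W x * norm (\<phi>' x) powr s)) (1 / s)
      = ennreal ((W x powr (\<kappa> * (1 - 1 / s)) * \<bar>\<phi> x\<bar> powr (\<gamma> - 1)) * (W x powr (1 / s) * norm (\<phi>' x)))"
      using s W0[of x] by (simp add: epow_ennreal powr_mult powr_powr e3 ennreal_mult[symmetric])
    also have "(W x powr (\<kappa> * (1 - 1 / s)) * \<bar>\<phi> x\<bar> powr (\<gamma> - 1)) * (W x powr (1 / s) * norm (\<phi>' x))
      = V x * (\<bar>\<phi> x\<bar> powr (\<gamma> - 1) * norm (\<phi>' x))"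
      by (simp add: V_def e4[symmetric] powr_add mult_ac)
    finally show "ennreal (g x) = ennreal \<gamma> *
      (epow (ennreal (W x powr \<kappa> * \<bar>\<phi> x\<bar> powr (s * \<kappa>))) (1 - 1 / s) *
       epow (ennreal (W x * norm (\<phi>' x) powr s)) (1 / s))"
      using \<gamma> V0[of x] by (simp add: g_def ennreal_mult[symmetric] mult_ac)
  qed
  also have "\<dots> = ennreal \<gamma> * (\<integral>\<^sup>+x. 
      (epow (ennreal (W x powr \<kappa> * \<bar>\<phi> x\<bar> powr (s * \<kappa>))) (1 - 1 / s) *
       epow (ennreal (W x * norm (\<phi>' x) powr s)) (1 / s)) \<partial>lborel)"
    by (intro nn_integral_cmult) measurable
  finally have "?X \<le> epow (ennreal \<gamma> * (\<integral>\<^sup>+x. 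
      (epow (ennreal (W x powr \<kappa> * \<bar>\<phi> x\<bar> powr (s * \<kappa>))) (1 - 1 / s) *
       epow (ennreal (W x * norm (\<phi>' x) powr s)) (1 / s)) \<partial>lborel)) \<theta>" .
  also have "\<dots> \<le> epow (ennreal \<gamma> * (epow ?X (1 - 1 / s) * epow ?Y (1 / s))) \<theta>"
    using s \<theta> by (intro epow_mono mult_left_mono nn_integral_Holder_epow) auto
  finally have self: "?X \<le> epow (ennreal \<gamma> * (epow ?X (1 - 1 / s) * epow ?Y (1 / s))) \<theta>" .
  \<comment> \<open>Absorption needs a finite left side. It is finite because \<phi> is bounded with
    bounded support and W is bounded there by M.\<close>
  have X_fin: "?X < top"
  proof -
    obtain B where B: "K \<subseteq> cball 0 B"
      using K(1) unfolding bounded_iff by (metis mem_cball_0 subsetI)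
    obtain C where C: "\<And>x. x \<in> cball 0 B \<Longrightarrow> \<bar>\<phi> x\<bar> \<le> C"
      using compact_imp_bounded[OF compact_continuous_image[OF continuous_on_subset[OF cont\<phi>] compact_cball], of 0 B]
      unfolding bounded_iff by (metis imageI real_norm_def subset_UNIV)
    define D where "D = \<bar>M\<bar> powr \<kappa> * \<bar>C\<bar> powr (s * \<kappa>)"
    have "?X \<le> (\<integral>\<^sup>+x. ennreal D * indicator (cball (0::'a) B) x \<partial>lborel)"
    proof (intro nn_integral_mono)
      fix x :: 'a
      show "ennreal (W x powr \<kappa> * \<bar>\<phi> x\<bar> powr (s * \<kappa>)) \<le> ennreal D * indicator (cball 0 B) x"
      proof (cases "x \<in> K")
        case True
        then have "W x \<le> \<bar>M\<bar>" "\<bar>\<phi> x\<bar> \<le> \<bar>C\<bar>" using W_le[of x] C[of x] B by (auto intro: order_trans)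
        then have "W x powr \<kappa> * \<bar>\<phi> x\<bar> powr (s * \<kappa>) \<le> D"
          unfolding D_def using W0[of x] \<kappa> s by (intro mult_mono powr_mono2) auto
        then show ?thesis using True B by (auto simp: ennreal_leI)
      next
        case False
        then show ?thesis using K by simp
      qed
    qed
    also have "\<dots> = ennreal D * emeasure lborel (cball (0::'a) B)"
      by (rule nn_integral_cmult_indicator) simp
    also have "\<dots> < top" using emeasure_lborel_cball_finite[of "0::'a" B] by (simp add: ennreal_mult_less_top)
    finally show ?thesis .
  qed
  have C0: "0 < \<gamma> powr (s * \<kappa>)" using \<gamma> by simp
  consider "?X = 0" | "?Y = top" | "?X \<noteq> 0" "?Y < top" using less_top by blast
  then show ?thesis
  proof cases
    case 2
    then show ?thesis using C0 \<kappa> by (simp add: ennreal_mult_top \<gamma>_def[symmetric])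
  next
    case 3
    obtain x where x: "?X = ennreal x" "0 \<le> x" using X_fin by (cases ?X) auto
    obtain y where y: "?Y = ennreal y" "0 \<le> y" using 3 by (cases ?Y) auto
    have x0: "0 < x" using 3 x by (cases "x = 0") auto
    have "ennreal x \<le> ennreal ((\<gamma> * (x powr (1 - 1 / s) * y powr (1 / s))) powr \<theta>)"
      using self s \<theta> \<gamma> x y by (simp add: epow_ennreal ennreal_mult[symmetric])
    then have "x \<le> (\<gamma> * (x powr (1 - 1 / s) * y powr (1 / s))) powr (N / (N - 1))"
      by (simp add: \<theta>_def ennreal_le_iff)
    then have "x \<le> \<gamma> powr (N * s / (N - s)) * y powr (N / (N - s))"
      using s N \<gamma> x0 y by (intro Sobolev_self_improvement) auto
    then have "x \<le> \<gamma> powr (s * \<kappa>) * y powr \<kappa>" by (simp add: \<kappa>_def mult.commute)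
    then show ?thesis unfolding \<gamma>_def[symmetric] x(1) y(1)
      using \<kappa> y by (simp add: epow_ennreal ennreal_mult[symmetric] ennreal_leI)
  qed simp
qed

section \<open>Smooth bump functions on boxes\<close>

lemma Ck_on_Suc_imp: "Ck_on (Suc k) S f \<Longrightarrow> Ck_on k S f"
proof (induction k arbitrary: f)
  case 0
  then show ?case
    by (auto intro!: continuous_at_imp_continuous_on simp: gderiv_def dest: has_derivative_continuous)
next
  case (Suc k)
  then obtain g where g: "\<forall>x\<in>S. GDERIV f x :> g x" "\<forall>i. Ck_on (Suc k) S (\<lambda>x. g x $ i)" by auto
  then show ?case using Suc.IH by (auto intro!: exI[of _ g] simp del: Ck_on.simps(2) simp: Ck_on.simps(2)[of k S f])
qed

lemma Ck_on_const: "Ck_on k S (\<lambda>x. c)"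
proof (induction k arbitrary: c)
  case (Suc k)
  then show ?case by (auto intro!: exI[of _ "\<lambda>_. 0"] GDERIV_const)
qed auto

lemma Ck_on_add: "Ck_on k S f \<Longrightarrow> Ck_on k S g \<Longrightarrow> Ck_on k S (\<lambda>x. f x + g x)"
proof (induction k arbitrary: f g)
  case 0
  then show ?case by (auto intro: continuous_intros)
next
  case (Suc k)
  then obtain f' g' where "\<forall>x\<in>S. GDERIV f x :> f' x" "\<forall>i. Ck_on k S (\<lambda>x. f' x $ i)"
    "\<forall>x\<in>S. GDERIV g x :> g' x" "\<forall>i. Ck_on k S (\<lambda>x. g' x $ i)" by auto
  then show ?case by (auto intro!: exI[of _ "\<lambda>x. f' x + g' x"] GDERIV_add Suc.IH)
qed

lemma Ck_on_mult: "Ck_on k S f \<Longrightarrow> Ck_on k S g \<Longrightarrow> Ck_on k S (\<lambda>x. f x * g x)"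
proof (induction k arbitrary: f g)
  case 0
  then show ?case by (auto intro: continuous_intros)
next
  case (Suc k)
  have fg: "Ck_on k S f" "Ck_on k S g" using Suc.prems by (auto dest: Ck_on_Suc_imp simp del: Ck_on.simps)
  from Suc.prems obtain f' g' where "\<forall>x\<in>S. GDERIV f x :> f' x" "\<forall>i. Ck_on k S (\<lambda>x. f' x $ i)"
    "\<forall>x\<in>S. GDERIV g x :> g' x" "\<forall>i. Ck_on k S (\<lambda>x. g' x $ i)" by auto
  then show ?case using fg
    by (auto intro!: exI[of _ "\<lambda>x. f x *\<^sub>R g' x + g x *\<^sub>R f' x"] GDERIV_mult Ck_on_add Suc.IH)
qed

lemma Ck_on_prod: "(\<And>i. i \<in> I \<Longrightarrow> Ck_on k S (f i)) \<Longrightarrow> Ck_on k S (\<lambda>x. \<Prod>i\<in>I. f i x)"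
  by (induction I rule: infinite_finite_induct) (auto intro: Ck_on_const Ck_on_mult)

text \<open>The family \<open>exp (- c / t) / t ^ m\<close> (\<open>t > 0\<close>) is closed under differentiation up to linear combinations.\<close>

definition flat :: "real \<Rightarrow> nat \<Rightarrow> real \<Rightarrow> real" where
  "flat c m t = (if t \<le> 0 then 0 else exp (- c / t) / t ^ m)"

text \<open>With s = c/t the quotient is s^(m + 1) exp(-s) / c^(m + 1), and s tends to infinity as t
  tends to 0 from the right. As \<open>flat c m 0\<close> is 0, this is the difference quotient at
  0, so the derivative there is 0.\<close>

lemma flat_over_tendsto_0:
  assumes "0 < c" shows "((\<lambda>t. flat c m t / t) \<longlongrightarrow> 0) (at 0)"
proof (rule filterlim_split_at)
  have "\<forall>\<^sub>F t in at_left 0. flat c m t / t = 0"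
    by (auto simp: flat_def eventually_at_filter)
  then show "((\<lambda>t. flat c m t / t) \<longlongrightarrow> 0) (at_left 0)"
    by (rule tendsto_eventually)
  have "filterlim (\<lambda>t. c / t) at_top (at_right 0)"
    using filterlim_tendsto_pos_mult_at_top[OF tendsto_const assms filterlim_inverse_at_top_right]
    by (simp add: divide_inverse)
  then have "((\<lambda>t. (c / t) ^ Suc m / exp (c / t) / c ^ Suc m) \<longlongrightarrow> 0) (at_right 0)"
    by (rule tendsto_divide_zero[OF filterlim_compose[OF tendsto_power_div_exp_0]])
  moreover have "\<forall>\<^sub>F t in at_right 0. (c / t) ^ Suc m / exp (c / t) / c ^ Suc m = flat c m t / t"
    using assms by (auto simp: flat_def eventually_at_filter exp_minus field_simps)
  ultimately show "((\<lambda>t. flat c m t / t) \<longlongrightarrow> 0) (at_right 0)"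
    by (rule Lim_transform_eventually)
qed

lemma DERIV_flat:
  assumes "0 < c"
  shows "(flat c m has_real_derivative c * flat c (m + 2) t - real m * flat c (m + 1) t) (at t)"
proof -
  consider "t > 0" | "t < 0" | "t = 0" by linarith
  then show ?thesis
  proof cases
    case 1
    have "((\<lambda>t. exp (- c / t) / t ^ m) has_real_derivative
        c * (exp (- c / t) / t ^ (m + 2)) - real m * (exp (- c / t) / t ^ (m + 1))) (at t)"
    proof (cases m)
      case 0
      then show ?thesis using 1
        by (auto intro!: derivative_eq_intros simp: power2_eq_square divide_simps)
    next
      case (Suc n)
      then show ?thesis using 1
        by (auto intro!: derivative_eq_intros simp: power2_eq_square divide_simps)
            (simp add: algebra_simps, cases n, auto)
    qed
    moreover have "\<forall>\<^sub>F y in nhds t. flat c m y = exp (- c / y) / y ^ m"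
      by (rule eventually_mono[OF eventually_nhds_in_open[of "{0<..}"]]) (use 1 in \<open>auto simp: flat_def\<close>)
    ultimately show ?thesis using 1 by (simp add: DERIV_cong_ev[OF refl] flat_def)
  next
    case 2
    have "\<forall>\<^sub>F y in nhds t. flat c m y = 0"
      by (rule eventually_mono[OF eventually_nhds_in_open[of "{..<0}"]]) (use 2 in \<open>auto simp: flat_def\<close>)
    then show ?thesis using 2 by (simp add: DERIV_cong_ev[OF refl] flat_def)
  next
    case 3
    then show ?thesis using flat_over_tendsto_0[OF assms, of m] by (simp add: DERIV_def flat_def)
  qed
qed

text \<open>The induction needs all m at once, since differentiation replaces m by m + 1 and m + 2.
  Free \<sigma> and d cover both kinds of faces of a box, x_i > a_i and x_i < b_i.\<close>

lemma Ck_on_flat_affine: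
  assumes "0 < c" shows "Ck_on k S (\<lambda>x::real^'n. flat c m (\<sigma> * x $ i + d))"
proof (induction k arbitrary: m)
  case 0
  have "continuous_on UNIV (flat c m)"
    by (intro continuous_at_imp_continuous_on ballI DERIV_isCont[OF DERIV_flat[OF assms]])
  then show ?case
    by (auto intro!: continuous_on_compose2[of UNIV "flat c m"] continuous_intros)
next
  case (Suc k)
  let ?l = "\<lambda>x::real^'n. \<sigma> * x $ i + d"
  let ?D = "\<lambda>x::real^'n. c * flat c (m + 2) (?l x) - real m * flat c (m + 1) (?l x)"
  have l: "GDERIV ?l x :> \<sigma> *\<^sub>R axis i 1" for x
    unfolding gderiv_def
    by (auto intro!: derivative_eq_intros bounded_linear_imp_has_derivative[OF bounded_linear_vec_nth]
        simp: inner_axis mult.commute)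
  have "GDERIV (\<lambda>x. flat c m (?l x)) x :> ?D x *\<^sub>R (\<sigma> *\<^sub>R axis i 1)" for x
    by (rule GDERIV_DERIV_compose[OF l DERIV_flat[OF assms]])
  moreover have "Ck_on k S (\<lambda>x. (?D x *\<^sub>R (\<sigma> *\<^sub>R axis i 1)) $ j)" for j
  proof -
    have "(?D x *\<^sub>R (\<sigma> *\<^sub>R axis i 1)) $ j =
      (c * flat c (m + 2) (?l x) + (- real m) * flat c (m + 1) (?l x)) * (\<sigma> * axis i 1 $ j)" for x
      by simp
    then show ?thesis
      by (simp only:) (intro Ck_on_mult Ck_on_add Ck_on_const Suc.IH)
  qed
  ultimately show ?case unfolding Ck_on.simps
    by (intro exI[of _ "\<lambda>x. ?D x *\<^sub>R (\<sigma> *\<^sub>R axis i 1)"] conjI ballI allI)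
qed

text \<open>The factors \<open>1 *\<close> and \<open>- 1 *\<close> and the form of the summands
  match the affine pattern for which smoothness was shown. The parameter c is there to be sent to 0:
  each factor exp(-c/t) then increases to 1, so the bumps increase to the indicator of the open
  box.\<close>

definition box_bump :: "real \<Rightarrow> real^'n \<Rightarrow> real^'n \<Rightarrow> real^'n \<Rightarrow> real" where
  "box_bump c a b x = (\<Prod>i\<in>UNIV. flat c 0 (1 * x $ i + - a $ i) * flat c 0 (- 1 * x $ i + b $ i))"

lemma flat_bounds: "0 < c \<Longrightarrow> 0 \<le> flat c 0 t" "0 < c \<Longrightarrow> flat c 0 t \<le> 1"
  by (auto simp: flat_def)

lemma box_bump_bounds:
  assumes "0 < c" shows "0 \<le> box_bump c a b x" "box_bump c a b x \<le> 1"
  using flat_bounds[OF assms] unfolding box_bump_def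
  by (auto intro!: prod_nonneg prod_le_1 mult_le_one)

lemma box_bump_nonzero: "{x. box_bump c a b x \<noteq> 0} = box a b"
  by (auto simp: box_bump_def prod_zero_iff flat_def mem_box_cart not_le)

lemma box_bump_test_function:
  assumes "0 < c" "cbox a b \<subseteq> \<Omega>" shows "box_bump c a b \<in> test_functions \<Omega>"
proof -
  have "Ck_on k UNIV (box_bump c a b)" for k
    unfolding box_bump_def[abs_def] using assms(1)
    by (intro Ck_on_prod Ck_on_mult Ck_on_flat_affine)
  moreover have "closure (box a b) \<subseteq> \<Omega>"
    using closure_minimal[OF box_subset_cbox closed_cbox] assms(2) by (rule order_trans)
  moreover have "compact (closure (box a b))" by (simp add: bounded_box)
  ultimately show ?thesis by (simp add: test_functions_def box_bump_nonzero)
qed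

lemma box_bump_tendsto:
  "(\<lambda>n. box_bump (1 / real (Suc n)) a b x) \<longlonglongrightarrow> indicator (box a b) x"
proof (cases "x \<in> box a b")
  case True
  have lim: "(\<lambda>n. flat (1 / real (Suc n)) 0 t) \<longlonglongrightarrow> 1" if "0 < t" for t
  proof -
    have "(\<lambda>n. exp (- (1 / real (Suc n)) / t)) \<longlonglongrightarrow> exp (- 0 / t)"
      using that by (intro tendsto_intros LIMSEQ_inverse_real_of_nat[unfolded inverse_eq_divide]) auto
    then show ?thesis using that by (simp add: flat_def)
  qed
  have "(\<lambda>n. box_bump (1 / real (Suc n)) a b x) \<longlonglongrightarrow> (\<Prod>i\<in>(UNIV::'a set). 1 * 1)"
    unfolding box_bump_def using True
    by (intro tendsto_prod tendsto_mult lim) (auto simp: mem_box_cart)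
  then show ?thesis using True by simp
next
  case False
  then have "box_bump (1 / real (Suc n)) a b x = 0" for n using box_bump_nonzero by blast
  then show ?thesis using False by simp
qed

section \<open>Weak gradients\<close>

lemma GDERIV_unique:
  assumes "GDERIV f x :> D" "GDERIV f x :> D'" shows "D = D'"
proof -
  have "(\<lambda>h. h \<bullet> D) = (\<lambda>h. h \<bullet> D')"
    using assms unfolding gderiv_def by (rule has_derivative_unique)
  then have "(D - D') \<bullet> D = (D - D') \<bullet> D'" by (rule fun_cong)
  then have "(D - D') \<bullet> (D - D') = 0" by (simp add: inner_diff_right)
  then show ?thesis by simp
qed

lemma test_function_C1E:
  assumes "\<phi> \<in> test_functions \<Omega>"
  obtains \<phi>' K where "\<And>x. GDERIV \<phi> x :> \<phi>' x" "continuous_on UNIV \<phi>'" "continuous_on UNIV \<phi>"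
    "compact K" "K \<subseteq> \<Omega>" "\<And>x. x \<notin> K \<Longrightarrow> \<phi> x = 0" "\<And>x. x \<notin> K \<Longrightarrow> \<phi>' x = 0"
proof -
  define K where "K = closure {x. \<phi> x \<noteq> 0}"
  have "Ck_on 1 UNIV \<phi>" "Ck_on 0 UNIV \<phi>" and K: "compact K" "K \<subseteq> \<Omega>"
    using assms unfolding test_functions_def K_def by blast+
  then obtain g where g: "\<And>x. GDERIV \<phi> x :> g x" "\<And>i. continuous_on UNIV (\<lambda>x. g x $ i)" and c: "continuous_on UNIV \<phi>"
    by auto
  have "continuous_on UNIV (\<lambda>x. \<chi> i. g x $ i)" by (intro continuous_on_vec_lambda g)
  then have cg: "continuous_on UNIV g" by simp
  have zero: "\<phi> x = 0" if "x \<notin> K" for x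
    using that closure_subset[of "{x. \<phi> x \<noteq> 0}"] by (auto simp: K_def subset_iff)
  have "g x = 0" if "x \<notin> K" for x
  proof (rule GDERIV_unique[OF g(1)])
    have "((\<lambda>_. 0) has_derivative (\<lambda>_. 0)) (at x)" by simp
    then have "(\<phi> has_derivative (\<lambda>_. 0)) (at x)"
      by (rule has_derivative_transform_within_open[of _ _ _ _ "- K"]) (use that zero K in \<open>auto intro: compact_imp_closed\<close>)
    then show "GDERIV \<phi> x :> 0" by (simp add: gderiv_def)
  qed
  with g(1) cg c K zero show thesis by (intro that[of g K])
qed

section \<open>The fundamental lemma of the calculus of variations\<close>

lemma integral_lebesgue_on_eq:
  fixes f :: "'a::euclidean_space \<Rightarrow> 'b::{banach, second_countable_topology}"
  assumes "open \<Omega>" "\<And>x. x \<notin> \<Omega> \<Longrightarrow> f x = 0"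
  shows "(LINT x|lebesgue_on \<Omega>. f x) = (LINT x|lebesgue. f x)"
proof -
  have "(LINT x|lebesgue_on \<Omega>. f x) = (LINT x|lebesgue. indicator \<Omega> x *\<^sub>R f x)"
    using assms(1) by (intro integral_restrict_space) auto
  also have "\<dots> = (LINT x|lebesgue. f x)"
    using assms(2) by (intro Bochner_Integration.integral_cong) (auto simp: indicator_def)
  finally show ?thesis .
qed

lemma locally_integrable_on_imp_measurable:
  fixes g :: "real^'n \<Rightarrow> 'b::euclidean_space"
  assumes "open \<Omega>" "locally_integrable_on g \<Omega>"
  shows "g \<in> borel_measurable (lebesgue_on \<Omega>)"
proof (rule open_Union_compact_subsets[OF assms(1)])
  fix C :: "nat \<Rightarrow> (real^'n) set"
  assume C: "\<And>n. compact (C n)" "\<And>n. C n \<subseteq> \<Omega>" "\<And>K. \<lbrakk>compact K; K \<subseteq> \<Omega>\<rbrakk> \<Longrightarrow> \<exists>N. \<forall>n\<ge>N. K \<subseteq> C n"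
  have "(\<lambda>x. indicator \<Omega> x *\<^sub>R g x) \<in> borel_measurable lebesgue"
  proof (rule borel_measurable_LIMSEQ_metric)
    fix n show "(\<lambda>x. indicator (C n) x *\<^sub>R g x) \<in> borel_measurable lebesgue"
    proof -
      have "g absolutely_integrable_on C n"
        using assms(2) C(1,2)[of n] by (simp add: locally_integrable_on_def)
      then show ?thesis unfolding set_integrable_def by (rule borel_measurable_integrable)
    qed
  next
    fix x
    show "(\<lambda>n. indicator (C n) x *\<^sub>R g x) \<longlonglongrightarrow> indicator \<Omega> x *\<^sub>R g x"
    proof (cases "x \<in> \<Omega>")
      case True
      then obtain N where "\<forall>n\<ge>N. {x} \<subseteq> C n" using C(3)[of "{x}"] by auto
      then have "\<forall>\<^sub>F n in sequentially. indicator (C n) x *\<^sub>R g x = indicator \<Omega> x *\<^sub>R g x"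
        using True by (auto simp: eventually_sequentially intro!: exI[of _ N])
      then show ?thesis by (rule tendsto_eventually)
    next
      case False
      then have "x \<notin> C n" for n using C(2) by blast
      then show ?thesis using False by simp
    qed
  qed
  then show ?thesis
    using assms(1) by (subst borel_measurable_restrict_space_iff) auto
qed

text \<open>The bumps of the box are admissible test functions, are bounded by 1 and converge to the
  indicator of the open box. Dominated convergence, with |h| on the closed box as majorant, carries
  the vanishing of the test integrals over to the open box, and its boundary is a null set.\<close>

lemma integral_cbox_eq_0:
  fixes h :: "real^'n \<Rightarrow> 'b::euclidean_space"
  assumes \<Omega>: "open \<Omega>" and h: "locally_integrable_on h \<Omega>"
    and zero: "\<And>\<phi>. \<phi> \<in> test_functions \<Omega> \<Longrightarrow> (LINT x|lebesgue_on \<Omega>. \<phi> x *\<^sub>R h x) = 0"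
    and ab: "cbox a b \<subseteq> \<Omega>"
  shows "integral (cbox a b) h = 0"
proof -
  define B where "B n = box_bump (1 / real (Suc n)) a b" for n
  have hint: "h absolutely_integrable_on cbox a b"
    using h ab by (simp add: locally_integrable_on_def)
  have B: "B n \<in> test_functions \<Omega>" for n unfolding B_def by (intro box_bump_test_function ab) simp
  have B0: "B n x = 0" if "x \<notin> box a b" for n x
    using that box_bump_nonzero unfolding B_def by blast
  have B_meas: "B n \<in> borel_measurable lebesgue" for n
  proof -
    have "continuous_on UNIV (B n)" using B[of n] by (rule test_function_C1E)
    then show ?thesis by (intro measurable_completion) (simp add: borel_measurable_continuous_onI)
  qed
  have eq: "B n x *\<^sub>R h x = B n x *\<^sub>R (indicator (cbox a b) x *\<^sub>R h x)" for n x
    using B0[of x n] box_subset_cbox[of a b] by (auto simp: indicator_def)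
  have hm: "(\<lambda>x. indicator (cbox a b) x *\<^sub>R h x) \<in> borel_measurable lebesgue"
    using hint unfolding set_integrable_def by (rule borel_measurable_integrable)
  have "(\<lambda>n. LINT x|lebesgue. B n x *\<^sub>R h x) \<longlonglongrightarrow> (LINT x|lebesgue. indicator (box a b) x *\<^sub>R h x)"
  proof (rule integral_dominated_convergence)
    have "h absolutely_integrable_on box a b"
      using absolutely_integrable_on_subinterval hint set_integrable_subset[OF hint _ box_subset_cbox] by auto
    then show "(\<lambda>x. indicator (box a b) x *\<^sub>R h x) \<in> borel_measurable lebesgue"
      unfolding set_integrable_def by (rule borel_measurable_integrable)
    show "(\<lambda>x. B n x *\<^sub>R h x) \<in> borel_measurable lebesgue" for n
      unfolding eq by (rule borel_measurable_scaleR[OF B_meas hm])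
    show "integrable lebesgue (\<lambda>x. norm (indicator (cbox a b) x *\<^sub>R h x))"
      using hint unfolding set_integrable_def by (rule integrable_norm)
    show "AE x in lebesgue. (\<lambda>n. B n x *\<^sub>R h x) \<longlonglongrightarrow> indicator (box a b) x *\<^sub>R h x"
      unfolding B_def by (intro AE_I2 tendsto_scaleR box_bump_tendsto tendsto_const)
    show "AE x in lebesgue. norm (B n x *\<^sub>R h x) \<le> norm (indicator (cbox a b) x *\<^sub>R h x)" for n
    proof (intro AE_I2)
      fix x
      have "norm (B n x) \<le> 1" using box_bump_bounds[of "1 / real (Suc n)" a b x] by (simp add: B_def)
      then show "norm (B n x *\<^sub>R h x) \<le> norm (indicator (cbox a b) x *\<^sub>R h x)"
        unfolding eq norm_scaleR[of "B n x"] by (intro mult_left_le_one_le norm_ge_zero) auto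
    qed
  qed
  moreover have "(LINT x|lebesgue. B n x *\<^sub>R h x) = 0" for n
    using zero[OF B[of n]] B0[of _ n] ab box_subset_cbox[of a b]
    by (subst integral_lebesgue_on_eq[OF \<Omega>, symmetric]) auto
  ultimately have "(LINT x|lebesgue. indicator (box a b) x *\<^sub>R h x) = 0"
    by (auto simp: LIMSEQ_const_iff)
  moreover have "h absolutely_integrable_on box a b"
    using set_integrable_subset[OF hint _ box_subset_cbox] by auto
  ultimately have "integral (box a b) h = 0"
    using set_lebesgue_integral_eq_integral(2)[of "box a b" h] by (simp add: set_lebesgue_integral_def)
  then show ?thesis by (simp add: integral_open_interval)
qed

text \<open>The integrals of \<open>h\<close> over all small cubes in \<Omega> vanish, while by
  Lebesgue's differentiation theorem the averages over such cubes converge to \<open>h\<close>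
  almost everywhere. Countably many closed boxes exhaust \<Omega>, so the exceptional sets add up to
  a null set.\<close>

proposition locally_integrable_eq_0_AE:
  fixes h :: "real^'n \<Rightarrow> 'b::euclidean_space"
  assumes \<Omega>: "open \<Omega>" and h: "locally_integrable_on h \<Omega>"
    and zero: "\<And>\<phi>. \<phi> \<in> test_functions \<Omega> \<Longrightarrow> (LINT x|lebesgue_on \<Omega>. \<phi> x *\<^sub>R h x) = 0"
  shows "AE x in lebesgue_on \<Omega>. h x = 0"
proof -
  have box: "negligible {x \<in> box u v. h x \<noteq> 0}" if uv: "cbox u v \<subseteq> \<Omega>" for u v
  proof -
    \<comment> \<open>Truncation makes the function integrable on every box, as the differentiation
      theorem asks, and changes nothing on cubes inside \<open>cbox u v\<close>.\<close>
    define f where "f x = (if x \<in> cbox u v then h x else 0)" for x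
    have "h integrable_on cbox u v"
      using h uv by (simp add: locally_integrable_on_def absolutely_integrable_on_def)
    then have "f integrable_on UNIV" unfolding f_def integrable_restrict_UNIV .
    then have fint: "f integrable_on cbox a b" for a b by (rule integrable_on_subcbox) simp
    have "\<exists>N. negligible N \<and> (\<forall>x e. x \<notin> N \<and> 0 < e \<longrightarrow> (\<exists>d>0. \<forall>t. 0 < t \<and> t < d \<longrightarrow>
        norm (integral (cbox x (x + t *\<^sub>R One)) f /\<^sub>R t ^ DIM(real^'n) - f x) < e))"
    proof (rule integrable_ccontinuous_explicit[OF fint])
      fix N
      assume "negligible N" "\<And>x e. x \<notin> N \<Longrightarrow> 0 < e \<Longrightarrow> \<exists>d>0. \<forall>t. 0 < t \<and> t < d \<longrightarrow>
        norm (integral (cbox x (x + t *\<^sub>R One)) f /\<^sub>R t ^ DIM(real^'n) - f x) < e"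
      then show ?thesis by (intro exI[of _ N]) simp
    qed
    then obtain N where N: "negligible N \<and> (\<forall>x e. x \<notin> N \<and> 0 < e \<longrightarrow> (\<exists>d>0. \<forall>t. 0 < t \<and> t < d \<longrightarrow>
        norm (integral (cbox x (x + t *\<^sub>R One)) f /\<^sub>R t ^ DIM(real^'n) - f x) < e))" ..
    have "h x = 0" if x: "x \<in> box u v" "x \<notin> N" for x
    proof (rule ccontr)
      assume "h x \<noteq> 0"
      then obtain d where d: "d > 0" "\<And>t. 0 < t \<Longrightarrow> t < d \<Longrightarrow>
        norm (integral (cbox x (x + t *\<^sub>R One)) f /\<^sub>R t ^ DIM(real^'n) - f x) < norm (h x)"
        using conjunct2[OF N, rule_format, of x "norm (h x)"] x(2) by auto
      \<comment> \<open>The cube has x as its lower corner; its opposite corner tends to x, so small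
        cubes stay inside the box.\<close>
      have "((\<lambda>t. x + t *\<^sub>R One) \<longlongrightarrow> x + 0 *\<^sub>R One) (at_right 0)"
        by (intro tendsto_intros)
      then have "\<forall>\<^sub>F t in at_right 0. x + t *\<^sub>R One \<in> box u v"
        using x(1) by (intro topological_tendstoD) (auto simp: open_box)
      moreover have "\<forall>\<^sub>F t in at_right 0. t \<in> {0<..<d}"
        using d(1) by (rule eventually_at_right_real)
      ultimately have "\<forall>\<^sub>F t in at_right 0. x + t *\<^sub>R One \<in> box u v \<and> t \<in> {0<..<d}"
        by (rule eventually_conj)
      then obtain t where t: "x + t *\<^sub>R One \<in> box u v" "0 < t" "t < d"
        using eventually_happens'[of "at_right (0::real)"] by force
      have sub: "cbox x (x + t *\<^sub>R One) \<subseteq> cbox u v"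
      proof
        fix y assume y: "y \<in> cbox x (x + t *\<^sub>R One)"
        show "y \<in> cbox u v" unfolding mem_box
        proof
          fix i :: "real^'n" assume i: "i \<in> Basis"
          have "u \<bullet> i < x \<bullet> i" "(x + t *\<^sub>R One) \<bullet> i < v \<bullet> i" "x \<bullet> i \<le> y \<bullet> i" "y \<bullet> i \<le> (x + t *\<^sub>R One) \<bullet> i"
            using x(1) t(1) y i unfolding mem_box by blast+
          then show "u \<bullet> i \<le> y \<bullet> i \<and> y \<bullet> i \<le> v \<bullet> i" by linarith
        qed
      qed
      have "integral (cbox x (x + t *\<^sub>R One)) f = integral (cbox x (x + t *\<^sub>R One)) h"
        using sub by (intro integral_cong) (auto simp: f_def)
      also have "\<dots> = 0"
        using sub uv by (intro integral_cbox_eq_0[OF \<Omega> h zero]) auto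
      finally have "norm (f x) < norm (h x)" using d(2)[OF t(2,3)] by simp
      then show False using x(1) box_subset_cbox[of u v] by (auto simp: f_def)
    qed
    then show ?thesis using conjunct1[OF N] by (auto intro: negligible_subset)
  qed
  obtain D where D: "countable D" "D \<subseteq> Pow \<Omega>" "\<And>X. X \<in> D \<Longrightarrow> \<exists>a b. X = cbox a b" "\<Union>D = \<Omega>"
    using open_countable_Union_open_cbox[OF \<Omega>] by metis
  have "negligible {x \<in> X. h x \<noteq> 0}" if X: "X \<in> D" for X
  proof -
    obtain a b where ab: "X = cbox a b" using D(3)[OF X] by auto
    have "{x \<in> X. h x \<noteq> 0} \<subseteq> {x \<in> box a b. h x \<noteq> 0} \<union> (cbox a b - box a b)" using ab by auto
    moreover have "negligible ({x \<in> box a b. h x \<noteq> 0} \<union> (cbox a b - box a b))"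
      using box[of a b] D(2) X ab by (intro negligible_Un negligible_frontier_interval) auto
    ultimately show ?thesis by (rule negligible_subset[rotated])
  qed
  then have "negligible (\<Union>X\<in>D. {x \<in> X. h x \<noteq> 0})"
    using D(1) by (intro negligible_countable_Union) auto
  moreover have "(\<Union>X\<in>D. {x \<in> X. h x \<noteq> 0}) = {x \<in> \<Omega>. h x \<noteq> 0}" using D(4) by auto
  ultimately have "{x \<in> \<Omega>. h x \<noteq> 0} \<in> null_sets lebesgue" by (simp add: negligible_iff_null_sets)
  then have "AE x in lebesgue. x \<in> \<Omega> \<longrightarrow> h x = 0"
    by (rule AE_I') auto
  then show ?thesis using \<Omega> by (subst AE_restrict_space_iff) auto
qed

section \<open>Classical gradients of test functions as weak gradients\<close>

lemma integrable_lborel_continuous_compact_support: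
  fixes f :: "'a::euclidean_space \<Rightarrow> 'b::{banach, second_countable_topology}"
  assumes "continuous_on UNIV f" "compact K" "\<And>x. x \<notin> K \<Longrightarrow> f x = 0"
  shows "integrable lborel f"
proof -
  have "integrable lborel (\<lambda>x. indicator K x *\<^sub>R f x)"
    using assms by (intro borel_integrable_compact) (auto intro: continuous_on_subset)
  also have "(\<lambda>x. indicator K x *\<^sub>R f x) = f" using assms(3) by (auto simp: indicator_def fun_eq_iff)
  finally show ?thesis .
qed

lemma integral_lborel_shift:
  fixes f :: "'a::euclidean_space \<Rightarrow> real"
  assumes "f \<in> borel_measurable borel"
  shows "(LINT x|lborel. f (x + v)) = (LINT x|lborel. f x)"
proof -
  have "(LINT x|lborel. f x) = (LINT x|distr lborel borel ((+) v). f x)"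
    by (simp add: lborel_distr_plus)
  also have "\<dots> = (LINT x|lborel. f (v + x))"
    using assms by (intro integral_distr) auto
  finally show ?thesis by (simp add: add.commute)
qed

lemma integrable_lborel_shift:
  fixes f :: "'a::euclidean_space \<Rightarrow> real"
  assumes "integrable lborel f"
  shows "integrable lborel (\<lambda>x. f (x + v))"
proof -
  have "integrable (distr lborel borel ((+) v)) f"
    using assms by (simp add: lborel_distr_plus)
  then have "integrable lborel (\<lambda>x. f (v + x))"
    using assms by (subst (asm) integrable_distr_eq) auto
  then show ?thesis by (simp add: add.commute)
qed

text \<open>By translation invariance the integral of every difference quotient vanishes.\<close>

lemma integral_gradient_eq_0:
  fixes f :: "'a::euclidean_space \<Rightarrow> real"
  assumes deriv: "\<And>x. GDERIV f x :> f' x" and cont: "continuous_on UNIV f'"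
    and K: "compact K" "\<And>x. x \<notin> K \<Longrightarrow> f x = 0" "\<And>x. x \<notin> K \<Longrightarrow> f' x = 0"
  shows "(LINT x|lborel. f' x) = 0"
proof (rule euclidean_eqI)
  fix b :: 'a assume b: "b \<in> Basis"
  have contf: "continuous_on UNIV f"
    using deriv by (auto intro!: continuous_at_imp_continuous_on simp: gderiv_def dest: has_derivative_continuous)
  have f'_int: "integrable lborel f'" and f_int: "integrable lborel f"
    using integrable_lborel_continuous_compact_support cont contf K by blast+
  have f_meas: "f \<in> borel_measurable borel" using contf by (rule borel_measurable_continuous_onI)
  define q where "q n x = real (Suc n) * (f (x + (1 / real (Suc n)) *\<^sub>R b) - f x)" for n x
  obtain R where R: "\<And>x. x \<in> K \<Longrightarrow> norm x \<le> R" using compact_imp_bounded[OF K(1)] by (auto simp: bounded_iff)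
  have "bounded (f' ` cball 0 (R + 1))"
    by (intro compact_imp_bounded compact_continuous_image continuous_on_subset[OF cont]) auto
  then obtain L where L: "\<And>x. norm x \<le> R + 1 \<Longrightarrow> norm (f' x) \<le> L"
    unfolding bounded_iff by (metis imageI mem_cball_0)
  have L': "norm (f' x) \<le> \<bar>L\<bar>" for x
  proof (cases "x \<in> K")
    case True then show ?thesis using L[of x] R[of x] by linarith
  next
    case False then show ?thesis using K(3) by simp
  qed
  \<comment> \<open>A majorant independent of n: the steps have length at most 1, so every quotient
    vanishes outside the ball of radius R + 1, and inside the mean value theorem bounds it by a
    bound for the gradient.\<close>
  have bound: "\<bar>q n x\<bar> \<le> \<bar>L\<bar> * indicator (cball 0 (R + 1)) x" for n x
  proof (cases "x \<in> cball 0 (R + 1)")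
    case True
    let ?t = "1 / real (Suc n)"
    have t: "0 < ?t" by simp
    obtain z where z: "f (x + ?t *\<^sub>R b) - f (x + 0 *\<^sub>R b) = (?t - 0) * (f' (x + z *\<^sub>R b) \<bullet> b)"
      using MVT2[OF t, of "\<lambda>t. f (x + t *\<^sub>R b)" "\<lambda>t. f' (x + t *\<^sub>R b) \<bullet> b"] GDERIV_along_line[OF deriv]
      by blast
    then have "q n x = f' (x + z *\<^sub>R b) \<bullet> b" by (simp add: q_def)
    then have "\<bar>q n x\<bar> \<le> norm (f' (x + z *\<^sub>R b))"
      using Basis_le_norm[OF b, of "f' (x + z *\<^sub>R b)"] by simp
    then show ?thesis using L'[of "x + z *\<^sub>R b"] True by simp
  next
    case False
    then have nx: "norm x > R + 1" by simp
    have "norm ((1 / real (Suc n)) *\<^sub>R b) \<le> 1" using b by (simp add: divide_simps)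
    then have "norm x \<le> norm (x + (1 / real (Suc n)) *\<^sub>R b) + 1"
      using norm_triangle_ineq4[of "x + (1 / real (Suc n)) *\<^sub>R b" "(1 / real (Suc n)) *\<^sub>R b"]
      unfolding add_diff_cancel_right' by linarith
    then have "x \<notin> K" "x + (1 / real (Suc n)) *\<^sub>R b \<notin> K"
      using nx R[of x] R[of "x + (1 / real (Suc n)) *\<^sub>R b"] by auto
    then show ?thesis using K(2) by (simp add: q_def)
  qed
  have lim: "(\<lambda>n. q n x) \<longlonglongrightarrow> f' x \<bullet> b" for x
  proof -
    have "((\<lambda>t. f (x + t *\<^sub>R b)) has_real_derivative f' x \<bullet> b) (at 0)"
      by (rule GDERIV_along_line) (simp add: deriv)
    then have "((\<lambda>h. (f (x + h *\<^sub>R b) - f x) / h) \<longlongrightarrow> f' x \<bullet> b) (at 0)"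
      by (simp add: DERIV_def)
    moreover have "filterlim (\<lambda>n. 1 / real (Suc n)) (at 0) sequentially"
      using LIMSEQ_inverse_real_of_nat by (intro filterlim_atI) (auto simp: inverse_eq_divide)
    ultimately have "(\<lambda>n. (f (x + (1 / real (Suc n)) *\<^sub>R b) - f x) / (1 / real (Suc n))) \<longlonglongrightarrow> f' x \<bullet> b"
      by (rule filterlim_compose)
    then show ?thesis by (simp add: q_def mult.commute)
  qed
  have "(\<lambda>n. LINT x|lborel. q n x) \<longlonglongrightarrow> (LINT x|lborel. f' x \<bullet> b)"
  proof (rule integral_dominated_convergence)
    show "(\<lambda>x. f' x \<bullet> b) \<in> borel_measurable lborel"
      using cont by (auto intro!: borel_measurable_continuous_onI continuous_intros)
    show "q n \<in> borel_measurable lborel" for n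
      unfolding q_def[abs_def] using f_meas by measurable
    show "integrable lborel (\<lambda>x::'a. \<bar>L\<bar> * indicator (cball 0 (R + 1)) x)"
      using emeasure_lborel_cball_finite[of "0::'a"] by (auto simp: less_top[symmetric])
    show "AE x in lborel. (\<lambda>n. q n x) \<longlonglongrightarrow> f' x \<bullet> b" using lim by simp
    show "AE x in lborel. norm (q n x) \<le> \<bar>L\<bar> * indicator (cball 0 (R + 1)) x" for n
      using bound by simp
  qed
  moreover have "(LINT x|lborel. q n x) = 0" for n
    using f_int integrable_lborel_shift[OF f_int] integral_lborel_shift[OF f_meas]
    by (simp add: q_def)
  ultimately have "(LINT x|lborel. f' x \<bullet> b) = 0" by (auto simp: LIMSEQ_const_iff)
  then show "(LINT x|lborel. f' x) \<bullet> b = 0 \<bullet> b" using f'_int by simp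
qed

lemma locally_integrable_on_continuous:
  fixes f :: "real^'n \<Rightarrow> 'b::euclidean_space"
  assumes "continuous_on UNIV f" shows "locally_integrable_on f \<Omega>"
  unfolding locally_integrable_on_def
proof (intro allI impI)
  fix K assume K: "compact K \<and> K \<subseteq> \<Omega>"
  then have int: "integrable lborel (\<lambda>x. indicator K x *\<^sub>R f x)"
    by (intro borel_integrable_compact continuous_on_subset[OF assms]) auto
  then show "f absolutely_integrable_on K" unfolding set_integrable_def
    by (subst integrable_completion) (simp_all add: borel_measurable_integrable)
qed

text \<open>Integration by parts: \<phi> \<psi> has compact support and gradient \<phi> \<psi>' +
  \<psi> \<phi>', whose integral over the whole space is 0. Both integrands vanish outside \<Omega>,
  which links this to the integrals over \<Omega>.\<close>

lemma test_function_has_weak_gradient: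
  assumes \<Omega>: "open \<Omega>" and \<phi>: "\<phi> \<in> test_functions \<Omega>" and \<phi>': "\<And>x. GDERIV \<phi> x :> \<phi>' x"
  shows "has_weak_gradient \<Omega> \<phi> \<phi>'"
proof -
  have C1: "continuous_on UNIV \<psi> \<and> continuous_on UNIV \<psi>' \<and>
      (\<exists>K. compact K \<and> K \<subseteq> \<Omega> \<and> (\<forall>x. x \<notin> K \<longrightarrow> \<psi> x = 0 \<and> \<psi>' x = 0))"
    if "\<psi> \<in> test_functions \<Omega>" "\<And>x. GDERIV \<psi> x :> \<psi>' x" for \<psi> \<psi>'
  proof (rule test_function_C1E[OF that(1)])
    fix g K assume g: "\<And>x. GDERIV \<psi> x :> g x" and *: "continuous_on UNIV g" "continuous_on UNIV \<psi>"
      "compact K" "K \<subseteq> \<Omega>" "\<And>x. x \<notin> K \<Longrightarrow> \<psi> x = 0" "\<And>x. x \<notin> K \<Longrightarrow> g x = 0"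
    have "\<psi>' = g" using GDERIV_unique[OF that(2) g] by blast
    then show ?thesis using * by auto
  qed
  note C\<phi> = C1[OF \<phi> \<phi>']
  have "(LINT x|lebesgue_on \<Omega>. \<phi> x *\<^sub>R \<psi>' x) = - (LINT x|lebesgue_on \<Omega>. \<psi> x *\<^sub>R \<phi>' x)"
    if \<psi>: "\<psi> \<in> test_functions \<Omega>" and \<psi>': "\<And>x. GDERIV \<psi> x :> \<psi>' x" for \<psi> \<psi>'
  proof -
    note C\<psi> = C1[OF \<psi> \<psi>']
    obtain K where K: "compact K" "K \<subseteq> \<Omega>" "\<And>x. x \<notin> K \<Longrightarrow> \<phi> x = 0 \<and> \<phi>' x = 0" using C\<phi> by blast
    have cont: "continuous_on UNIV (\<lambda>x. \<phi> x *\<^sub>R \<psi>' x)" "continuous_on UNIV (\<lambda>x. \<psi> x *\<^sub>R \<phi>' x)"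
      using C\<phi> C\<psi> by (auto intro!: continuous_intros)
    have int: "integrable lborel (\<lambda>x. \<phi> x *\<^sub>R \<psi>' x)" "integrable lborel (\<lambda>x. \<psi> x *\<^sub>R \<phi>' x)"
      using K by (auto intro!: integrable_lborel_continuous_compact_support[OF cont(1) K(1)]
          integrable_lborel_continuous_compact_support[OF cont(2) K(1)])
    have "(LINT x|lborel. \<phi> x *\<^sub>R \<psi>' x + \<psi> x *\<^sub>R \<phi>' x) = 0"
      using cont K by (intro integral_gradient_eq_0[where f="\<lambda>x. \<phi> x * \<psi> x" and K=K] GDERIV_mult \<phi>' \<psi>')
        (auto intro!: continuous_intros)
    then have sum0: "(LINT x|lborel. \<phi> x *\<^sub>R \<psi>' x) + (LINT x|lborel. \<psi> x *\<^sub>R \<phi>' x) = 0"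
      using int by simp
    have zero: "\<phi> x *\<^sub>R \<psi>' x = 0" "\<psi> x *\<^sub>R \<phi>' x = 0" if "x \<notin> \<Omega>" for x
      using that K by auto
    have "(LINT x|lebesgue_on \<Omega>. \<phi> x *\<^sub>R \<psi>' x) = (LINT x|lborel. \<phi> x *\<^sub>R \<psi>' x)"
      using zero cont by (subst integral_lebesgue_on_eq[OF \<Omega>])
        (auto intro!: integral_completion simp: borel_measurable_continuous_onI)
    moreover have "(LINT x|lebesgue_on \<Omega>. \<psi> x *\<^sub>R \<phi>' x) = (LINT x|lborel. \<psi> x *\<^sub>R \<phi>' x)"
      using zero cont by (subst integral_lebesgue_on_eq[OF \<Omega>])
        (auto intro!: integral_completion simp: borel_measurable_continuous_onI)
    ultimately show ?thesis using sum0 by (simp add: eq_neg_iff_add_eq_0)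
  qed
  then show ?thesis using C\<phi> by (auto simp: has_weak_gradient_def intro: locally_integrable_on_continuous)
qed

text \<open>A general product is used because both orders of the factors occur: a scalar test
  function times a vector field, and the gradient of a test function times a scalar function.
  Splitting \<open>LINT\<close> of a difference depends on such integrability, since
  \<open>LINT\<close> defaults to 0 otherwise.\<close>

lemma integrable_bilinear_locally_integrable:
  fixes f :: "real^'n \<Rightarrow> 'a::euclidean_space" and g :: "real^'n \<Rightarrow> 'b::euclidean_space"
    and pr :: "'a \<Rightarrow> 'b \<Rightarrow> 'c::euclidean_space"
  assumes pr: "bounded_bilinear pr" and \<Omega>: "open \<Omega>" and g: "locally_integrable_on g \<Omega>"
    and f: "continuous_on UNIV f" "compact K" "K \<subseteq> \<Omega>" "\<And>x. x \<notin> K \<Longrightarrow> f x = 0"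
  shows "integrable (lebesgue_on \<Omega>) (\<lambda>x. pr (f x) (g x))"
proof -
  interpret bounded_bilinear pr by (rule pr)
  obtain C where C: "0 < C" "\<And>a b. norm (pr a b) \<le> norm a * norm b * C" using pos_bounded by blast
  have "bounded (f ` K)"
    using f by (intro compact_imp_bounded compact_continuous_image) (auto intro: continuous_on_subset)
  then obtain B where B: "\<forall>x\<in>K. norm (f x) \<le> B" unfolding bounded_iff by blast
  have gK: "integrable lebesgue (\<lambda>x. indicator K x *\<^sub>R g x)"
    using g f unfolding locally_integrable_on_def set_integrable_def by simp
  have eq: "pr (f x) (g x) = pr (f x) (indicator K x *\<^sub>R g x)" for x
    using f(4)[of x] by (auto simp: indicator_def zero_left)
  have fm: "f \<in> borel_measurable lebesgue"
    using f(1) by (intro measurable_completion) (simp add: borel_measurable_continuous_onI)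
  have "integrable lebesgue (\<lambda>x. pr (f x) (g x))"
  proof (rule Bochner_Integration.integrable_bound)
    show "integrable lebesgue (\<lambda>x. (\<bar>B\<bar> * C) *\<^sub>R (indicator K x *\<^sub>R g x))" using gK by (rule integrable_scaleR_right)
    show "(\<lambda>x. pr (f x) (g x)) \<in> borel_measurable lebesgue"
      unfolding eq
      by (rule borel_measurable_continuous_Pair[OF fm borel_measurable_integrable[OF gK]])
        (intro continuous_on continuous_intros)
    have fB: "norm (f x) \<le> \<bar>B\<bar>" for x using B f(4)[of x] by (cases "x \<in> K") force+
    have "norm (pr (f x) w) \<le> norm ((\<bar>B\<bar> * C) *\<^sub>R w)" for x w
    proof -
      have "norm (pr (f x) w) \<le> norm (f x) * norm w * C" by (rule C)
      also have "\<dots> \<le> \<bar>B\<bar> * norm w * C"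
        using fB[of x] C(1) by (intro mult_right_mono) auto
      finally show ?thesis using C(1) by (simp add: abs_mult mult_ac)
    qed
    then show "AE x in lebesgue. norm (pr (f x) (g x)) \<le> norm ((\<bar>B\<bar> * C) *\<^sub>R (indicator K x *\<^sub>R g x))"
      unfolding eq by (intro AE_I2)
  qed
  then have "integrable lebesgue (\<lambda>x. indicator \<Omega> x *\<^sub>R pr (f x) (g x))"
    using \<Omega> by (intro integrable_mult_indicator) auto
  then show ?thesis using \<Omega> by (subst integrable_restrict_space) auto
qed

section \<open>Uniqueness and linearity of weak gradients\<close>

lemmas integrable_test_function_mult =
  integrable_bilinear_locally_integrable[OF bounded_bilinear_scaleR]

lemma has_weak_gradientD:
  assumes "has_weak_gradient \<Omega> u g" "\<phi> \<in> test_functions \<Omega>" "\<And>x. GDERIV \<phi> x :> \<phi>' x"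
  shows "(LINT x|lebesgue_on \<Omega>. u x *\<^sub>R \<phi>' x) = - (LINT x|lebesgue_on \<Omega>. \<phi> x *\<^sub>R g x)"
  using assms unfolding has_weak_gradient_def by blast

text \<open>Both candidates have the same integral against every test function, so the fundamental
  lemma applies to their difference. This gives the arbitrarily chosen \<open>weak_grad\<close> a
  meaning up to null sets.\<close>

lemma weak_gradient_unique:
  assumes \<Omega>: "open \<Omega>" and g: "has_weak_gradient \<Omega> u g" "has_weak_gradient \<Omega> u h"
  shows "AE x in lebesgue_on \<Omega>. g x = h x"
proof -
  have loc: "locally_integrable_on g \<Omega>" "locally_integrable_on h \<Omega>"
    using g by (auto simp: has_weak_gradient_def)
  have "AE x in lebesgue_on \<Omega>. g x - h x = 0"
  proof (rule locally_integrable_eq_0_AE[OF \<Omega>])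
    show "locally_integrable_on (\<lambda>x. g x - h x) \<Omega>"
      using loc by (auto simp: locally_integrable_on_def)
    fix \<phi> assume \<phi>: "\<phi> \<in> test_functions \<Omega>"
    show "(LINT x|lebesgue_on \<Omega>. \<phi> x *\<^sub>R (g x - h x)) = 0"
    proof (rule test_function_C1E[OF \<phi>])
      fix \<phi>' K assume *: "\<And>x. GDERIV \<phi> x :> \<phi>' x" "continuous_on UNIV \<phi>" "compact K" "K \<subseteq> \<Omega>"
        "\<And>x. x \<notin> K \<Longrightarrow> \<phi> x = 0"
      have "(LINT x|lebesgue_on \<Omega>. \<phi> x *\<^sub>R g x) = (LINT x|lebesgue_on \<Omega>. \<phi> x *\<^sub>R h x)"
      proof -
        have "(LINT x|lebesgue_on \<Omega>. u x *\<^sub>R \<phi>' x) = - (LINT x|lebesgue_on \<Omega>. \<phi> x *\<^sub>R g x)"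
          "(LINT x|lebesgue_on \<Omega>. u x *\<^sub>R \<phi>' x) = - (LINT x|lebesgue_on \<Omega>. \<phi> x *\<^sub>R h x)"
          by (rule has_weak_gradientD[OF g(1) \<phi> *(1)], rule has_weak_gradientD[OF g(2) \<phi> *(1)])
        then show ?thesis by simp
      qed
      then show ?thesis
        using integrable_test_function_mult[OF \<Omega> loc(1) *(2-5)] integrable_test_function_mult[OF \<Omega> loc(2) *(2-5)]
        by (simp add: scaleR_diff_right)
    qed
  qed
  then show ?thesis by simp
qed

lemma has_weak_gradient_diff:
  assumes \<Omega>: "open \<Omega>" and "has_weak_gradient \<Omega> u g" "has_weak_gradient \<Omega> v h"
  shows "has_weak_gradient \<Omega> (\<lambda>x. u x - v x) (\<lambda>x. g x - h x)"
proof -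
  have loc: "locally_integrable_on u \<Omega>" "locally_integrable_on g \<Omega>" "locally_integrable_on v \<Omega>" "locally_integrable_on h \<Omega>"
    using assms by (auto simp: has_weak_gradient_def)
  have "(LINT x|lebesgue_on \<Omega>. (u x - v x) *\<^sub>R \<phi>' x) = - (LINT x|lebesgue_on \<Omega>. \<phi> x *\<^sub>R (g x - h x))"
    if \<phi>: "\<phi> \<in> test_functions \<Omega>" and \<phi>': "\<And>x. GDERIV \<phi> x :> \<phi>' x" for \<phi> \<phi>'
  proof (rule test_function_C1E[OF \<phi>])
    fix g' K assume g': "\<And>x. GDERIV \<phi> x :> g' x" and *: "continuous_on UNIV g'" "continuous_on UNIV \<phi>"
      "compact K" "K \<subseteq> \<Omega>" "\<And>x. x \<notin> K \<Longrightarrow> \<phi> x = 0" "\<And>x. x \<notin> K \<Longrightarrow> g' x = 0"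
    have "\<phi>' = g'" using GDERIV_unique[OF \<phi>' g'] by blast
    have int: "integrable (lebesgue_on \<Omega>) (\<lambda>x. w x *\<^sub>R \<phi>' x)" if "locally_integrable_on w \<Omega>" for w
      using integrable_bilinear_locally_integrable[OF bounded_bilinear.flip[OF bounded_bilinear_scaleR] \<Omega> that *(1,3,4,6)]
      by (simp add: \<open>\<phi>' = g'\<close>)
    show ?thesis
      using int[OF loc(1)] int[OF loc(3)]
        has_weak_gradientD[OF assms(2) \<phi> \<phi>'] has_weak_gradientD[OF assms(3) \<phi> \<phi>']
        integrable_test_function_mult[OF \<Omega> loc(2) *(2-5)] integrable_test_function_mult[OF \<Omega> loc(4) *(2-5)]
      by (simp add: scaleR_diff_right scaleR_diff_left)
  qed
  then show ?thesis using loc by (auto simp: has_weak_gradient_def locally_integrable_on_def)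
qed

section \<open>Double phase spaces\<close>

lemma nn_integral_lebesgue_on_eq:
  fixes f :: "'a::euclidean_space \<Rightarrow> ennreal"
  assumes "open \<Omega>" "\<And>x. x \<notin> \<Omega> \<Longrightarrow> f x = 0"
  shows "(\<integral>\<^sup>+x. f x \<partial>lebesgue_on \<Omega>) = (\<integral>\<^sup>+x. f x \<partial>lborel)"
proof -
  have "(\<integral>\<^sup>+x. f x \<partial>lebesgue_on \<Omega>) = (\<integral>\<^sup>+x. f x * indicator \<Omega> x \<partial>lebesgue)"
    using assms(1) by (intro nn_integral_restrict_space) auto
  also have "\<dots> = (\<integral>\<^sup>+x. f x \<partial>lebesgue)"
    using assms(2) by (intro nn_integral_cong) (auto simp: indicator_def)
  finally show ?thesis by (simp add: nn_integral_completion)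
qed

text \<open>The weight is extended by 0 outside \<Omega>. This may destroy monotonicity on the whole
  space, which is why the whole-space inequality asks for it only between points of a set K carrying
  the test function.\<close>

lemma Sobolev_test_function:
  fixes \<phi> W :: "real^'n \<Rightarrow> real"
  assumes \<Omega>: "open \<Omega>" and \<phi>: "\<phi> \<in> test_functions \<Omega>" "\<And>x. GDERIV \<phi> x :> \<phi>' x"
    and W: "continuous_on \<Omega> W" "\<And>x. x \<in> \<Omega> \<Longrightarrow> 0 \<le> W x"
      "\<And>x y. x \<in> \<Omega> \<Longrightarrow> y \<in> \<Omega> \<Longrightarrow> norm x \<le> norm y \<Longrightarrow> W x \<le> W y"
    and dim: "CARD('n) \<ge> 2" and s: "1 < s" "s < real CARD('n)"
  defines "N \<equiv> real CARD('n)"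
  defines "\<kappa> \<equiv> N / (N - s)"
  shows "(\<integral>\<^sup>+x. ennreal (W x powr \<kappa> * \<bar>\<phi> x\<bar> powr (s * \<kappa>)) \<partial>lebesgue_on \<Omega>)
    \<le> ennreal ((s * (N - 1) / (N - s)) powr (s * \<kappa>)) * epow (\<integral>\<^sup>+x. ennreal (W x * norm (\<phi>' x) powr s) \<partial>lebesgue_on \<Omega>) \<kappa>"
proof (rule test_function_C1E[OF \<phi>(1)])
  fix g K assume g: "\<And>x. GDERIV \<phi> x :> g x" and *: "continuous_on UNIV g" "continuous_on UNIV \<phi>"
    "compact K" "K \<subseteq> \<Omega>" "\<And>x. x \<notin> K \<Longrightarrow> \<phi> x = 0" "\<And>x. x \<notin> K \<Longrightarrow> g x = 0"
  have \<phi>'g: "\<phi>' = g" using GDERIV_unique[OF \<phi>(2) g] by blast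
  define V where "V x = (if x \<in> \<Omega> then W x else 0)" for x
  have Vm: "V \<in> borel_measurable borel"
    unfolding V_def[abs_def] using borel_measurable_continuous_on_if[OF _ W(1), of "\<lambda>_. 0"] \<Omega> by auto
  have "bounded (W ` K)"
    using * by (intro compact_imp_bounded compact_continuous_image) (auto intro: continuous_on_subset[OF W(1)])
  then obtain M where M: "\<forall>x\<in>K. \<bar>W x\<bar> \<le> M" unfolding bounded_iff by auto
  have V: "0 \<le> V x" "x \<in> K \<Longrightarrow> V x \<le> M" for x using W(2) M *(4) by (auto simp: V_def abs_le_iff subset_iff)
  have V_mono: "V x \<le> V y" if "x \<in> K" "y \<in> K" "norm x \<le> norm y" for x y
    using W(3)[of x y] that *(4) by (auto simp: V_def)
  have "(\<integral>\<^sup>+x. ennreal (V x powr \<kappa> * \<bar>\<phi> x\<bar> powr (s * \<kappa>)) \<partial>lborel)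
    \<le> ennreal ((s * (N - 1) / (N - s)) powr (s * \<kappa>)) * epow (\<integral>\<^sup>+x. ennreal (V x * norm (g x) powr s) \<partial>lborel) \<kappa>"
    using weighted_Sobolev[OF g *(1) compact_imp_bounded[OF *(3)] *(5,6) Vm V V_mono] dim s
    by (simp add: N_def \<kappa>_def)
  also have "(\<integral>\<^sup>+x. ennreal (V x powr \<kappa> * \<bar>\<phi> x\<bar> powr (s * \<kappa>)) \<partial>lborel)
     = (\<integral>\<^sup>+x. ennreal (V x powr \<kappa> * \<bar>\<phi> x\<bar> powr (s * \<kappa>)) \<partial>lebesgue_on \<Omega>)"
    by (rule nn_integral_lebesgue_on_eq[OF \<Omega>, symmetric]) (simp add: V_def)
  also have "\<dots> = (\<integral>\<^sup>+x. ennreal (W x powr \<kappa> * \<bar>\<phi> x\<bar> powr (s * \<kappa>)) \<partial>lebesgue_on \<Omega>)"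
    by (intro nn_integral_cong) (simp add: V_def)
  also have "(\<integral>\<^sup>+x. ennreal (V x * norm (g x) powr s) \<partial>lborel) = (\<integral>\<^sup>+x. ennreal (V x * norm (g x) powr s) \<partial>lebesgue_on \<Omega>)"
    by (rule nn_integral_lebesgue_on_eq[OF \<Omega>, symmetric]) (simp add: V_def)
  also have "\<dots> = (\<integral>\<^sup>+x. ennreal (W x * norm (\<phi>' x) powr s) \<partial>lebesgue_on \<Omega>)"
    unfolding \<phi>'g by (intro nn_integral_cong) (simp add: V_def)
  finally show ?thesis .
qed

section \<open>The modular and the Luxemburg norm\<close>

lemma powr_add_le:
  fixes x y s :: real
  assumes "0 \<le> x" "0 \<le> y" "0 \<le> s"
  shows "(x + y) powr s \<le> 2 powr s * (x powr s + y powr s)"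
proof -
  have "(x + y) powr s \<le> (2 * max x y) powr s" using assms by (intro powr_mono2) auto
  also have "\<dots> = 2 powr s * max x y powr s" using assms by (simp add: powr_mult)
  also have "max x y powr s \<le> x powr s + y powr s" by (auto simp: max_def)
  finally show ?thesis by simp
qed

text \<open>The infimum of an empty set of reals is an unspecified value, so \<open>LA_norm\<close>
  is informative only once this is known. As p, q > 1, dividing by \<tau> \<ge> 1 shrinks the
  modular at least by the factor 1/\<tau>; hence \<tau> = 1 + m, with m the modular of u,
  works.\<close>

lemma Luxemburg_set_nonempty:
  fixes a u :: "real^'n \<Rightarrow> real"
  assumes pq: "1 < p" "1 < q" and a[measurable]: "a \<in> borel_measurable (lebesgue_on \<Omega>)" and a0: "\<And>x. x \<in> \<Omega> \<Longrightarrow> 0 \<le> a x"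
    and u: "u \<in> LA \<Omega> p q a"
  shows "{\<tau>. \<tau> > 0 \<and> modular \<Omega> p q a (\<lambda>x. u x / \<tau>) \<le> 1} \<noteq> {}" (is "?S \<noteq> {}")
proof -
  have [measurable]: "u \<in> borel_measurable (lebesgue_on \<Omega>)" and fin: "modular \<Omega> p q a u < \<infinity>"
    using u by (auto simp: LA_def)
  obtain m where m: "modular \<Omega> p q a u = ennreal m" "0 \<le> m"
    using fin by (cases "modular \<Omega> p q a u") auto
  have "1 + m \<in> ?S"
  proof -
    let ?t = "1 + m"
    have scale: "\<bar>y / ?t\<bar> powr s \<le> (1 / ?t) * \<bar>y\<bar> powr s" if "1 < s" for y s :: real
    proof -
      have "\<bar>y / ?t\<bar> powr s = (1 / ?t) powr s * \<bar>y\<bar> powr s"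
        using m by (simp add: powr_mult[symmetric])
      also have "(1 / ?t) powr s \<le> (1 / ?t) powr 1"
        using m that by (intro powr_mono') auto
      finally show ?thesis using m by (simp add: mult_right_mono)
    qed
    have "modular \<Omega> p q a (\<lambda>x. u x / ?t) \<le> (\<integral>\<^sup>+x. ennreal (1 / ?t) * ennreal (\<bar>u x\<bar> powr p + a x * \<bar>u x\<bar> powr q) \<partial>lebesgue_on \<Omega>)"
      unfolding modular_def
    proof (intro nn_integral_mono)
      fix x assume "x \<in> space (lebesgue_on \<Omega>)"
      then have ax: "0 \<le> a x" using a0 by simp
      have "\<bar>u x / ?t\<bar> powr p + a x * \<bar>u x / ?t\<bar> powr q \<le> (1 / ?t) * \<bar>u x\<bar> powr p + a x * ((1 / ?t) * \<bar>u x\<bar> powr q)"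
        using scale pq ax by (intro add_mono mult_left_mono) auto
      also have "\<dots> = (1 / ?t) * (\<bar>u x\<bar> powr p + a x * \<bar>u x\<bar> powr q)" by (simp add: algebra_simps)
      finally show "ennreal (\<bar>u x / ?t\<bar> powr p + a x * \<bar>u x / ?t\<bar> powr q)
          \<le> ennreal (1 / ?t) * ennreal (\<bar>u x\<bar> powr p + a x * \<bar>u x\<bar> powr q)"
        using ax m by (subst ennreal_mult[symmetric]) (auto intro: ennreal_leI simp del: ennreal_plus)
    qed
    also have "\<dots> = ennreal (1 / ?t) * modular \<Omega> p q a u"
      unfolding modular_def by (intro nn_integral_cmult) measurable
    also have "\<dots> = ennreal (m / ?t)" using m by (simp add: ennreal_mult[symmetric])
    also have "\<dots> \<le> 1" using m by (simp add: ennreal_le_1)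
    finally show ?thesis using m by simp
  qed
  then show ?thesis by blast
qed

lemma LA_norm_nonneg:
  fixes a u :: "real^'n \<Rightarrow> real"
  assumes "1 < p" "1 < q" "a \<in> borel_measurable (lebesgue_on \<Omega>)" "\<And>x. x \<in> \<Omega> \<Longrightarrow> 0 \<le> a x"
    and "u \<in> LA \<Omega> p q a"
  shows "0 \<le> LA_norm \<Omega> p q a u"
  unfolding LA_norm_def
  by (rule cInf_greatest[OF Luxemburg_set_nonempty[OF assms]]) auto

text \<open>A strict bound on the infimum yields an actual \<tau> < \<epsilon> for which u/\<tau>
  has modular at most 1. Each phase is bounded by the whole modular and is homogeneous, so the two
  scale back separately, each with its own power of \<tau>.\<close>

lemma LA_norm_less:
  fixes a u :: "real^'n \<Rightarrow> real"
  assumes pq: "1 < p" "1 < q" and a[measurable]: "a \<in> borel_measurable (lebesgue_on \<Omega>)" and a0: "\<And>x. x \<in> \<Omega> \<Longrightarrow> 0 \<le> a x"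
    and u: "u \<in> LA \<Omega> p q a" and less: "LA_norm \<Omega> p q a u < \<epsilon>"
  shows "(\<integral>\<^sup>+x. ennreal (\<bar>u x\<bar> powr p) \<partial>lebesgue_on \<Omega>) \<le> ennreal (\<epsilon> powr p)"
    "(\<integral>\<^sup>+x. ennreal (a x * \<bar>u x\<bar> powr q) \<partial>lebesgue_on \<Omega>) \<le> ennreal (\<epsilon> powr q)"
proof -
  have [measurable]: "u \<in> borel_measurable (lebesgue_on \<Omega>)"
    using u by (auto simp: LA_def)
  let ?S = "{\<tau>. \<tau> > 0 \<and> modular \<Omega> p q a (\<lambda>x. u x / \<tau>) \<le> 1}"
  have "?S \<noteq> {}" by (rule Luxemburg_set_nonempty[OF pq a a0 u])
  moreover have "bdd_below ?S" by (intro bdd_belowI[of _ 0]) auto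
  ultimately obtain \<tau> where \<tau>: "0 < \<tau>" "modular \<Omega> p q a (\<lambda>x. u x / \<tau>) \<le> 1" "\<tau> < \<epsilon>"
    using less unfolding LA_norm_def by (subst (asm) cInf_less_iff) auto
  have main: "(\<integral>\<^sup>+x. ennreal (W x * \<bar>u x\<bar> powr s) \<partial>lebesgue_on \<Omega>) \<le> ennreal (\<epsilon> powr s)"
    if W[measurable]: "W \<in> borel_measurable (lebesgue_on \<Omega>)" and s: "0 \<le> s" and W0: "\<And>x. x \<in> \<Omega> \<Longrightarrow> 0 \<le> W x"
      and le: "\<And>x. x \<in> \<Omega> \<Longrightarrow> W x * \<bar>u x / \<tau>\<bar> powr s \<le> \<bar>u x / \<tau>\<bar> powr p + a x * \<bar>u x / \<tau>\<bar> powr q" for W s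
  proof -
    have "(\<integral>\<^sup>+x. ennreal (W x * \<bar>u x\<bar> powr s) \<partial>lebesgue_on \<Omega>) =
        (\<integral>\<^sup>+x. ennreal (\<tau> powr s) * ennreal (W x * \<bar>u x / \<tau>\<bar> powr s) \<partial>lebesgue_on \<Omega>)"
    proof (intro nn_integral_cong)
      fix x
      have "\<bar>u x\<bar> = \<tau> * \<bar>u x / \<tau>\<bar>" using \<tau> by simp
      then have "\<bar>u x\<bar> powr s = \<tau> powr s * \<bar>u x / \<tau>\<bar> powr s" using \<tau> by (metis abs_ge_zero less_imp_le powr_mult)
      then show "ennreal (W x * \<bar>u x\<bar> powr s) = ennreal (\<tau> powr s) * ennreal (W x * \<bar>u x / \<tau>\<bar> powr s)"
        by (simp add: ennreal_mult'[symmetric] mult_ac)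
    qed
    also have "\<dots> = ennreal (\<tau> powr s) * (\<integral>\<^sup>+x. ennreal (W x * \<bar>u x / \<tau>\<bar> powr s) \<partial>lebesgue_on \<Omega>)"
      by (intro nn_integral_cmult) measurable
    also have "\<dots> \<le> ennreal (\<tau> powr s) * modular \<Omega> p q a (\<lambda>x. u x / \<tau>)"
      unfolding modular_def using le by (intro mult_left_mono nn_integral_mono ennreal_leI) auto
    also have "\<dots> \<le> ennreal (\<tau> powr s) * 1" using \<tau> by (intro mult_left_mono) auto
    also have "\<dots> \<le> ennreal (\<epsilon> powr s)" using \<tau> s by (simp add: ennreal_leI powr_mono2)
    finally show ?thesis .
  qed
  show "(\<integral>\<^sup>+x. ennreal (\<bar>u x\<bar> powr p) \<partial>lebesgue_on \<Omega>) \<le> ennreal (\<epsilon> powr p)"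
    using main[of "\<lambda>_. 1" p] pq a0 by simp
  show "(\<integral>\<^sup>+x. ennreal (a x * \<bar>u x\<bar> powr q) \<partial>lebesgue_on \<Omega>) \<le> ennreal (\<epsilon> powr q)"
    using main[of a q] pq a0 a by simp
qed

text \<open>This places u - \<phi> and the norm of its weak gradient in \<open>LA\<close>. The
  domination is only almost everywhere because that weak gradient is identified only up to null
  sets.\<close>

lemma LA_bound:
  fixes a :: "real^'n \<Rightarrow> real"
  assumes pq: "1 < p" "1 < q" and a[measurable]: "a \<in> borel_measurable (lebesgue_on \<Omega>)" and a0: "\<And>x. x \<in> \<Omega> \<Longrightarrow> 0 \<le> a x"
    and u: "u \<in> LA \<Omega> p q a" "v \<in> LA \<Omega> p q a" and w: "w \<in> borel_measurable (lebesgue_on \<Omega>)"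
    and le: "AE x in lebesgue_on \<Omega>. \<bar>w x\<bar> \<le> \<bar>u x\<bar> + \<bar>v x\<bar>"
  shows "w \<in> LA \<Omega> p q a"
proof -
  let ?A = "\<lambda>u x. \<bar>u x\<bar> powr p + a x * \<bar>u x\<bar> powr q"
  let ?C = "2 powr p + 2 powr q :: real"
  have [measurable]: "u \<in> borel_measurable (lebesgue_on \<Omega>)" "v \<in> borel_measurable (lebesgue_on \<Omega>)"
    using u by (auto simp: LA_def)
  have "modular \<Omega> p q a w \<le> (\<integral>\<^sup>+x. ennreal ?C * (ennreal (?A u x) + ennreal (?A v x)) \<partial>lebesgue_on \<Omega>)"
    unfolding modular_def
  proof (rule nn_integral_mono_AE)
    show "AE x in lebesgue_on \<Omega>. ennreal (?A w x) \<le> ennreal ?C * (ennreal (?A u x) + ennreal (?A v x))"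
      using le AE_space
    proof eventually_elim
    case (elim x)
    then have ax: "0 \<le> a x" and le: "\<bar>w x\<bar> \<le> \<bar>u x\<bar> + \<bar>v x\<bar>" using a0 by auto
    have *: "\<bar>w x\<bar> powr s \<le> 2 powr s * (\<bar>u x\<bar> powr s + \<bar>v x\<bar> powr s)" if "1 < s" for s
      using order_trans[OF powr_mono2[OF _ _ le] powr_add_le] that by simp
    have "?A w x \<le> ?C * (\<bar>u x\<bar> powr p + \<bar>v x\<bar> powr p) + a x * (?C * (\<bar>u x\<bar> powr q + \<bar>v x\<bar> powr q))"
      using pq ax by (intro add_mono mult_left_mono order_trans[OF *] mult_right_mono) auto
    also have "\<dots> = ?C * (?A u x + ?A v x)" by (simp add: algebra_simps)
    finally show "ennreal (?A w x) \<le> ennreal ?C * (ennreal (?A u x) + ennreal (?A v x))"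
      using ax by (simp add: ennreal_mult[symmetric] ennreal_plus[symmetric] ennreal_leI del: ennreal_plus)
    qed
  qed
  also have "\<dots> = ennreal ?C * (modular \<Omega> p q a u + modular \<Omega> p q a v)"
    unfolding modular_def by (subst nn_integral_cmult, measurable, subst nn_integral_add) auto
  also have "\<dots> < \<infinity>" using u by (simp add: LA_def ennreal_mult_less_top)
  finally show ?thesis using w by (simp add: LA_def)
qed

lemma compact_support_in_LA:
  fixes a f :: "real^'n \<Rightarrow> real"
  assumes pq: "1 < p" "1 < q" and \<Omega>: "open \<Omega>" and a: "continuous_on \<Omega> a" and a0: "\<And>x. x \<in> \<Omega> \<Longrightarrow> 0 \<le> a x"
    and f: "continuous_on UNIV f" "compact K" "K \<subseteq> \<Omega>" "\<And>x. x \<notin> K \<Longrightarrow> f x = 0"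
  shows "f \<in> LA \<Omega> p q a"
proof -
  have "bounded (f ` K)" "bounded (a ` K)"
    using f a by (auto intro!: compact_imp_bounded compact_continuous_image intro: continuous_on_subset)
  then obtain B A where B: "\<forall>x\<in>K. \<bar>f x\<bar> \<le> B" and A: "\<forall>x\<in>K. \<bar>a x\<bar> \<le> A" unfolding bounded_iff by auto
  have "modular \<Omega> p q a f \<le> (\<integral>\<^sup>+x. ennreal (B powr p + A * B powr q) * indicator K x \<partial>lebesgue_on \<Omega>)"
    unfolding modular_def
  proof (intro nn_integral_mono)
    fix x
    show "ennreal (\<bar>f x\<bar> powr p + a x * \<bar>f x\<bar> powr q) \<le> ennreal (B powr p + A * B powr q) * indicator K x"
    proof (cases "x \<in> K")
      case True
      then have "\<bar>f x\<bar> \<le> B" "a x \<le> A" "0 \<le> a x" using A B a0 f(3) by (auto simp: abs_le_iff)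
      then have "\<bar>f x\<bar> powr p + a x * \<bar>f x\<bar> powr q \<le> B powr p + A * B powr q"
        using pq by (intro add_mono mult_mono powr_mono2) auto
      then show ?thesis using True by (simp add: ennreal_leI)
    next
      case False
      then show ?thesis using f(4) by simp
    qed
  qed
  also have "\<dots> = ennreal (B powr p + A * B powr q) * emeasure (lebesgue_on \<Omega>) K"
    using f \<Omega> by (intro nn_integral_cmult_indicator) (auto simp: sets_restrict_space_iff compact_imp_closed)
  also have "emeasure (lebesgue_on \<Omega>) K = emeasure lborel K"
    using f \<Omega> by (subst emeasure_restrict_space) (auto simp: compact_imp_closed)
  also have "ennreal (B powr p + A * B powr q) * emeasure lborel K < \<infinity>"
    using emeasure_compact_finite[OF f(2)] by (simp add: ennreal_mult_less_top)
  finally have "modular \<Omega> p q a f < \<infinity>" .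
  moreover have "f \<in> borel_measurable (lebesgue_on \<Omega>)"
    using f(1) by (intro measurable_restrict_space1 measurable_completion) (simp add: borel_measurable_continuous_onI)
  ultimately show ?thesis by (simp add: LA_def)
qed

section \<open>Approximation by test functions and the Sobolev inequality in
  \<open>W01A\<close>\<close>

lemma weak_grad_has_weak_gradient:
  assumes "weakly_differentiable \<Omega> u" shows "has_weak_gradient \<Omega> u (weak_grad \<Omega> u)"
  using assms unfolding weakly_differentiable_def weak_grad_def by (rule someI_ex)

lemma weak_grad_measurable:
  "open \<Omega> \<Longrightarrow> weakly_differentiable \<Omega> u \<Longrightarrow> weak_grad \<Omega> u \<in> borel_measurable (lebesgue_on \<Omega>)"
  using weak_grad_has_weak_gradient[of \<Omega> u]
  by (auto simp: has_weak_gradient_def intro: locally_integrable_on_imp_measurable)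

text \<open>The chosen weak gradient of u - \<phi> equals the difference of the gradients almost
  everywhere, by linearity and uniqueness. Closeness in \<open>W1A_norm\<close> thus becomes three
  integral bounds in terms of the fixed representative \<open>weak_grad \<Omega> u\<close>.\<close>

lemma W01A_approx:
  fixes a :: "real^'n \<Rightarrow> real"
  assumes pq: "1 < p" "1 < q" and \<Omega>: "open \<Omega>" and a: "continuous_on \<Omega> a" "\<And>x. x \<in> \<Omega> \<Longrightarrow> 0 \<le> a x"
    and u: "u \<in> W01A \<Omega> p q a" and \<epsilon>: "0 < \<epsilon>"
  obtains \<phi> \<phi>' where "\<phi> \<in> test_functions \<Omega>" "\<And>x. GDERIV \<phi> x :> \<phi>' x"
    "continuous_on UNIV \<phi>" "continuous_on UNIV \<phi>'"
    "(\<integral>\<^sup>+x. ennreal (\<bar>u x - \<phi> x\<bar> powr p) \<partial>lebesgue_on \<Omega>) \<le> ennreal (\<epsilon> powr p)"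
    "(\<integral>\<^sup>+x. ennreal (norm (weak_grad \<Omega> u x - \<phi>' x) powr p) \<partial>lebesgue_on \<Omega>) \<le> ennreal (\<epsilon> powr p)"
    "(\<integral>\<^sup>+x. ennreal (a x * norm (weak_grad \<Omega> u x - \<phi>' x) powr q) \<partial>lebesgue_on \<Omega>) \<le> ennreal (\<epsilon> powr q)"
proof -
  obtain \<phi> where \<phi>: "\<phi> \<in> test_functions \<Omega>" and less: "W1A_norm \<Omega> p q a (\<lambda>x. u x - \<phi> x) < \<epsilon>"
    using u \<epsilon> unfolding W01A_def by blast
  have uLA: "u \<in> LA \<Omega> p q a" "(\<lambda>x. norm (weak_grad \<Omega> u x)) \<in> LA \<Omega> p q a" and ud: "weakly_differentiable \<Omega> u"
    using u by (auto simp: W01A_def W1A_def)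
  have am: "a \<in> borel_measurable (lebesgue_on \<Omega>)"
    using a(1) \<Omega> by (intro continuous_imp_measurable_on_sets_lebesgue) auto
  show thesis
  proof (rule test_function_C1E[OF \<phi>])
    fix \<phi>' K assume \<phi>': "\<And>x. GDERIV \<phi> x :> \<phi>' x" and *: "continuous_on UNIV \<phi>'" "continuous_on UNIV \<phi>"
      "compact K" "K \<subseteq> \<Omega>" "\<And>x. x \<notin> K \<Longrightarrow> \<phi> x = 0" "\<And>x. x \<notin> K \<Longrightarrow> \<phi>' x = 0"
    define G where "G = weak_grad \<Omega> u"
    define H where "H = weak_grad \<Omega> (\<lambda>x. u x - \<phi> x)"
    have wg: "has_weak_gradient \<Omega> (\<lambda>x. u x - \<phi> x) (\<lambda>x. G x - \<phi>' x)" unfolding G_def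
      by (intro has_weak_gradient_diff[OF \<Omega>] weak_grad_has_weak_gradient ud test_function_has_weak_gradient[OF \<Omega> \<phi> \<phi>'])
    then have vd: "weakly_differentiable \<Omega> (\<lambda>x. u x - \<phi> x)" by (auto simp: weakly_differentiable_def)
    have HG: "AE x in lebesgue_on \<Omega>. H x = G x - \<phi>' x" unfolding H_def
      by (rule weak_gradient_unique[OF \<Omega> weak_grad_has_weak_gradient[OF vd] wg])
    have [measurable]: "H \<in> borel_measurable (lebesgue_on \<Omega>)"
      unfolding H_def by (rule weak_grad_measurable[OF \<Omega> vd])
    have \<phi>LA: "\<phi> \<in> LA \<Omega> p q a"
      by (rule compact_support_in_LA[OF pq \<Omega> a *(2-5)])
    have \<phi>'LA: "(\<lambda>x. norm (\<phi>' x)) \<in> LA \<Omega> p q a"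
      by (rule compact_support_in_LA[OF pq \<Omega> a _ *(3,4)]) (use * in \<open>auto intro: continuous_intros\<close>)
    have d1: "(\<lambda>x. u x - \<phi> x) \<in> LA \<Omega> p q a"
      using uLA(1) \<phi>LA by (intro LA_bound[OF pq am a(2) uLA(1) \<phi>LA]) (auto simp: LA_def)
    have HGn: "AE x in lebesgue_on \<Omega>. \<bar>norm (H x)\<bar> \<le> \<bar>norm (G x)\<bar> + \<bar>norm (\<phi>' x)\<bar>"
      using HG by eventually_elim (simp add: norm_triangle_ineq4)
    have d2: "(\<lambda>x. norm (H x)) \<in> LA \<Omega> p q a"
      by (rule LA_bound[OF pq am a(2) uLA(2) \<phi>'LA _ HGn[unfolded G_def]]) auto
    \<comment> \<open>The norm is a sum of two Luxemburg norms. Each is nonnegative by membership in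
      \<open>LA\<close>, so each is below \<epsilon>.\<close>
    have "LA_norm \<Omega> p q a (\<lambda>x. u x - \<phi> x) < \<epsilon>" "LA_norm \<Omega> p q a (\<lambda>x. norm (H x)) < \<epsilon>"
      using less LA_norm_nonneg[OF pq am a(2) d1] LA_norm_nonneg[OF pq am a(2) d2] unfolding W1A_norm_def H_def by linarith+
    note b1 = LA_norm_less[OF pq am a(2) d1 this(1)] and b2 = LA_norm_less[OF pq am a(2) d2 this(2)]
    have "(\<integral>\<^sup>+x. ennreal (norm (G x - \<phi>' x) powr p) \<partial>lebesgue_on \<Omega>) = (\<integral>\<^sup>+x. ennreal (\<bar>norm (H x)\<bar> powr p) \<partial>lebesgue_on \<Omega>)"
      using HG by (intro nn_integral_cong_AE) (auto elim: eventually_mono)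
    moreover have "(\<integral>\<^sup>+x. ennreal (a x * norm (G x - \<phi>' x) powr q) \<partial>lebesgue_on \<Omega>) = (\<integral>\<^sup>+x. ennreal (a x * \<bar>norm (H x)\<bar> powr q) \<partial>lebesgue_on \<Omega>)"
      using HG by (intro nn_integral_cong_AE) (auto elim: eventually_mono)
    ultimately show thesis
      using b1(1) b2 by (intro that[OF \<phi> \<phi>' *(2,1)]) (simp_all add: G_def)
  qed
qed

lemma AE_convergent_subseq_of_powr:
  fixes u :: "'a \<Rightarrow> real"
  assumes p: "0 < p" and [measurable]: "u \<in> borel_measurable M" "\<And>n. v n \<in> borel_measurable M"
    and le: "\<And>n. (\<integral>\<^sup>+x. ennreal (\<bar>u x - v n x\<bar> powr p) \<partial>M) \<le> ennreal (e n)" and e: "e \<longlonglongrightarrow> 0"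
  obtains r :: "nat \<Rightarrow> nat" where "strict_mono r" "AE x in M. (\<lambda>n. v (r n) x) \<longlonglongrightarrow> u x"
proof -
  let ?f = "\<lambda>n x. \<bar>u x - v n x\<bar> powr p"
  have int: "integrable M (?f n)" for n
  proof (rule integrableI_nonneg)
    show "(\<integral>\<^sup>+x. ennreal (?f n x) \<partial>M) < \<infinity>" using le[of n] by (auto intro: le_less_trans)
  qed auto
  have "(\<lambda>n. LINT x|M. norm (?f n x)) \<longlonglongrightarrow> 0"
  proof (rule tendsto_sandwich[OF _ _ tendsto_const])
    have "(\<lambda>n. max 0 (e n)) \<longlonglongrightarrow> max 0 0" by (intro tendsto_max tendsto_const e)
    then show "(\<lambda>n. max 0 (e n)) \<longlonglongrightarrow> 0" by simp
    have "(LINT x|M. norm (?f n x)) \<le> max 0 (e n)" for n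
    proof -
      have "ennreal (LINT x|M. ?f n x) \<le> ennreal (e n)"
        using le[of n] int[of n] by (subst (asm) nn_integral_eq_integral) auto
      then show ?thesis by (auto simp: ennreal_le_iff2)
    qed
    then show "\<forall>\<^sub>F n in sequentially. (LINT x|M. norm (?f n x)) \<le> max 0 (e n)" by simp
  qed simp
  from tendsto_L1_AE_subseq[OF int this] obtain r :: "nat \<Rightarrow> nat" where r: "strict_mono r"
    "AE x in M. (\<lambda>n. ?f (r n) x) \<longlonglongrightarrow> 0" by auto
  have "AE x in M. (\<lambda>n. v (r n) x) \<longlonglongrightarrow> u x"
    using r(2)
  proof eventually_elim
    case (elim x)
    have "(\<lambda>n. ?f (r n) x powr (1 / p)) \<longlonglongrightarrow> 0 powr (1 / p)"
      using p elim by (intro tendsto_powr2 tendsto_const) auto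
    then have "(\<lambda>n. \<bar>u x - v (r n) x\<bar>) \<longlonglongrightarrow> 0" using p by (simp add: powr_powr)
    then have "(\<lambda>n. u x - v (r n) x) \<longlonglongrightarrow> 0" by (rule tendsto_rabs_zero_cancel)
    then have "(\<lambda>n. u x - (u x - v (r n) x)) \<longlonglongrightarrow> u x - 0" by (intro tendsto_diff tendsto_const)
    then show ?case by simp
  qed
  with r(1) show thesis by (rule that)
qed

text \<open>Fatou's lemma along test functions that converge almost everywhere. \<open>Ws\<close>
  names the two weights whose gradient integrals the norm controls, 1 with power p and
  \<open>a\<close> with power q, so one proof serves both. The factor 2^s comes from comparing the
  gradients of the approximants with that of u by a crude triangle inequality, and it survives in
  the limit.\<close>

proposition Sobolev_W01A:
  fixes a W :: "real^'n \<Rightarrow> real"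
  assumes pq: "1 < p" "1 < q" and \<Omega>: "open \<Omega>" and a: "continuous_on \<Omega> a" "\<And>x. x \<in> \<Omega> \<Longrightarrow> 0 \<le> a x"
    and W: "continuous_on \<Omega> W" "\<And>x. x \<in> \<Omega> \<Longrightarrow> 0 \<le> W x"
      "\<And>x y. x \<in> \<Omega> \<Longrightarrow> y \<in> \<Omega> \<Longrightarrow> norm x \<le> norm y \<Longrightarrow> W x \<le> W y"
    and dim: "CARD('n) \<ge> 2" and s: "1 < s" "s < real CARD('n)"
    and Ws: "(W = (\<lambda>_. 1) \<and> s = p) \<or> (W = a \<and> s = q)"
    and u: "u \<in> W01A \<Omega> p q a"
    and y: "(\<integral>\<^sup>+x. ennreal (W x * norm (weak_grad \<Omega> u x) powr s) \<partial>lebesgue_on \<Omega>) = ennreal y" "0 \<le> y"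
  defines "N \<equiv> real CARD('n)"
  defines "\<kappa> \<equiv> N / (N - s)"
  shows "(\<integral>\<^sup>+x. ennreal (W x powr \<kappa> * \<bar>u x\<bar> powr (s * \<kappa>)) \<partial>lebesgue_on \<Omega>)
    \<le> ennreal ((s * (N - 1) / (N - s)) powr (s * \<kappa>) * (2 powr s * y) powr \<kappa>)" (is "?X \<le> _")
proof -
  let ?C = "(s * (N - 1) / (N - s)) powr (s * \<kappa>)"
  have \<kappa>: "0 < \<kappa>" using s by (simp add: \<kappa>_def N_def)
  define G where "G = weak_grad \<Omega> u"
  have um[measurable]: "u \<in> borel_measurable (lebesgue_on \<Omega>)" and ud: "weakly_differentiable \<Omega> u"
    using u by (auto simp: W01A_def W1A_def LA_def)
  have [measurable]: "G \<in> borel_measurable (lebesgue_on \<Omega>)" unfolding G_def by (rule weak_grad_measurable[OF \<Omega> ud])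
  have [measurable]: "W \<in> borel_measurable (lebesgue_on \<Omega>)"
    using W(1) \<Omega> by (intro continuous_imp_measurable_on_sets_lebesgue) auto
  \<comment> \<open>What an approximant must provide: closeness of the values in L^p, which yields a
    subsequence converging almost everywhere, and closeness of the gradients in the weighted L^s,
    which keeps the Sobolev bounds under control.\<close>
  define P where "P n \<phi> \<phi>' \<longleftrightarrow> \<phi> \<in> test_functions \<Omega> \<and> (\<forall>x. GDERIV \<phi> x :> \<phi>' x) \<and> continuous_on UNIV \<phi> \<and> continuous_on UNIV \<phi>' \<and>
    (\<integral>\<^sup>+x. ennreal (\<bar>u x - \<phi> x\<bar> powr p) \<partial>lebesgue_on \<Omega>) \<le> ennreal ((1 / real (Suc n)) powr p) \<and>
    (\<integral>\<^sup>+x. ennreal (W x * norm (G x - \<phi>' x) powr s) \<partial>lebesgue_on \<Omega>) \<le> ennreal ((1 / real (Suc n)) powr s)" for n \<phi> \<phi>'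
  have ex: "\<exists>z. P n (fst z) (snd z)" for n
  proof (rule W01A_approx[OF pq \<Omega> a u, of "1 / real (Suc n)"])
    fix \<phi> \<phi>'
    assume "\<phi> \<in> test_functions \<Omega>" "\<And>x. GDERIV \<phi> x :> \<phi>' x" "continuous_on UNIV \<phi>" "continuous_on UNIV \<phi>'"
      "(\<integral>\<^sup>+x. ennreal (\<bar>u x - \<phi> x\<bar> powr p) \<partial>lebesgue_on \<Omega>) \<le> ennreal ((1 / real (Suc n)) powr p)"
      "(\<integral>\<^sup>+x. ennreal (norm (weak_grad \<Omega> u x - \<phi>' x) powr p) \<partial>lebesgue_on \<Omega>) \<le> ennreal ((1 / real (Suc n)) powr p)"
      "(\<integral>\<^sup>+x. ennreal (a x * norm (weak_grad \<Omega> u x - \<phi>' x) powr q) \<partial>lebesgue_on \<Omega>) \<le> ennreal ((1 / real (Suc n)) powr q)"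
    then show ?thesis using Ws unfolding P_def G_def by (intro exI[of _ "(\<phi>, \<phi>')"]) auto
  qed simp_all
  define z where "z n = (SOME z. P n (fst z) (snd z))" for n
  have z: "P n (fst (z n)) (snd (z n))" for n unfolding z_def by (rule someI_ex[OF ex])
  define \<phi> where "\<phi> n = fst (z n)" for n
  define \<phi>' where "\<phi>' n = snd (z n)" for n
  have \<phi>: "\<And>n. \<phi> n \<in> test_functions \<Omega>" "\<And>n x. GDERIV (\<phi> n) x :> \<phi>' n x"
    and c: "\<And>n. continuous_on UNIV (\<phi> n)" "\<And>n. continuous_on UNIV (\<phi>' n)"
    and conv: "\<And>n. (\<integral>\<^sup>+x. ennreal (\<bar>u x - \<phi> n x\<bar> powr p) \<partial>lebesgue_on \<Omega>) \<le> ennreal ((1 / real (Suc n)) powr p)"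
    and grad: "\<And>n. (\<integral>\<^sup>+x. ennreal (W x * norm (G x - \<phi>' n x) powr s) \<partial>lebesgue_on \<Omega>) \<le> ennreal ((1 / real (Suc n)) powr s)"
    using z unfolding P_def \<phi>_def \<phi>'_def by blast+
  have [measurable]: "\<phi> n \<in> borel_measurable (lebesgue_on \<Omega>)" "\<phi>' n \<in> borel_measurable (lebesgue_on \<Omega>)" for n
    using c by (auto intro!: measurable_restrict_space1 measurable_completion simp: borel_measurable_continuous_onI)
  have e0: "(\<lambda>n. (1 / real (Suc n)) powr t) \<longlonglongrightarrow> 0" if "0 < t" for t
  proof -
    have "(\<lambda>n. (1 / real (Suc n)) powr t) \<longlonglongrightarrow> 0 powr t"
      using that LIMSEQ_inverse_real_of_nat by (intro tendsto_powr2 tendsto_const) (auto simp: inverse_eq_divide)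
    then show ?thesis by simp
  qed
  obtain r :: "nat \<Rightarrow> nat" where r: "strict_mono r" "AE x in lebesgue_on \<Omega>. (\<lambda>n. \<phi> (r n) x) \<longlonglongrightarrow> u x"
    using AE_convergent_subseq_of_powr[OF _ um _ conv e0] pq by auto
  define b where "b n = ?C * (2 powr s * (y + (1 / real (Suc n)) powr s)) powr \<kappa>" for n
  have test_le: "(\<integral>\<^sup>+x. ennreal (W x powr \<kappa> * \<bar>\<phi> n x\<bar> powr (s * \<kappa>)) \<partial>lebesgue_on \<Omega>) \<le> ennreal (b n)" for n
  proof -
    let ?e = "(1 / real (Suc n)) powr s"
    have "(\<integral>\<^sup>+x. ennreal (W x * norm (\<phi>' n x) powr s) \<partial>lebesgue_on \<Omega>)
      \<le> (\<integral>\<^sup>+x. ennreal (2 powr s) * (ennreal (W x * norm (G x) powr s) + ennreal (W x * norm (G x - \<phi>' n x) powr s)) \<partial>lebesgue_on \<Omega>)"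
    proof (rule nn_integral_mono)
      fix x assume "x \<in> space (lebesgue_on \<Omega>)"
      then have W0: "0 \<le> W x" using W(2) by simp
      have "norm (\<phi>' n x) \<le> norm (G x) + norm (G x - \<phi>' n x)"
        using norm_triangle_ineq4[of "G x" "G x - \<phi>' n x"] by simp
      then have "norm (\<phi>' n x) powr s \<le> (norm (G x) + norm (G x - \<phi>' n x)) powr s" using s by (intro powr_mono2) auto
      also have "\<dots> \<le> 2 powr s * (norm (G x) powr s + norm (G x - \<phi>' n x) powr s)" using s by (intro powr_add_le) auto
      finally have "W x * norm (\<phi>' n x) powr s \<le> W x * (2 powr s * (norm (G x) powr s + norm (G x - \<phi>' n x) powr s))"
        using W0 by (rule mult_left_mono)
      then have "W x * norm (\<phi>' n x) powr s \<le> 2 powr s * (W x * norm (G x) powr s + W x * norm (G x - \<phi>' n x) powr s)"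
        by (simp add: algebra_simps)
      then show "ennreal (W x * norm (\<phi>' n x) powr s) \<le> ennreal (2 powr s) * (ennreal (W x * norm (G x) powr s) + ennreal (W x * norm (G x - \<phi>' n x) powr s))"
        using W0 by (simp add: ennreal_mult[symmetric] ennreal_plus[symmetric] ennreal_leI del: ennreal_plus)
    qed
    also have "\<dots> = ennreal (2 powr s) * ((\<integral>\<^sup>+x. ennreal (W x * norm (G x) powr s) \<partial>lebesgue_on \<Omega>) + (\<integral>\<^sup>+x. ennreal (W x * norm (G x - \<phi>' n x) powr s) \<partial>lebesgue_on \<Omega>))"
      by (subst nn_integral_cmult, measurable, subst nn_integral_add) auto
    also have "\<dots> \<le> ennreal (2 powr s) * (ennreal y + ennreal ?e)"
      using y(1) grad[of n] by (intro mult_left_mono add_mono) (auto simp: G_def)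
    also have "\<dots> = ennreal (2 powr s * (y + ?e))"
      using y(2) by (simp add: ennreal_mult[symmetric] ennreal_plus[symmetric] del: ennreal_plus)
    finally have le: "(\<integral>\<^sup>+x. ennreal (W x * norm (\<phi>' n x) powr s) \<partial>lebesgue_on \<Omega>) \<le> ennreal (2 powr s * (y + ?e))" .
    have "(\<integral>\<^sup>+x. ennreal (W x powr \<kappa> * \<bar>\<phi> n x\<bar> powr (s * \<kappa>)) \<partial>lebesgue_on \<Omega>)
      \<le> ennreal ?C * epow (\<integral>\<^sup>+x. ennreal (W x * norm (\<phi>' n x) powr s) \<partial>lebesgue_on \<Omega>) \<kappa>"
      unfolding \<kappa>_def N_def by (rule Sobolev_test_function[OF \<Omega> \<phi> W dim s])
    also have "\<dots> \<le> ennreal ?C * epow (ennreal (2 powr s * (y + ?e))) \<kappa>"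
      using \<kappa> le by (intro mult_left_mono epow_mono) auto
    also have "\<dots> = ennreal (b n)"
      using \<kappa> y(2) by (subst epow_ennreal) (auto simp: b_def ennreal_mult[symmetric])
    finally show ?thesis .
  qed
  have b_lim: "b \<longlonglongrightarrow> ?C * (2 powr s * (y + 0)) powr \<kappa>"
    unfolding b_def using \<kappa> s y(2) by (intro tendsto_intros tendsto_powr2 e0) auto
  have "?X = (\<integral>\<^sup>+x. liminf (\<lambda>n. ennreal (W x powr \<kappa> * \<bar>\<phi> (r n) x\<bar> powr (s * \<kappa>))) \<partial>lebesgue_on \<Omega>)"
  proof (rule nn_integral_cong_AE, use r(2) in eventually_elim)
    fix x assume "(\<lambda>n. \<phi> (r n) x) \<longlonglongrightarrow> u x"
    then have "(\<lambda>n. ennreal (W x powr \<kappa> * \<bar>\<phi> (r n) x\<bar> powr (s * \<kappa>))) \<longlonglongrightarrow> ennreal (W x powr \<kappa> * \<bar>u x\<bar> powr (s * \<kappa>))"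
      using s \<kappa> by (intro tendsto_ennrealI tendsto_mult tendsto_const tendsto_powr2 tendsto_rabs) auto
    then show "ennreal (W x powr \<kappa> * \<bar>u x\<bar> powr (s * \<kappa>)) = liminf (\<lambda>n. ennreal (W x powr \<kappa> * \<bar>\<phi> (r n) x\<bar> powr (s * \<kappa>)))"
      by (intro lim_imp_Liminf[symmetric]) auto
  qed
  also have "\<dots> \<le> liminf (\<lambda>n. \<integral>\<^sup>+x. ennreal (W x powr \<kappa> * \<bar>\<phi> (r n) x\<bar> powr (s * \<kappa>)) \<partial>lebesgue_on \<Omega>)"
    by (intro nn_integral_liminf) measurable
  also have "\<dots> \<le> liminf (\<lambda>n. ennreal (b (r n)))"
    using test_le by (intro Liminf_mono) auto
  also have "\<dots> = ennreal (?C * (2 powr s * (y + 0)) powr \<kappa>)"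
    by (intro lim_imp_Liminf tendsto_ennrealI LIMSEQ_subseq_LIMSEQ[OF b_lim r(1), unfolded o_def]) auto
  finally show ?thesis by simp
qed

section \<open>Nonexistence of small solutions\<close>

text \<open>Each point of \<Omega> off the support has a ball on which f vanishes almost everywhere.
  By Lindelof countably many of these balls cover all such points, so the exceptional null sets add
  up to a null set.\<close>

lemma vanishes_off_support_AE:
  fixes f :: "real^'n \<Rightarrow> real"
  assumes \<Omega>: "open \<Omega>"
  shows "AE x in lebesgue_on \<Omega>. f x \<noteq> 0 \<longrightarrow> x \<in> support_in \<Omega> f"
proof -
  let ?S = "\<Omega> - support_in \<Omega> f"
  define e where "e x = (SOME \<epsilon>. 0 < \<epsilon> \<and> (AE y in lebesgue_on \<Omega>. y \<in> ball x \<epsilon> \<longrightarrow> f y = 0))" for x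
  have e: "0 < e x \<and> (AE y in lebesgue_on \<Omega>. y \<in> ball x (e x) \<longrightarrow> f y = 0)" if "x \<in> ?S" for x
  proof -
    have "\<exists>\<epsilon>. 0 < \<epsilon> \<and> (AE y in lebesgue_on \<Omega>. y \<in> ball x \<epsilon> \<longrightarrow> f y = 0)"
      using that by (auto simp: support_in_def)
    then show ?thesis unfolding e_def by (rule someI_ex)
  qed
  obtain F where F: "F \<subseteq> (\<lambda>x. ball x (e x)) ` ?S" "countable F" "\<Union>F = \<Union>((\<lambda>x. ball x (e x)) ` ?S)"
    by (rule Lindelof[of "(\<lambda>x. ball x (e x)) ` ?S"]) (auto intro: that)
  have "AE y in lebesgue_on \<Omega>. \<forall>B\<in>F. y \<in> B \<longrightarrow> f y = 0"
    unfolding AE_ball_countable[OF F(2)]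
  proof
    fix B assume "B \<in> F"
    then obtain x where "x \<in> ?S" "B = ball x (e x)" using F(1) by (auto simp: subset_iff image_iff)
    then show "AE y in lebesgue_on \<Omega>. y \<in> B \<longrightarrow> f y = 0" using e by simp
  qed
  then show ?thesis using AE_space
  proof eventually_elim
    case (elim y)
    show ?case
    proof (rule impI, rule ccontr)
      assume "f y \<noteq> 0" "y \<notin> support_in \<Omega> f"
      then have y: "y \<in> ?S" using elim by simp
      then have "y \<in> \<Union>((\<lambda>x. ball x (e x)) ` ?S)" using e[OF y] by (auto intro!: bexI[of _ y])
      then show False using F(3) elim(1) \<open>f y \<noteq> 0\<close> by auto
    qed
  qed
qed

text \<open>On the support a/\<alpha> \<ge> 1, so a nonnegative power of it may be inserted as a
  factor; elsewhere f vanishes almost everywhere. It serves \<open>b\<close> with t = q*/q and, in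
  case (iii), \<open>c\<close> with t = r/q.\<close>

lemma le_weight_of_inf_on_support:
  fixes a f :: "real^'n \<Rightarrow> real"
  assumes \<Omega>: "open \<Omega>" and B: "AE x in lebesgue_on \<Omega>. f x \<le> B" "0 \<le> B"
    and \<alpha>: "0 < \<alpha>" "ereal \<alpha> \<le> inf_on_support \<Omega> a f" and t: "0 \<le> t"
  shows "AE x in lebesgue_on \<Omega>. f x \<le> B * \<alpha> powr (- t) * a x powr t"
  using B(1) vanishes_off_support_AE[OF \<Omega>, of f]
proof eventually_elim
  case (elim x)
  show ?case
  proof (cases "f x = 0")
    case True
    then show ?thesis using B by simp
  next
    case False
    then have "inf_on_support \<Omega> a f \<le> ereal (a x)"
      using elim unfolding inf_on_support_def by (intro INF_lower) auto
    then have "ereal \<alpha> \<le> ereal (a x)" using \<alpha>(2) by (rule order_trans[rotated])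
    then have "\<alpha> powr t \<le> a x powr t" using \<alpha> t by (intro powr_mono2) auto
    then have "1 \<le> \<alpha> powr (- t) * a x powr t"
      using \<alpha> by (simp add: powr_minus divide_simps)
    then have "B * 1 \<le> B * (\<alpha> powr (- t) * a x powr t)" using B by (intro mult_left_mono)
    then show ?thesis using elim by (simp add: mult.assoc)
  qed
qed

lemma Linf_AE_bound:
  assumes "b \<in> Linf \<Omega>" shows "AE x in lebesgue_on \<Omega>. \<bar>b x\<bar> \<le> \<bar>Linf_norm \<Omega> b\<bar>"
proof -
  let ?e = "esssup (lebesgue_on \<Omega>) (\<lambda>x. ereal \<bar>b x\<bar>)"
  have "AE x in lebesgue_on \<Omega>. ereal \<bar>b x\<bar> \<le> ?e" by (rule esssup_AE)
  then show ?thesis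
  proof eventually_elim
    case (elim x)
    have "?e < \<infinity>" using assms by (simp add: Linf_def)
    with elim show ?case unfolding Linf_norm_def by (cases ?e) auto
  qed
qed

text \<open>The range of w is split at the level h = E^(1/s). Below it w^r \<le> h^r, which
  integrates to at most m h^r; above it w^r \<le> h^(r - t) w^t, as r \<le> t. The level is chosen
  so that both parts have the same order E^(r/s).\<close>

lemma nn_integral_powr_interpolate:
  fixes w :: "'a \<Rightarrow> real"
  assumes [measurable]: "w \<in> borel_measurable M" and w: "\<And>x. 0 \<le> w x" and m: "emeasure M (space M) = ennreal m" "0 \<le> m"
    and s: "0 < s" and r: "0 < r" "r \<le> t" and E: "0 < E" and K: "0 \<le> K"
    and le: "(\<integral>\<^sup>+x. ennreal (w x powr t) \<partial>M) \<le> ennreal (K * E powr (t / s))"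
  shows "(\<integral>\<^sup>+x. ennreal (w x powr r) \<partial>M) \<le> ennreal ((m + K) * E powr (r / s))"
proof -
  define h where "h = E powr (1 / s)"
  have h: "0 < h" using E by (simp add: h_def)
  have hp: "h powr z = E powr (z / s)" for z by (simp add: h_def powr_powr)
  have "w x powr r \<le> h powr r + h powr (r - t) * w x powr t" for x
  proof (cases "w x \<le> h")
    case True
    then have "w x powr r \<le> h powr r" using w r by (intro powr_mono2) auto
    then show ?thesis by (simp add: add_increasing2)
  next
    case False
    then have wx: "h \<le> w x" "0 < w x" using h by auto
    have "w x powr r = w x powr (r - t) * w x powr t" using wx by (simp add: powr_add[symmetric])
    also have "\<dots> \<le> h powr (r - t) * w x powr t"
      using wx h r by (intro mult_right_mono powr_mono2') auto
    finally show ?thesis by (simp add: add_increasing)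
  qed
  then have "(\<integral>\<^sup>+x. ennreal (w x powr r) \<partial>M) \<le> (\<integral>\<^sup>+x. ennreal (h powr r) + ennreal (h powr (r - t)) * ennreal (w x powr t) \<partial>M)"
    by (intro nn_integral_mono) (simp add: ennreal_mult[symmetric] ennreal_plus[symmetric] ennreal_leI del: ennreal_plus)
  also have "\<dots> = ennreal (h powr r) * ennreal m + ennreal (h powr (r - t)) * (\<integral>\<^sup>+x. ennreal (w x powr t) \<partial>M)"
    by (subst nn_integral_add) (auto simp: nn_integral_cmult m)
  also have "\<dots> \<le> ennreal (h powr r) * ennreal m + ennreal (h powr (r - t)) * ennreal (K * E powr (t / s))"
    by (intro add_left_mono mult_left_mono le) auto
  also have "\<dots> = ennreal (h powr r * m + h powr (r - t) * (K * E powr (t / s)))"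
    using m K by (simp add: ennreal_mult[symmetric] ennreal_plus[symmetric] del: ennreal_plus)
  also have "h powr r * m + h powr (r - t) * (K * E powr (t / s)) = (m + K) * E powr (r / s)"
  proof -
    have "h powr (r - t) * E powr (t / s) = E powr (r / s)"
      unfolding hp by (simp add: powr_add[symmetric] diff_divide_distrib)
    then show ?thesis by (simp add: hp algebra_simps)
  qed
  finally show ?thesis .
qed

text \<open>Divided by E, each term on the left becomes a constant times a positive power of E, and
  the sum tends to 0.\<close>

lemma superlinear_bound_fails:
  fixes \<beta>1 \<beta>2 \<beta>3 :: real
  assumes "1 < \<beta>1" "1 < \<beta>2" "1 < \<beta>3"
  shows "\<exists>t>0. \<forall>E. 0 < E \<and> E < t \<longrightarrow> K1 * E powr \<beta>1 + K2 * E powr \<beta>2 + K3 * E powr \<beta>3 < E"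
proof -
  have lim: "((\<lambda>E. E powr (\<beta> - 1)) \<longlongrightarrow> 0) (at_right 0)" if "1 < \<beta>" for \<beta> :: real
  proof -
    have "((\<lambda>E. E powr (\<beta> - 1)) \<longlongrightarrow> 0 powr (\<beta> - 1)) (at_right 0)"
      using that by (intro tendsto_powr2 tendsto_intros) (auto simp: eventually_at_right_less eventually_at_filter)
    then show ?thesis by simp
  qed
  have "((\<lambda>E. K1 * E powr (\<beta>1 - 1) + K2 * E powr (\<beta>2 - 1) + K3 * E powr (\<beta>3 - 1)) \<longlongrightarrow> K1 * 0 + K2 * 0 + K3 * 0) (at_right 0)"
    using assms by (intro tendsto_intros lim)
  then have "\<forall>\<^sub>F E in at_right 0. K1 * E powr (\<beta>1 - 1) + K2 * E powr (\<beta>2 - 1) + K3 * E powr (\<beta>3 - 1) < 1"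
    by (intro order_tendstoD(2)) auto
  then obtain t where t: "0 < t" "\<And>E. 0 < E \<Longrightarrow> E < t \<Longrightarrow>
      K1 * E powr (\<beta>1 - 1) + K2 * E powr (\<beta>2 - 1) + K3 * E powr (\<beta>3 - 1) < 1"
    by (auto simp: eventually_at_right_field)
  show ?thesis
  proof (intro exI[of _ t] conjI allI impI t(1))
    fix E assume "0 < E \<and> E < t"
    then have E: "0 < E" "E < t" by auto
    have "E * (K1 * E powr (\<beta>1 - 1) + K2 * E powr (\<beta>2 - 1) + K3 * E powr (\<beta>3 - 1)) < E * 1"
      using t(2)[OF E] E(1) by (rule mult_strict_left_mono)
    moreover have "E * (K * E powr (\<beta> - 1)) = K * E powr \<beta>" for K \<beta>
      using E(1) by (simp add: powr_diff)
    ultimately show "K1 * E powr \<beta>1 + K2 * E powr \<beta>2 + K3 * E powr \<beta>3 < E"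
      by (simp only: distrib_left mult_1_right)
  qed
qed

text \<open>The solution is itself an admissible test function. The integrability built into
  \<open>weak_solution\<close> and the signs of both integrands carry the identity over to
  \<open>ennreal\<close> integrals, where the terms can be split and bounded without knowing
  beforehand that each is integrable.\<close>

lemma weak_solution_Nehari:
  assumes sol: "weak_solution \<Omega> p q a (nonlinearity p q r \<mu> c b) (u :: real^'n \<Rightarrow> real)"
    and a0: "\<And>x. x \<in> \<Omega> \<Longrightarrow> 0 \<le> a x" and c0: "\<And>x. x \<in> \<Omega> \<Longrightarrow> 0 \<le> c x" and \<mu>: "0 \<le> \<mu>"
    and b0: "AE x in lebesgue_on \<Omega>. 0 \<le> b x"
  shows "(\<integral>\<^sup>+x. ennreal (norm (weak_grad \<Omega> u x) powr p + a x * norm (weak_grad \<Omega> u x) powr q) \<partial>lebesgue_on \<Omega>)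
    = (\<integral>\<^sup>+x. ennreal (c x * \<bar>u x\<bar> powr r + \<mu> * \<bar>u x\<bar> powr crit_exp (real CARD('n)) p
        + b x * \<bar>u x\<bar> powr crit_exp (real CARD('n)) q) \<partial>lebesgue_on \<Omega>)"
proof -
  let ?G = "weak_grad \<Omega> u" and ?M = "lebesgue_on \<Omega>"
  have u: "u \<in> W01A \<Omega> p q a" using sol by (simp add: weak_solution_def)
  \<comment> \<open>At t = 0 both sides are 0 for every z, since \<open>0 powr z\<close> is 0;
    exponents z - 2 below 0 are therefore harmless.\<close>
  have pw: "\<bar>t\<bar> powr (z - 2) * t * t = \<bar>t\<bar> powr z" for t z :: real
  proof (cases "t = 0")
    case False
    then have "\<bar>t\<bar> powr z = \<bar>t\<bar> powr (z - 2) * \<bar>t\<bar> powr 2"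
      unfolding powr_add[symmetric] by simp
    then show ?thesis using False by (simp add: power2_eq_square)
  qed simp
  have flux: "flux p q a x (?G x) \<bullet> ?G x = norm (?G x) powr p + a x * norm (?G x) powr q" for x
  proof -
    have "flux p q a x (?G x) \<bullet> ?G x = (norm (?G x) powr (p - 2) + a x * norm (?G x) powr (q - 2)) * (norm (?G x) * norm (?G x))"
      by (simp add: flux_def dot_square_norm power2_eq_square)
    also have "\<dots> = norm (?G x) powr p + a x * norm (?G x) powr q"
      using pw[of "norm (?G x)" p] pw[of "norm (?G x)" q] by (simp add: algebra_simps)
    finally show ?thesis .
  qed
  have rhs: "nonlinearity p q r \<mu> c b x (u x) * u x = c x * \<bar>u x\<bar> powr r + \<mu> * \<bar>u x\<bar> powr crit_exp (real CARD('n)) p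
        + b x * \<bar>u x\<bar> powr crit_exp (real CARD('n)) q" for x
    using pw[of "u x" r] pw[of "u x" "crit_exp (real CARD('n)) p"] pw[of "u x" "crit_exp (real CARD('n)) q"]
    by (simp add: nonlinearity_def algebra_simps)
  have *: "integrable ?M (\<lambda>x. norm (?G x) powr p + a x * norm (?G x) powr q)"
    "integrable ?M (\<lambda>x. c x * \<bar>u x\<bar> powr r + \<mu> * \<bar>u x\<bar> powr crit_exp (real CARD('n)) p
        + b x * \<bar>u x\<bar> powr crit_exp (real CARD('n)) q)"
    "(LINT x|?M. norm (?G x) powr p + a x * norm (?G x) powr q) = (LINT x|?M. c x * \<bar>u x\<bar> powr r + \<mu> * \<bar>u x\<bar> powr crit_exp (real CARD('n)) p
        + b x * \<bar>u x\<bar> powr crit_exp (real CARD('n)) q)"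
    using sol u unfolding weak_solution_def flux[symmetric] rhs[symmetric] by blast+
  have n1: "AE x in ?M. 0 \<le> norm (?G x) powr p + a x * norm (?G x) powr q"
    using a0 by (intro AE_I2) (simp add: add_nonneg_nonneg)
  have n2: "AE x in ?M. 0 \<le> c x * \<bar>u x\<bar> powr r + \<mu> * \<bar>u x\<bar> powr crit_exp (real CARD('n)) p
        + b x * \<bar>u x\<bar> powr crit_exp (real CARD('n)) q"
    using b0 AE_space by eventually_elim (use c0 \<mu> in \<open>auto intro!: add_nonneg_nonneg\<close>)
  show ?thesis
    unfolding nn_integral_eq_integral[OF *(1) n1] nn_integral_eq_integral[OF *(2) n2] *(3) ..
qed

theorem theorem2p13:
  fixes \<Omega> :: "(real^'n) set"
    and p q r \<mu> b_inf :: real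
    and a0 :: ereal
    and a c :: "real^'n \<Rightarrow> real"
  assumes dim: "CARD('n) \<ge> 2"
    and domain: "bounded \<Omega>" "C1_domain \<Omega>" "starshaped_origin \<Omega>"
    and exponents: "1 < p" "p < q" "q < real CARD('n)"
      "q / p \<le> real CARD('n) / (real CARD('n) - 1)"
    and a_standing: "a \<in> Linf \<Omega>" "holder_on (real CARD('n) / p * (q - p)) \<Omega> a"
    and a_hyps: "\<forall>x\<in>\<Omega>. 0 \<le> a x" "Ck_on 1 \<Omega> a" "radial_nondecreasing_on \<Omega> a"
    and mu: "0 \<le> \<mu>"
    and c_hyps: "continuous_on (closure \<Omega>) c" "\<forall>x\<in>closure \<Omega>. 0 \<le> c x"
      "\<exists>x\<in>closure \<Omega>. c x \<noteq> 0"
    and a0_pos: "0 < a0"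
    and cases:
      "(p < r \<and> r \<le> crit_exp (real CARD('n)) p)
       \<or> (crit_exp (real CARD('n)) p < r \<and> r < crit_exp (real CARD('n)) q \<and>
           (\<exists>C>0. AE x in lebesgue_on \<Omega>. c x \<le> C * a x powr (r / q)))
       \<or> (crit_exp (real CARD('n)) p < r \<and> r < crit_exp (real CARD('n)) q \<and>
           0 < inf_on_support \<Omega> a c)"
  shows "\<exists>\<kappa>>0. \<forall>b. b \<in> Linf \<Omega> \<and> (AE x in lebesgue_on \<Omega>. 0 \<le> b x) \<and>
            inf_on_support \<Omega> a b = a0 \<and> Linf_norm \<Omega> b = b_inf \<longrightarrow>
          \<not> (\<exists>u. weak_solution \<Omega> p q a (nonlinearity p q r \<mu> c b) u \<and>
                 u \<in> W01A \<Omega> p q a \<inter> W2A \<Omega> p q a \<and>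
                 \<not> (AE x in lebesgue_on \<Omega>. u x = 0) \<and>
                 W01A_norm \<Omega> p q a u \<le> \<kappa>)"
proof -
  let ?M = "lebesgue_on \<Omega>"
  define N where "N = real CARD('n)"
  define \<kappa>p where "\<kappa>p = N / (N - p)"
  define \<kappa>q where "\<kappa>q = N / (N - q)"
  define ps where "ps = crit_exp N p"
  define qs where "qs = crit_exp N q"
  have N: "2 \<le> N" "p < N" "q < N" using dim exponents by (auto simp: N_def)
  have pq: "1 < p" "1 < q" using exponents by auto
  have ps: "ps = p * \<kappa>p" "ps / p = \<kappa>p" and qs: "qs = q * \<kappa>q" "qs / q = \<kappa>q"
    using pq by (simp_all add: ps_def qs_def \<kappa>p_def \<kappa>q_def crit_exp_def)
  have \<kappa>: "1 < \<kappa>p" "1 < \<kappa>q" using N pq by (simp_all add: \<kappa>p_def \<kappa>q_def)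
  have "q \<le> N * p / (N - 1)"
    using exponents(4) N pq by (simp add: N_def[symmetric] divide_simps mult.commute)
  also have "\<dots> < ps" unfolding ps_def crit_exp_def
    using N pq by (intro divide_strict_left_mono mult_pos_pos) auto
  finally have q_less: "q < ps" .
  have \<Omega>: "open \<Omega>" using domain(2) by (simp add: C1_domain_def)
  have "Ck_on (Suc 0) \<Omega> a" using a_hyps(2) by (simp only: One_nat_def)
  then have a: "continuous_on \<Omega> a" "\<And>x. x \<in> \<Omega> \<Longrightarrow> 0 \<le> a x"
    using Ck_on_Suc_imp[of 0 \<Omega> a] a_hyps(1) by auto
  have am[measurable]: "a \<in> borel_measurable ?M"
    using a(1) \<Omega> by (intro continuous_imp_measurable_on_sets_lebesgue) auto
  have a_mono: "a x \<le> a y" if "x \<in> \<Omega>" "y \<in> \<Omega>" "norm x \<le> norm y" for x y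
  proof -
    obtain g where g: "\<forall>x\<in>\<Omega>. a x = g (norm x)" "mono_on (norm ` \<Omega>) g"
      using a_hyps(3) by (auto simp: radial_nondecreasing_on_def)
    then show ?thesis using mono_onD[OF g(2), of "norm x" "norm y"] that by auto
  qed
  have "emeasure ?M (space ?M) = emeasure lebesgue \<Omega>" using \<Omega> by (simp add: emeasure_restrict_space)
  also have "\<dots> < \<infinity>" using domain(1) \<Omega> by (intro emeasure_bounded_finite[THEN le_less_trans[rotated]]) (auto)
  finally obtain m where m: "emeasure ?M (space ?M) = ennreal m" "0 \<le> m"
    by (cases "emeasure ?M (space ?M)") auto
  have c0: "0 \<le> c x" if "x \<in> \<Omega>" for x using c_hyps(2) closure_subset that by blast
  have "bounded (c ` closure \<Omega>)"
    using domain(1) c_hyps(1) by (intro compact_imp_bounded compact_continuous_image) auto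
  then obtain C0 where C0: "\<forall>x\<in>closure \<Omega>. \<bar>c x\<bar> \<le> C0" unfolding bounded_iff by auto
  have c_le: "c x \<le> \<bar>C0\<bar>" if "x \<in> \<Omega>" for x using C0 closure_subset that by force
  have cm[measurable]: "c \<in> borel_measurable ?M"
    using continuous_on_subset[OF c_hyps(1) closure_subset] \<Omega>
    by (intro continuous_imp_measurable_on_sets_lebesgue) auto
  \<comment> \<open>The constants of the Sobolev inequality on \<open>W01A\<close>, including the
    factor 2^s of the approximation, with the power of the gradient integral taken out.\<close>
  define Cp where "Cp = (p * (N - 1) / (N - p)) powr (p * \<kappa>p) * (2 powr p) powr \<kappa>p"
  define Cq where "Cq = (q * (N - 1) / (N - q)) powr (q * \<kappa>q) * (2 powr q) powr \<kappa>q"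
  have Cpq: "0 \<le> Cp" "0 \<le> Cq" by (simp_all add: Cp_def Cq_def)
  \<comment> \<open>The three cases meet in one statement: the \<open>c\<close> term is at most Kc
    E^\<beta> with \<beta> > 1, namely \<beta> = r/p in case (i) and \<beta> = r/q otherwise.
    \<open>Kc\<close> and \<beta> precede u and E, so they depend on the data alone.\<close>
  have "\<exists>Kc \<beta>. 0 \<le> Kc \<and> 1 < \<beta> \<and> (\<forall>u E. u \<in> borel_measurable ?M \<longrightarrow> 0 < E \<longrightarrow>
      (\<integral>\<^sup>+x. ennreal (\<bar>u x\<bar> powr ps) \<partial>?M) \<le> ennreal (Cp * E powr \<kappa>p) \<longrightarrow>
      (\<integral>\<^sup>+x. ennreal (a x powr \<kappa>q * \<bar>u x\<bar> powr qs) \<partial>?M) \<le> ennreal (Cq * E powr \<kappa>q) \<longrightarrow>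
      (\<integral>\<^sup>+x. ennreal (c x * \<bar>u x\<bar> powr r) \<partial>?M) \<le> ennreal (Kc * E powr \<beta>))"
  proof -
    have weighted: ?thesis
      if r: "ps < r" "r < qs" and D: "0 \<le> D" "AE x in ?M. c x \<le> D * a x powr (r / q)" for D
    proof (rule exI[of _ "D * (m + Cq)"], rule exI[of _ "r / q"], intro conjI allI impI)
      show "1 < r / q" using r q_less pq by simp
      show "0 \<le> D * (m + Cq)" using D m Cpq by simp
      fix u E assume [measurable]: "u \<in> borel_measurable ?M" and E: "0 < (E::real)"
        and V: "(\<integral>\<^sup>+x. ennreal (a x powr \<kappa>q * \<bar>u x\<bar> powr qs) \<partial>?M) \<le> ennreal (Cq * E powr \<kappa>q)"
      define w where "w x = a x powr (1 / q) * \<bar>u x\<bar>" for x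
      have wp: "w x powr z = a x powr (z / q) * \<bar>u x\<bar> powr z" for x z
        by (simp add: w_def powr_mult powr_powr)
      have [measurable]: "w \<in> borel_measurable ?M" unfolding w_def[abs_def] by measurable
      have "(\<integral>\<^sup>+x. ennreal (c x * \<bar>u x\<bar> powr r) \<partial>?M) \<le> (\<integral>\<^sup>+x. ennreal D * ennreal (w x powr r) \<partial>?M)"
      proof (rule nn_integral_mono_AE)
        show "AE x in ?M. ennreal (c x * \<bar>u x\<bar> powr r) \<le> ennreal D * ennreal (w x powr r)"
          using D(2)
        proof eventually_elim
          case (elim x)
          then have "c x * \<bar>u x\<bar> powr r \<le> (D * a x powr (r / q)) * \<bar>u x\<bar> powr r" by (rule mult_right_mono) simp
          then show ?case using D by (simp add: wp mult.assoc ennreal_mult[symmetric] ennreal_leI)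
        qed
      qed
      also have "\<dots> = ennreal D * (\<integral>\<^sup>+x. ennreal (w x powr r) \<partial>?M)"
        by (intro nn_integral_cmult) measurable
      also have "\<dots> \<le> ennreal D * ennreal ((m + Cq) * E powr (r / q))"
      proof (intro mult_left_mono nn_integral_powr_interpolate[OF _ _ m _ _ _ E Cpq(2)])
        show "(\<integral>\<^sup>+x. ennreal (w x powr qs) \<partial>?M) \<le> ennreal (Cq * E powr (qs / q))"
          using V by (simp add: wp qs(2))
      qed (use pq r q_less in \<open>auto simp: w_def[abs_def]\<close>)
      also have "\<dots> = ennreal (D * (m + Cq) * E powr (r / q))"
        using D m Cpq by (simp add: ennreal_mult[symmetric] mult.assoc)
      finally show "(\<integral>\<^sup>+x. ennreal (c x * \<bar>u x\<bar> powr r) \<partial>?M) \<le> ennreal (D * (m + Cq) * E powr (r / q))" .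
    qed
    consider "p < r" "r \<le> ps"
      | C where "ps < r" "r < qs" "0 < C" "AE x in ?M. c x \<le> C * a x powr (r / q)"
      | "ps < r" "r < qs" "0 < inf_on_support \<Omega> a c"
      using cases unfolding ps_def qs_def N_def by blast
    then show ?thesis
    proof cases
      case 1
      show ?thesis
      proof (rule exI[of _ "\<bar>C0\<bar> * (m + Cp)"], rule exI[of _ "r / p"], intro conjI allI impI)
        show "1 < r / p" using 1 pq by simp
        show "0 \<le> \<bar>C0\<bar> * (m + Cp)" using m Cpq by simp
        fix u E assume [measurable]: "u \<in> borel_measurable ?M" and E: "0 < (E::real)"
          and U: "(\<integral>\<^sup>+x. ennreal (\<bar>u x\<bar> powr ps) \<partial>?M) \<le> ennreal (Cp * E powr \<kappa>p)"
        have "(\<integral>\<^sup>+x. ennreal (c x * \<bar>u x\<bar> powr r) \<partial>?M) \<le> (\<integral>\<^sup>+x. ennreal \<bar>C0\<bar> * ennreal (\<bar>u x\<bar> powr r) \<partial>?M)"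
          using c_le by (intro nn_integral_mono) (auto simp: ennreal_mult[symmetric] intro!: ennreal_leI mult_right_mono)
        also have "\<dots> = ennreal \<bar>C0\<bar> * (\<integral>\<^sup>+x. ennreal (\<bar>u x\<bar> powr r) \<partial>?M)"
          by (intro nn_integral_cmult) measurable
        also have "\<dots> \<le> ennreal \<bar>C0\<bar> * ennreal ((m + Cp) * E powr (r / p))"
          using 1 pq U by (intro mult_left_mono nn_integral_powr_interpolate[OF _ _ m _ _ _ E Cpq(1)]) (auto simp: ps(2))
        also have "\<dots> = ennreal (\<bar>C0\<bar> * (m + Cp) * E powr (r / p))"
          using m Cpq by (simp add: ennreal_mult[symmetric] mult.assoc)
        finally show "(\<integral>\<^sup>+x. ennreal (c x * \<bar>u x\<bar> powr r) \<partial>?M) \<le> ennreal (\<bar>C0\<bar> * (m + Cp) * E powr (r / p))" .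
      qed
    next
      case 2
      then show ?thesis by (intro weighted[of C]) auto
    next
      case 3
      obtain \<alpha> where \<alpha>: "0 < \<alpha>" "ereal \<alpha> < inf_on_support \<Omega> a c"
        using ereal_dense2[OF 3(3)] by auto
      have "AE x in ?M. c x \<le> \<bar>C0\<bar> * \<alpha> powr (- (r / q)) * a x powr (r / q)"
        using \<alpha> 3 q_less pq c_le by (intro le_weight_of_inf_on_support[OF \<Omega>] AE_I2) auto
      then show ?thesis using 3 by (intro weighted[of "\<bar>C0\<bar> * \<alpha> powr (- (r / q))"]) auto
    qed
  qed
  then obtain Kc \<beta> where Kc: "0 \<le> Kc" and \<beta>: "1 < \<beta>" and c_bound: "\<And>u E. u \<in> borel_measurable ?M \<Longrightarrow> 0 < E \<Longrightarrow>
      (\<integral>\<^sup>+x. ennreal (\<bar>u x\<bar> powr ps) \<partial>?M) \<le> ennreal (Cp * E powr \<kappa>p) \<Longrightarrow>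
      (\<integral>\<^sup>+x. ennreal (a x powr \<kappa>q * \<bar>u x\<bar> powr qs) \<partial>?M) \<le> ennreal (Cq * E powr \<kappa>q) \<Longrightarrow>
      (\<integral>\<^sup>+x. ennreal (c x * \<bar>u x\<bar> powr r) \<partial>?M) \<le> ennreal (Kc * E powr \<beta>)"
    by (elim exE conjE) (rule that, auto)
  \<comment> \<open>\<open>a0\<close> may be infinite, so a real \<alpha> below it is used. It is
    fixed before \<open>b\<close>, which makes \<open>Kb\<close> and the radius uniform in
    \<open>b\<close>.\<close>
  obtain \<alpha> where \<alpha>: "0 < \<alpha>" "ereal \<alpha> < a0" using ereal_dense2[OF a0_pos] by auto
  define Kb where "Kb = \<bar>b_inf\<bar> * \<alpha> powr (- \<kappa>q)"
  have Kb: "0 \<le> Kb" by (simp add: Kb_def)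
  obtain t where t: "0 < t" and small: "\<And>E. 0 < E \<Longrightarrow> E < t \<Longrightarrow>
      Kc * E powr \<beta> + \<mu> * Cp * E powr \<kappa>p + Kb * Cq * E powr \<kappa>q < E"
    using superlinear_bound_fails[OF \<beta> \<kappa>, of Kc "\<mu> * Cp" "Kb * Cq"] by auto
  \<comment> \<open>A norm of at most \<kappa> is strictly below 2 \<kappa>, as
    \<open>LA_norm_less\<close> requires. Since 2 \<kappa> \<le> 1 and p, q > 1, both phases P and Q
    of the energy are at most 2 \<kappa>, so P + Q \<le> 4 \<kappa> < t.\<close>
  define \<kappa> where "\<kappa> = min (1 / 2) (t / 8)"
  have \<kappa>0: "0 < \<kappa>" "2 * \<kappa> \<le> 1" "4 * \<kappa> < t" using t by (auto simp: \<kappa>_def)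
  have False
    if b: "b \<in> Linf \<Omega>" "AE x in ?M. 0 \<le> b x" "inf_on_support \<Omega> a b = a0" "Linf_norm \<Omega> b = b_inf"
      and sol: "weak_solution \<Omega> p q a (nonlinearity p q r \<mu> c b) u"
      and nz: "\<not> (AE x in ?M. u x = 0)" and norm_u: "W01A_norm \<Omega> p q a u \<le> \<kappa>" for b u
  proof -
    define G where "G = weak_grad \<Omega> u"
    have u: "u \<in> W01A \<Omega> p q a" using sol by (simp add: weak_solution_def)
    have um[measurable]: "u \<in> borel_measurable ?M" and G: "(\<lambda>x. norm (G x)) \<in> LA \<Omega> p q a"
      using u by (auto simp: W01A_def W1A_def LA_def G_def)
    have Gm[measurable]: "(\<lambda>x. norm (G x)) \<in> borel_measurable ?M" using G by (simp add: LA_def)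
    have bm[measurable]: "b \<in> borel_measurable ?M" using b(1) by (simp add: Linf_def)
    have "LA_norm \<Omega> p q a (\<lambda>x. norm (G x)) < 2 * \<kappa>"
      using norm_u \<kappa>0 by (simp add: W01A_norm_def G_def)
    note le = LA_norm_less[OF pq am a(2) G this, unfolded abs_norm_cancel]
    obtain P where P: "(\<integral>\<^sup>+x. ennreal (norm (G x) powr p) \<partial>?M) = ennreal P" "0 \<le> P"
      using le(1) by (cases "\<integral>\<^sup>+x. ennreal (norm (G x) powr p) \<partial>?M") (auto simp: top_unique)
    obtain Q where Q: "(\<integral>\<^sup>+x. ennreal (a x * norm (G x) powr q) \<partial>?M) = ennreal Q" "0 \<le> Q"
      using le(2) by (cases "\<integral>\<^sup>+x. ennreal (a x * norm (G x) powr q) \<partial>?M") (auto simp: top_unique)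
    have powr_le: "(2 * \<kappa>) powr s \<le> 2 * \<kappa>" if "1 < s" for s
      using powr_mono'[of 1 s "2 * \<kappa>"] that \<kappa>0 by simp
    have "P \<le> 2 * \<kappa>" "Q \<le> 2 * \<kappa>"
      using le P Q powr_le[OF pq(1)] powr_le[OF pq(2)] by (auto simp: ennreal_le_iff intro: order_trans)
    then have E_small: "P + Q < t" using \<kappa>0 by linarith
    have U: "(\<integral>\<^sup>+x. ennreal (\<bar>u x\<bar> powr ps) \<partial>?M) \<le> ennreal (Cp * P powr \<kappa>p)"
    proof -
      have "(\<integral>\<^sup>+x. ennreal (1 powr \<kappa>p * \<bar>u x\<bar> powr (p * \<kappa>p)) \<partial>?M)
          \<le> ennreal ((p * (N - 1) / (N - p)) powr (p * \<kappa>p) * (2 powr p * P) powr \<kappa>p)"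
        unfolding \<kappa>p_def N_def
        by (rule Sobolev_W01A[OF pq \<Omega> a _ _ _ dim pq(1) _ _ u])
          (use P N in \<open>auto simp: G_def N_def[symmetric]\<close>)
      then show ?thesis using P(2) by (simp add: ps(1) Cp_def powr_mult mult.assoc)
    qed
    \<comment> \<open>The weighted Sobolev inequality with W = a; this is where the radial
      monotonicity of \<open>a\<close> enters.\<close>
    have V: "(\<integral>\<^sup>+x. ennreal (a x powr \<kappa>q * \<bar>u x\<bar> powr qs) \<partial>?M) \<le> ennreal (Cq * Q powr \<kappa>q)"
    proof -
      have "(\<integral>\<^sup>+x. ennreal (a x powr \<kappa>q * \<bar>u x\<bar> powr (q * \<kappa>q)) \<partial>?M)
          \<le> ennreal ((q * (N - 1) / (N - q)) powr (q * \<kappa>q) * (2 powr q * Q) powr \<kappa>q)"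
        unfolding \<kappa>q_def N_def
        by (rule Sobolev_W01A[OF pq \<Omega> a a a_mono dim pq(2) _ _ u])
          (use Q N in \<open>auto simp: G_def N_def[symmetric]\<close>)
      then show ?thesis using Q(2) by (simp add: qs(1) Cq_def powr_mult mult.assoc)
    qed
    \<comment> \<open>If the energy is 0, then \<open>U\<close> already gives u = 0 almost
      everywhere. Otherwise E = P + Q lies strictly between 0 and t, and the energy identity bounds
      E by the sum that \<open>small\<close> places strictly below E.\<close>
    show False
    proof (cases "P + Q = 0")
      case True
      then have "P = 0" using P Q by linarith
      then have "(\<integral>\<^sup>+x. ennreal (\<bar>u x\<bar> powr ps) \<partial>?M) = 0" using U by simp
      then have "AE x in ?M. ennreal (\<bar>u x\<bar> powr ps) = 0" by (subst (asm) nn_integral_0_iff_AE) auto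
      then have "AE x in ?M. u x = 0" by eventually_elim auto
      then show False using nz by simp
    next
      case False
      define E where "E = P + Q"
      have E: "0 < E" "P \<le> E" "Q \<le> E" using False P Q by (auto simp: E_def)
      have U': "(\<integral>\<^sup>+x. ennreal (\<bar>u x\<bar> powr ps) \<partial>?M) \<le> ennreal (Cp * E powr \<kappa>p)"
        using E P \<kappa> Cpq by (intro order_trans[OF U] ennreal_leI mult_left_mono powr_mono2) auto
      have V': "(\<integral>\<^sup>+x. ennreal (a x powr \<kappa>q * \<bar>u x\<bar> powr qs) \<partial>?M) \<le> ennreal (Cq * E powr \<kappa>q)"
        using E Q \<kappa> Cpq by (intro order_trans[OF V] ennreal_leI mult_left_mono powr_mono2) auto
      note cb = c_bound[OF um E(1) U' V']
      have "AE x in ?M. b x \<le> \<bar>b_inf\<bar>" using Linf_AE_bound[OF b(1)] b(4) by (auto elim: eventually_mono)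
      then have b_le: "AE x in ?M. b x \<le> Kb * a x powr \<kappa>q" unfolding Kb_def
        using \<alpha> b(3) \<kappa> by (intro le_weight_of_inf_on_support[OF \<Omega>]) auto
      have "(\<integral>\<^sup>+x. ennreal (b x * \<bar>u x\<bar> powr qs) \<partial>?M) \<le> (\<integral>\<^sup>+x. ennreal Kb * ennreal (a x powr \<kappa>q * \<bar>u x\<bar> powr qs) \<partial>?M)"
      proof (rule nn_integral_mono_AE)
        show "AE x in ?M. ennreal (b x * \<bar>u x\<bar> powr qs) \<le> ennreal Kb * ennreal (a x powr \<kappa>q * \<bar>u x\<bar> powr qs)"
          using b_le
        proof eventually_elim
          case (elim x)
          then have "b x * \<bar>u x\<bar> powr qs \<le> Kb * a x powr \<kappa>q * \<bar>u x\<bar> powr qs" by (rule mult_right_mono) simp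
          then show ?case using Kb by (simp add: mult.assoc ennreal_mult[symmetric] ennreal_leI)
        qed
      qed
      also have "\<dots> = ennreal Kb * (\<integral>\<^sup>+x. ennreal (a x powr \<kappa>q * \<bar>u x\<bar> powr qs) \<partial>?M)"
        by (intro nn_integral_cmult) measurable
      also have "\<dots> \<le> ennreal Kb * ennreal (Cq * E powr \<kappa>q)" by (intro mult_left_mono V') auto
      finally have bb: "(\<integral>\<^sup>+x. ennreal (b x * \<bar>u x\<bar> powr qs) \<partial>?M) \<le> ennreal Kb * ennreal (Cq * E powr \<kappa>q)" .
      have "ennreal E = (\<integral>\<^sup>+x. ennreal (norm (G x) powr p + a x * norm (G x) powr q) \<partial>?M)"
      proof -
        have "(\<integral>\<^sup>+x. ennreal (norm (G x) powr p + a x * norm (G x) powr q) \<partial>?M)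
          = (\<integral>\<^sup>+x. ennreal (norm (G x) powr p) + ennreal (a x * norm (G x) powr q) \<partial>?M)"
          using a(2) by (intro nn_integral_cong) simp
        also have "\<dots> = ennreal P + ennreal Q" by (subst nn_integral_add) (auto simp: P(1) Q(1))
        finally show ?thesis using P Q by (simp add: E_def)
      qed
      also have "\<dots> = (\<integral>\<^sup>+x. ennreal (c x * \<bar>u x\<bar> powr r + \<mu> * \<bar>u x\<bar> powr ps + b x * \<bar>u x\<bar> powr qs) \<partial>?M)"
        using weak_solution_Nehari[OF sol a(2) c0 mu b(2)] by (simp add: G_def ps_def qs_def N_def)
      also have "\<dots> = (\<integral>\<^sup>+x. ennreal (c x * \<bar>u x\<bar> powr r) + (ennreal \<mu> * ennreal (\<bar>u x\<bar> powr ps) + ennreal (b x * \<bar>u x\<bar> powr qs)) \<partial>?M)"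
      proof (rule nn_integral_cong_AE)
        show "AE x in ?M. ennreal (c x * \<bar>u x\<bar> powr r + \<mu> * \<bar>u x\<bar> powr ps + b x * \<bar>u x\<bar> powr qs) =
          ennreal (c x * \<bar>u x\<bar> powr r) + (ennreal \<mu> * ennreal (\<bar>u x\<bar> powr ps) + ennreal (b x * \<bar>u x\<bar> powr qs))"
          using b(2) AE_space
        proof eventually_elim
          case (elim x)
          then show ?case using c0[of x] mu by (simp add: ennreal_mult[symmetric] add.assoc)
        qed
      qed
      also have "\<dots> = (\<integral>\<^sup>+x. ennreal (c x * \<bar>u x\<bar> powr r) \<partial>?M) + (ennreal \<mu> * (\<integral>\<^sup>+x. ennreal (\<bar>u x\<bar> powr ps) \<partial>?M)
          + (\<integral>\<^sup>+x. ennreal (b x * \<bar>u x\<bar> powr qs) \<partial>?M))"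
        by (simp add: nn_integral_add nn_integral_cmult)
      also have "\<dots> \<le> ennreal (Kc * E powr \<beta>) + (ennreal \<mu> * ennreal (Cp * E powr \<kappa>p) + ennreal Kb * ennreal (Cq * E powr \<kappa>q))"
        by (intro add_mono mult_left_mono cb U' bb) auto
      also have "\<dots> = ennreal (Kc * E powr \<beta> + \<mu> * Cp * E powr \<kappa>p + Kb * Cq * E powr \<kappa>q)"
        using Kc Kb mu Cpq by (simp add: ennreal_mult[symmetric] ennreal_plus[symmetric] add.assoc mult.assoc del: ennreal_plus)
      finally have "E \<le> Kc * E powr \<beta> + \<mu> * Cp * E powr \<kappa>p + Kb * Cq * E powr \<kappa>q"
        using Kc Kb mu Cpq by (subst (asm) ennreal_le_iff) auto
      then show False using small[OF E(1)] E_small by (simp add: E_def)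
    qed
  qed
  then show ?thesis using \<kappa>0(1) by (intro exI[of _ \<kappa>]) blast
qed

end
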